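(* Fix $n\in\mathbb{N}=\{1,2,\ldots\}$ and $1\leq p<2$. Let $\Lambda$ be either $\mathscr{S}_n$ or $\mathscr{B}_n$, and let $\{f_{k}\}_{k\in\mathbb{Z}}$ be a bi-infinite sequence of functions on $\mathcal{X}$ such that for all $k\in\mathbb{Z}$, $\Lambda f_{k}=Af_{k+1}$ for some constant $A\in\mathbb{C}\setminus\{0\}$ (independent of $k$) and $\|f_{k}\|_{L^{p^{\prime},\infty}(\mathcal{X})}\leq M$ for some $M>0$ (independent of $k$). Put $z_{1}=i\delta_{p^{\prime}}$ and $z_{2}=\tau/2+i\delta_{p^{\prime}}$. (i) If $\Lambda=\mathscr{S}_{n}$ and $|A|=\phi_{i\delta_{p^{\prime}}}(n)$, then $f_{0}$ can be uniquely written as $f_{0}=g_{1}+g_{2}$ for some $g_1, g_2\in L^{p^{\prime},\infty}(\mathcal{X})$ satisfying $\mathcal{L}g_{1}=\gamma(i\delta_{p^{\prime}})g_{1}$ and $\mathcal{L}g_{2}=\gamma(\tau/2+i\delta_{p^{\prime}})g_{2}$. In particular, $g_{j}=\mathcal{P}_{z_{j}}G_{j}$ for a unique $G_{j}\in L^{p^{\prime}}(\Omega)$, $j=1,2$. (ii) If $\Lambda =\mathscr{B}_{n}$ and $|A|=\psi_{i\delta_{p^{\prime}}}(n)$, then $\mathcal{L}f_{0}=\gamma(i\delta_{p^{\prime}})f_{0}$. In particular, $f_{0}=\mathcal{P}_{z_{1}}F$ for a unique $F\in L^{p^{\prime}}(\Omega)$.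
   Context: Let $q\geq 2$ be an integer and let $\mathcal{X}$ be the homogeneous tree of degree $q+1$ (the connected graph without cycles in which every vertex has $q+1$ neighbours), identified with its set of vertices, with graph distance $d$, counting measure, a fixed reference vertex $o$, and $|x|=d(o,x)$. $S(x,n)$ and $B(x,n)$ are the sphere $\{y:d(x,y)=n\}$ and the ball $\{y:d(x,y)\le n\}$. $p'$ is the conjugate exponent of $p$ ($p'=\infty$ if $p=1$). For $p\in(1,\infty)$ put $\delta_p=\frac1p-\frac12$; $\delta_1=\frac12=-\delta_\infty$. $\tau=2\pi/\log q$. The Laplacian is $\mathcal{L}f(x)=f(x)-\frac{1}{q+1}\sum_{y:d(x,y)=1}f(y)$, and $\gamma(z)=1-\frac{q^{1/2+iz}+q^{1/2-iz}}{q+1}$ for $z\in\mathbb{C}$. For $r\in[1,\infty)$, $L^{r,\infty}(\mathcal{X})$ is the space of functions $f$ on $\mathcal X$ with $\|f\|_{L^{r,\infty}(\mathcal{X})}=\sup_{t>0}t\,(\#\{x:|f(x)|>t\})^{1/r}<\infty$; $L^{\infty,\infty}(\mathcal{X})=L^\infty(\mathcal{X})$. $\Omega$ is the set of infinite geodesic rays $\omega=\{\omega_0,\omega_1,\dots\}$ starting at $\omega_0=o$; $c(x,\omega)$ is the last vertex of the geodesic path from $o$ to $x$ that lies on $\omega$. $\nu$ is the Borel probability measure on $\Omega$ giving mass $(q+1)^{-1}q^{-n+1}$ to each set $\{\omega:|c(x,\omega)|=|x|\}$ with $|x|=n\ge1$ (these sets, for $x\in\mathcal X$, form a basis of the topology);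 $L^r(\Omega)=L^r(\Omega,\nu)$. With $p(x,\omega)=q^{2|c(x,\omega)|-|x|}$, the Poisson transform of $F$ is $\mathcal{P}_zF(x)=\int_\Omega p^{1/2+iz}(x,\omega)F(\omega)\,d\nu(\omega)$, and $\phi_z=\mathcal{P}_z\mathbf{1}$ is the elementary spherical function, which is radial (depends only on $|x|$); $\phi_z(n)$ denotes its value on $S(o,n)$. Averaging operators: $\mathscr{S}_{n}f(x)=\frac{1}{\# S(o,n)}\sum_{y\in S(x,n)}f(y)$ and $\mathscr{B}_{n}f(x)=\frac{1}{\# B(o,n)}\sum_{y\in B(x,n)}f(y)=\frac{1}{\# B(o,n)}\sum_{j=0}^{n}(\# S(o,j))\mathscr{S}_jf(x)$. Also $\psi_{z}(n)=\frac{1}{\# B(o,n)}\sum_{j=0}^{n}(\# S(o,j))\phi_{z}(j)$. *)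

theory Defs
  imports "HOL-Probability.Probability"
begin

text \<open>
  A graph is a symmetric irreflexive adjacency relation \<open>E\<close> whose vertex set is the whole
  type \<open>'v\<close>; \<open>x0\<close> is the reference vertex of the tree.
\<close>

definition homogeneous_tree :: "nat \<Rightarrow> ('v \<Rightarrow> 'v \<Rightarrow> bool) \<Rightarrow> bool" where
  "homogeneous_tree q E \<longleftrightarrow>
     symp E \<and> irreflp E \<and>
     (\<forall>x y. E\<^sup>*\<^sup>* x y) \<and>
     (\<nexists>xs. 3 \<le> length xs \<and> distinct xs \<and> successively E xs \<and> E (last xs) (hd xs)) \<and>
     (\<forall>x. card {y. E x y} = q + 1)"

definition gdist :: "('v \<Rightarrow> 'v \<Rightarrow> bool) \<Rightarrow> 'v \<Rightarrow> 'v \<Rightarrow> nat" where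
  "gdist E x y = (LEAST n. (E ^^ n) x y)"

definition gsphere :: "('v \<Rightarrow> 'v \<Rightarrow> bool) \<Rightarrow> 'v \<Rightarrow> nat \<Rightarrow> 'v set" where
  "gsphere E x n = {y. gdist E x y = n}"

definition gball :: "('v \<Rightarrow> 'v \<Rightarrow> bool) \<Rightarrow> 'v \<Rightarrow> nat \<Rightarrow> 'v set" where
  "gball E x n = {y. gdist E x y \<le> n}"

definition laplacian :: "nat \<Rightarrow> ('v \<Rightarrow> 'v \<Rightarrow> bool) \<Rightarrow> ('v \<Rightarrow> complex) \<Rightarrow> 'v \<Rightarrow> complex" where
  "laplacian q E f x = f x - (\<Sum>y | gdist E x y = 1. f y) / (of_nat q + 1)"

definition sphere_avg ::
  "('v \<Rightarrow> 'v \<Rightarrow> bool) \<Rightarrow> 'v \<Rightarrow> nat \<Rightarrow> ('v \<Rightarrow> complex) \<Rightarrow> 'v \<Rightarrow> complex" where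
  "sphere_avg E x0 n f x = (\<Sum>y\<in>gsphere E x n. f y) / of_nat (card (gsphere E x0 n))"

definition ball_avg ::
  "('v \<Rightarrow> 'v \<Rightarrow> bool) \<Rightarrow> 'v \<Rightarrow> nat \<Rightarrow> ('v \<Rightarrow> complex) \<Rightarrow> 'v \<Rightarrow> complex" where
  "ball_avg E x0 n f x = (\<Sum>y\<in>gball E x n. f y) / of_nat (card (gball E x0 n))"

definition tau :: "nat \<Rightarrow> real" where
  "tau q = 2 * pi / ln (real q)"

definition gamma :: "nat \<Rightarrow> complex \<Rightarrow> complex" where
  "gamma q z =
     1 - (of_nat q powr (1/2 + \<i> * z) + of_nat q powr (1/2 - \<i> * z)) / (of_nat q + 1)"

text \<open>Exponents in \<open>[1,\<infinity>]\<close> are elements of \<^typ>\<open>ennreal\<close>.\<close>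

definition conj_exponent :: "real \<Rightarrow> ennreal" where
  "conj_exponent p = (if p = 1 then \<infinity> else ennreal (p / (p - 1)))"

definition delta :: "ennreal \<Rightarrow> real" where
  "delta r = (if r = \<infinity> then - 1/2 else 1 / enn2real r - 1/2)"

text \<open>
  The finiteness test is needed because \<^const>\<open>card\<close> is \<open>0\<close> on infinite sets. For
  \<open>r = \<infinity>\<close> and counting measure the norm is the plain supremum.
\<close>

definition weak_norm :: "ennreal \<Rightarrow> ('v \<Rightarrow> complex) \<Rightarrow> ennreal" where
  "weak_norm r f =
     (if r = \<infinity> then (SUP x. ennreal (cmod (f x)))
      else (SUP t\<in>{0<..}.
              if finite {x. t < cmod (f x)}
              then ennreal (t * real (card {x. t < cmod (f x)}) powr (1 / enn2real r))
              else \<infinity>))"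

definition weak_L :: "ennreal \<Rightarrow> ('v \<Rightarrow> complex) set" where
  "weak_L r = {f. weak_norm r f < \<infinity>}"

definition rays :: "('v \<Rightarrow> 'v \<Rightarrow> bool) \<Rightarrow> 'v \<Rightarrow> (nat \<Rightarrow> 'v) set" where
  "rays E x0 = {\<omega>. \<omega> 0 = x0 \<and> (\<forall>m n. m \<le> n \<longrightarrow> gdist E (\<omega> m) (\<omega> n) = n - m)}"

text \<open>The vertices of the (unique) geodesic path from \<open>x\<close> to \<open>y\<close>.\<close>

definition geodesic :: "('v \<Rightarrow> 'v \<Rightarrow> bool) \<Rightarrow> 'v \<Rightarrow> 'v \<Rightarrow> 'v set" where
  "geodesic E x y = {v. gdist E x v + gdist E v y = gdist E x y}"

definition confluent :: "('v \<Rightarrow> 'v \<Rightarrow> bool) \<Rightarrow> 'v \<Rightarrow> 'v \<Rightarrow> (nat \<Rightarrow> 'v) \<Rightarrow> 'v" where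
  "confluent E x0 x \<omega> = (ARG_MAX (gdist E x0) v. v \<in> geodesic E x0 x \<inter> range \<omega>)"

definition sector :: "('v \<Rightarrow> 'v \<Rightarrow> bool) \<Rightarrow> 'v \<Rightarrow> 'v \<Rightarrow> (nat \<Rightarrow> 'v) set" where
  "sector E x0 x = {\<omega> \<in> rays E x0. gdist E x0 (confluent E x0 x \<omega>) = gdist E x0 x}"

definition ray_topology :: "('v \<Rightarrow> 'v \<Rightarrow> bool) \<Rightarrow> 'v \<Rightarrow> (nat \<Rightarrow> 'v) topology" where
  "ray_topology E x0 = topology_generated_by (range (sector E x0))"

text \<open>
  The conditions determine \<open>\<nu>\<close> uniquely, since the sectors together with the empty set are
  closed under finite intersections and generate the Borel sets.
\<close>

definition boundary_measure ::
  "nat \<Rightarrow> ('v \<Rightarrow> 'v \<Rightarrow> bool) \<Rightarrow> 'v \<Rightarrow> (nat \<Rightarrow> 'v) measure \<Rightarrow> bool" where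
  "boundary_measure q E x0 \<nu> \<longleftrightarrow>
     prob_space \<nu> \<and>
     space \<nu> = rays E x0 \<and>
     sets \<nu> = sigma_sets (rays E x0) {U. openin (ray_topology E x0) U} \<and>
     (\<forall>x. gdist E x0 x \<ge> 1 \<longrightarrow>
        measure \<nu> (sector E x0 x) = inverse (real q + 1) * real q powi (1 - int (gdist E x0 x)))"

text \<open>
  Representatives of elements of \<open>L\<^sup>r(\<nu>)\<close>; equality in \<open>L\<^sup>r\<close> is equality almost everywhere.
\<close>

definition Lr :: "ennreal \<Rightarrow> 'a measure \<Rightarrow> ('a \<Rightarrow> complex) set" where
  "Lr r \<nu> = {F \<in> borel_measurable \<nu>.
     if r = \<infinity> then (\<exists>C. AE \<omega> in \<nu>. cmod (F \<omega>) \<le> C)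
     else integrable \<nu> (\<lambda>\<omega>. cmod (F \<omega>) powr enn2real r)}"

definition poisson_kernel ::
  "nat \<Rightarrow> ('v \<Rightarrow> 'v \<Rightarrow> bool) \<Rightarrow> 'v \<Rightarrow> 'v \<Rightarrow> (nat \<Rightarrow> 'v) \<Rightarrow> real" where
  "poisson_kernel q E x0 x \<omega> =
     real q powi (2 * int (gdist E x0 (confluent E x0 x \<omega>)) - int (gdist E x0 x))"

definition poisson ::
  "nat \<Rightarrow> ('v \<Rightarrow> 'v \<Rightarrow> bool) \<Rightarrow> 'v \<Rightarrow> (nat \<Rightarrow> 'v) measure \<Rightarrow> complex \<Rightarrow>
     ((nat \<Rightarrow> 'v) \<Rightarrow> complex) \<Rightarrow> 'v \<Rightarrow> complex" where
  "poisson q E x0 \<nu> z F x =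
     (LINT \<omega>|\<nu>. complex_of_real (poisson_kernel q E x0 x \<omega>) powr (1/2 + \<i> * z) * F \<omega>)"

text \<open>The common value of the radial function \<open>\<P>\<^sub>z 1\<close> on the sphere of radius \<open>n\<close> about \<open>x0\<close>.\<close>

definition phi ::
  "nat \<Rightarrow> ('v \<Rightarrow> 'v \<Rightarrow> bool) \<Rightarrow> 'v \<Rightarrow> (nat \<Rightarrow> 'v) measure \<Rightarrow> complex \<Rightarrow> nat \<Rightarrow> complex" where
  "phi q E x0 \<nu> z n = the_elem (poisson q E x0 \<nu> z (\<lambda>_. 1) ` gsphere E x0 n)"

definition psi ::
  "nat \<Rightarrow> ('v \<Rightarrow> 'v \<Rightarrow> bool) \<Rightarrow> 'v \<Rightarrow> (nat \<Rightarrow> 'v) measure \<Rightarrow> complex \<Rightarrow> nat \<Rightarrow> complex" where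
  "psi q E x0 \<nu> z n =
     (\<Sum>j\<le>n. of_nat (card (gsphere E x0 j)) * phi q E x0 \<nu> z j) / of_nat (card (gball E x0 n))"

definition eigenfunction ::
  "nat \<Rightarrow> ('v \<Rightarrow> 'v \<Rightarrow> bool) \<Rightarrow> complex \<Rightarrow> ('v \<Rightarrow> complex) \<Rightarrow> bool" where
  "eigenfunction q E c g \<longleftrightarrow> (\<forall>x. laplacian q E g x = c * g x)"

definition unique_poisson_rep ::
  "nat \<Rightarrow> ('v \<Rightarrow> 'v \<Rightarrow> bool) \<Rightarrow> 'v \<Rightarrow> (nat \<Rightarrow> 'v) measure \<Rightarrow> complex \<Rightarrow> ennreal \<Rightarrow>
     ('v \<Rightarrow> complex) \<Rightarrow> bool" where
  "unique_poisson_rep q E x0 \<nu> z r g \<longleftrightarrow>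
     (\<exists>G\<in>Lr r \<nu>. g = poisson q E x0 \<nu> z G \<and>
        (\<forall>H\<in>Lr r \<nu>. g = poisson q E x0 \<nu> z H \<longrightarrow> (AE \<omega> in \<nu>. H \<omega> = G \<omega>)))"

definition decomposition ::
  "nat \<Rightarrow> ('v \<Rightarrow> 'v \<Rightarrow> bool) \<Rightarrow> ennreal \<Rightarrow> complex \<Rightarrow> complex \<Rightarrow>
     ('v \<Rightarrow> complex) \<Rightarrow> ('v \<Rightarrow> complex) \<Rightarrow> ('v \<Rightarrow> complex) \<Rightarrow> bool" where
  "decomposition q E r z1 z2 f g1 g2 \<longleftrightarrow>
     g1 \<in> weak_L r \<and> g2 \<in> weak_L r \<and>
     eigenfunction q E (gamma q z1) g1 \<and> eigenfunction q E (gamma q z2) g2 \<and>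
     (\<forall>x. f x = g1 x + g2 x)"

end

theory Submission
  imports Defs
begin

text \<open>
  Write \<open>a = q\<^sup>1\<^sup>/\<^sup>p\<close> and \<open>b = q / a\<close>, so that \<open>\<gamma>(z\<^sub>1) = 1 - (a + b) / (q + 1)\<close> and
  \<open>\<gamma>(z\<^sub>2) = 1 + (a + b) / (q + 1)\<close>. With \<open>A\<^sub>j\<close> denoting summation over spheres of radius \<open>j\<close>, the two
  eigenvalue equations say \<open>A\<^sub>1 g = (a + b) g\<close> and \<open>A\<^sub>1 g = -(a + b) g\<close>. The proof has two parts.

  Eigenvalue equation. The sphere sums generate a commutative algebra in which
  \<open>A\<^sub>i A\<^sub>j\<close> is a combination of the \<open>A\<^sub>k\<close> with nonnegative coefficients, and the eigenvalue
  \<open>\<alpha>\<^sub>j\<close> of \<open>A\<^sub>j\<close> on the positive spherical function is a character of it. Hence each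
  \<open>A\<^sub>j / \<alpha>\<^sub>j\<close> is a contraction for the norm that is the supremum of \<open>A\<^sub>j |g| (x) / \<alpha>\<^sub>j\<close> over all
  \<open>x\<close> and \<open>j\<close>, and the weak norm dominates this norm, because a set of \<open>N\<close> points
  contributes at most a multiple of \<open>N\<^sup>1\<^sup>/\<^sup>p\<close> to a sum of \<open>|g|\<close>.
  Suppose that a convex combination \<open>T\<close> of these contractions charges both the identity and
  \<open>R = A\<^sub>i / \<alpha>\<^sub>i\<close>, and that \<open>T F\<^sub>m\<^sub>+\<^sub>1 = \<omega> F\<^sub>m\<close> with \<open>|\<omega>| = 1\<close> for a
  bounded sequence \<open>F\<close>. The differences \<open>u\<^sub>m = F\<^sub>m - R F\<^sub>m\<close> satisfy the same recursion, and
  \<open>T\<^sup>m = \<epsilon>\<^sup>m (1 + R + \<dots> + R\<^sup>m) + Q\<close> with \<open>Q\<close> of norm at most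
  \<open>1 - (m + 1) \<epsilon>\<^sup>m\<close>. On \<open>u\<close> the bracket telescopes to \<open>1 - R\<^sup>m\<^sup>+\<^sup>1\<close>
  applied to \<open>F\<close>, so the best common bound \<open>N\<close> of the \<open>u\<^sub>m\<close> satisfies
  \<open>(m + 1) N \<le> 2 C\<close> for every \<open>m\<close>. Hence \<open>u = 0\<close>; this is lemma \<open>liouville\<close>.
  For ball averages take \<open>R = A\<^sub>1 / \<alpha>\<^sub>1\<close>. For sphere averages
  the square of \<open>A\<^sub>n\<close> charges \<open>A\<^sub>0\<close> and \<open>A\<^sub>2\<close>, which gives \<open>A\<^sub>1\<^sup>2 f\<^sub>0 = (a + b)\<^sup>2 f\<^sub>0\<close>, and
  \<open>f\<^sub>0\<close> splits into its parts for the eigenvalues \<open>a + b\<close> and \<open>-(a + b)\<close>.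

  Poisson representation. The kernel for \<open>z\<^sub>1\<close> at a vertex is the kernel at its parent
  divided by \<open>a\<close>, except for a jump on the sector of the vertex. So a function is a Poisson
  transform of \<open>G\<close> exactly when the weighted increments \<open>g(x) - g(parent x) / a\<close>
  are the integrals of \<open>G\<close> over the sectors, up to constants, and for an eigenfunction with eigenvalue \<open>a + b\<close> these
  numbers are additive under passing to children, that is, they define a martingale. Its
  \<open>L\<^sup>p\<^sup>'\<close> norms are governed by the sphere sums of \<open>|g(x) - g(parent x) / a|\<^sup>p\<^sup>'\<close>, which increase with the radius, while a function of
  weak type \<open>p'\<close> has sums of its power \<open>p'\<close> over balls of radius \<open>n\<close> that are at most linear in \<open>n\<close>. Hence the
  sphere sums are bounded; for \<open>p = 1\<close> the martingale is bounded outright. As \<open>p' > 2\<close>, the martingale converges, and its limit is the boundary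
  function (lemmas \<open>martingale_limit\<close> and \<open>poisson_representation\<close>). Uniqueness holds since the sectors
  generate the Borel sets (\<open>mass_unique\<close>). Finally, the kernel for \<open>z\<^sub>2\<close> is the one for \<open>z\<^sub>1\<close>
  times \<open>(-1)\<^sup>|\<^sup>x\<^sup>|\<close>, and multiplication by this sign exchanges the two eigenvalues.
\<close>

section \<open>The tree as a metric space\<close>

locale tree =
  fixes q :: nat and E :: "'v \<Rightarrow> 'v \<Rightarrow> bool"
  assumes q2: "q \<ge> 2" and homogeneous: "homogeneous_tree q E"
begin

abbreviation d :: "'v \<Rightarrow> 'v \<Rightarrow> nat" where "d \<equiv> gdist E"
abbreviation S :: "'v \<Rightarrow> nat \<Rightarrow> 'v set" where "S \<equiv> gsphere E"

lemma E_sym: "E x y \<Longrightarrow> E y x"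
  using homogeneous unfolding homogeneous_tree_def by (meson sympD)

lemma E_irrefl: "\<not> E x x"
  using homogeneous unfolding homogeneous_tree_def by (meson irreflpD)

lemma no_cycle: "3 \<le> length xs \<Longrightarrow> distinct xs \<Longrightarrow> successively E xs \<Longrightarrow> \<not> E (last xs) (hd xs)"
  using homogeneous unfolding homogeneous_tree_def by blast

lemma card_nbrs: "card {y. E x y} = q + 1"
  using homogeneous unfolding homogeneous_tree_def by blast

lemma finite_nbrs: "finite {y. E x y}"
  using card_nbrs[of x] by (intro card_ge_0_finite) simp

lemma relpow_dist: "(E ^^ d x y) x y"
proof -
  have "E\<^sup>*\<^sup>* x y" using homogeneous unfolding homogeneous_tree_def by blast
  then show ?thesis unfolding gdist_def by (metis LeastI rtranclp_imp_relpowp)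
qed

lemma dist_le: "(E ^^ n) x y \<Longrightarrow> d x y \<le> n"
  unfolding gdist_def by (rule Least_le)

lemma relpow_sym: "(E ^^ n) x y \<Longrightarrow> (E ^^ n) y x"
proof (induction n arbitrary: y)
  case (Suc n)
  then show ?case by (metis E_sym relpowp_Suc_E relpowp_Suc_I2)
qed simp

lemma dist_sym: "d x y = d y x"
  by (meson antisym dist_le relpow_dist relpow_sym)

lemma dist_eq_0 [simp]: "d x y = 0 \<longleftrightarrow> x = y"
  using relpow_dist[of x y] dist_le[of 0 x y] by auto

lemma dist_self [simp]: "d x x = 0"
  by simp

lemma dist_triangle: "d x z \<le> d x y + d y z"
  using relpow_dist dist_le by (metis relpowp_trans)

lemma dist_eq_1 [simp]: "d x y = Suc 0 \<longleftrightarrow> E x y"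
proof
  assume "d x y = Suc 0" then show "E x y" using relpow_dist[of x y] by auto
next
  assume *: "E x y"
  then have "d x y \<le> 1" by (intro dist_le) auto
  moreover have "d x y \<noteq> 0" using * E_irrefl by auto
  ultimately show "d x y = Suc 0" by linarith
qed

lemma dist_nbr: "E y z \<Longrightarrow> d x z \<le> Suc (d x y) \<and> d x y \<le> Suc (d x z)"
  using dist_triangle[of x z y] dist_triangle[of x y z] dist_eq_1[of y z] dist_eq_1[of z y] E_sym
  by fastforce

lemma dist_pred:
  assumes "d x y = Suc n" obtains z where "E y z" "d x z = n"
proof -
  have "(E ^^ Suc n) x y" using relpow_dist[of x y] assms by simp
  then obtain z where z: "(E ^^ n) x z" "E z y" by (meson relpowp_Suc_E)
  then have "d x z \<le> n" "E y z" using dist_le E_sym by auto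
  moreover have "n \<le> d x z" using dist_nbr[OF z(2), of x] assms by simp
  ultimately show ?thesis using that by force
qed

text \<open>
  Loops are cut out of a walk, which turns the absence of closed simple paths into a
  statement about reachability.
\<close>

lemma walk_imp_simple_path:
  assumes "r\<^sup>*\<^sup>* v w"
  obtains xs where "xs \<noteq> []" "distinct xs" "successively r xs" "hd xs = v" "last xs = w"
proof -
  have "\<exists>xs. xs \<noteq> [] \<and> distinct xs \<and> successively r xs \<and> hd xs = v \<and> last xs = w"
    using assms
  proof (induction rule: converse_rtranclp_induct)
    case base
    show ?case by (rule exI[of _ "[w]"]) simp
  next
    case (step v u)
    then obtain xs where xs: "xs \<noteq> []" "distinct xs" "successively r xs" "hd xs = u" "last xs = w"
      by blast
    show ?case
    proof (cases "v \<in> set xs")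
      case True
      then obtain ys zs where "xs = ys @ v # zs" by (meson split_list)
      then show ?thesis using xs
        by (intro exI[of _ "v # zs"]) (auto simp: successively_append_iff)
    next
      case False
      then show ?thesis using xs step.hyps(1)
        by (intro exI[of _ "v # xs"]) (auto simp: successively_Cons)
    qed
  qed
  then show ?thesis using that by blast
qed

lemma nbrs_joined_avoiding_eq:
  assumes "E y v" "E y w" "(\<lambda>a b. E a b \<and> a \<noteq> y \<and> b \<noteq> y)\<^sup>*\<^sup>* v w"
  shows "v = w"
proof (rule ccontr)
  assume "v \<noteq> w"
  let ?r = "\<lambda>a b. E a b \<and> a \<noteq> y \<and> b \<noteq> y"
  obtain xs where xs: "xs \<noteq> []" "distinct xs" "successively ?r xs" "hd xs = v" "last xs = w"
    using walk_imp_simple_path[OF assms(3)] by blast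
  obtain u zs where xs_eq: "xs = v # u # zs"
    using xs \<open>v \<noteq> w\<close> by (metis last_ConsL list.collapse)
  have avoid: "y \<notin> set xs"
  proof -
    have "successively ?r zs \<Longrightarrow> hd zs \<noteq> y \<Longrightarrow> y \<notin> set zs" for zs
      by (induction zs) (auto simp: successively_Cons split: if_splits)
    then show ?thesis using xs assms(1) E_irrefl by blast
  qed
  have succ: "successively E xs" using xs(3) by (rule successively_mono) auto
  have "\<not> E (last (y # xs)) (hd (y # xs))"
  proof (rule no_cycle)
    show "3 \<le> length (y # xs)" using xs_eq by simp
    show "distinct (y # xs)" using avoid xs by simp
    show "successively E (y # xs)" using succ xs assms by (simp add: successively_Cons)
  qed
  then show False using xs assms E_sym by auto
qed

lemma walk_to_root_avoiding:
  assumes "d x v \<le> d x y" "v \<noteq> y"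
  shows "(\<lambda>a b. E a b \<and> a \<noteq> y \<and> b \<noteq> y)\<^sup>*\<^sup>* v x"
  using assms
proof (induction "d x v" arbitrary: v)
  case 0
  then have "v = x" using dist_eq_0[of x v] by simp
  then show ?case by simp
next
  case (Suc n)
  then obtain u where u: "E v u" "d x u = n" by (metis dist_pred)
  then have "u \<noteq> y" using Suc by auto
  then show ?case using Suc u by (intro converse_rtranclp_into_rtranclp[of _ v u]) auto
qed

text \<open>
  The walks from two such neighbours \<open>v\<close> and \<open>w\<close> of \<open>y\<close> towards \<open>x\<close> avoid \<open>y\<close>, since the
  distance to \<open>x\<close> decreases along them; joined at \<open>x\<close> and closed up through \<open>y\<close> they would contain a cycle.
  This one fact excludes both a second predecessor and edges inside a sphere.
\<close>

lemma closer_nbr_unique: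
  assumes "E y v" "E y w" "d x v \<le> d x y" "d x w \<le> d x y"
  shows "v = w"
proof -
  let ?r = "\<lambda>a b. E a b \<and> a \<noteq> y \<and> b \<noteq> y"
  have ne: "v \<noteq> y" "w \<noteq> y" using assms E_irrefl by auto
  have sym: "symp ?r" by (auto intro!: sympI E_sym)
  have "?r\<^sup>*\<^sup>* v x" "?r\<^sup>*\<^sup>* x w"
    using walk_to_root_avoiding[OF assms(3) ne(1)] walk_to_root_avoiding[OF assms(4) ne(2)]
      symp_rtranclp[OF sym] by (auto dest: sympD)
  then have "?r\<^sup>*\<^sup>* v w" by (rule rtranclp_trans)
  then show ?thesis using nbrs_joined_avoiding_eq assms by blast
qed

lemma nbrs_split:
  assumes "d x y = Suc n"
  obtains p where "E y p" "d x p = n" "\<And>v. E y v \<Longrightarrow> v \<noteq> p \<Longrightarrow> d x v = Suc (Suc n)"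
proof -
  obtain p where p: "E y p" "d x p = n" using dist_pred[OF assms] by blast
  have "d x v = Suc (Suc n)" if "E y v" "v \<noteq> p" for v
  proof (rule ccontr)
    assume "d x v \<noteq> Suc (Suc n)"
    then have "d x v \<le> d x y" using dist_nbr[OF that(1), of x] assms by simp
    then show False using closer_nbr_unique[OF that(1) p(1), of x] that p assms by simp
  qed
  then show ?thesis using that p by blast
qed

lemma card_nbrs_by_dist:
  "card {v. E x v \<and> d v y = j} =
    (if d x y = Suc j then 1 else if j \<noteq> 0 \<and> d x y = j - 1 then (if j = 1 then q + 1 else q) else 0)"
proof (cases "d x y")
  case 0
  then have "x = y" by simp
  then have *: "{v. E x v \<and> d v y = j} = (if j = 1 then {v. E x v} else {})"
    by (auto simp: dist_sym[of _ y])
  show ?thesis unfolding * using 0 card_nbrs by auto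
next
  case (Suc n)
  then have "d y x = Suc n" by (simp add: dist_sym)
  then obtain p where p: "E x p" "d y p = n" "\<And>v. E x v \<Longrightarrow> v \<noteq> p \<Longrightarrow> d y v = Suc (Suc n)"
    using nbrs_split by blast
  have "{v. E x v \<and> d v y = j} =
      (if j = n then {p} else if j = Suc (Suc n) then {v. E x v} - {p} else {})"
    using p by (auto simp: dist_sym[of _ y]) (metis n_not_Suc_n Suc_n_not_le_n le_SucI order_refl)
  then show ?thesis using Suc p card_nbrs[of x] finite_nbrs[of x] by (auto simp: card_Diff_singleton)
qed



lemma mem_sphere: "y \<in> S x n \<longleftrightarrow> d x y = n"
  by (simp add: gsphere_def)

lemma sphere_0: "S x 0 = {x}"
  by (auto simp: gsphere_def)

lemma sphere_1: "S x (Suc 0) = {y. E x y}"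
  by (auto simp: gsphere_def)

lemma finite_sphere: "finite (S x n)"
proof (induction n)
  case 0
  then show ?case by (simp add: sphere_0)
next
  case (Suc n)
  have "S x (Suc n) \<subseteq> (\<Union>z\<in>S x n. {y. E z y})"
  proof
    fix y assume "y \<in> S x (Suc n)"
    then obtain z where "E y z" "d x z = n" using dist_pred[of x y n] by (auto simp: mem_sphere)
    then show "y \<in> (\<Union>z\<in>S x n. {y. E z y})" using E_sym mem_sphere by blast
  qed
  then show ?case using Suc finite_nbrs by (meson finite_UN finite_subset)
qed

lemma ball_eq_UN_spheres: "gball E x n = (\<Union>j\<le>n. S x j)"
  by (auto simp: gball_def gsphere_def)

lemma finite_ball: "finite (gball E x n)"
  by (simp add: ball_eq_UN_spheres finite_sphere)

lemma sum_ball: "sum f (gball E x n) = (\<Sum>j\<le>n. sum f (S x j))"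
  unfolding ball_eq_UN_spheres
  by (rule sum.UNION_disjoint) (auto simp: finite_sphere mem_sphere)

lemma countable_vertices: "countable (UNIV :: 'v set)"
proof -
  have "countable (\<Union>n. S undefined n)"
    by (intro countable_UN) (auto intro: countable_finite finite_sphere)
  moreover have "(\<Union>n. S undefined n) = UNIV" by (auto simp: mem_sphere)
  ultimately show ?thesis by simp
qed

end

section \<open>The algebra of sphere sums\<close>

context tree begin

definition sphere_sum :: "nat \<Rightarrow> ('v \<Rightarrow> 'b::comm_ring_1) \<Rightarrow> 'v \<Rightarrow> 'b" where
  "sphere_sum j g x = (\<Sum>y\<in>S x j. g y)"

lemma sphere_sum_0 [simp]: "sphere_sum 0 g = g"
  by (simp add: sphere_sum_def sphere_0 fun_eq_iff)

lemma sphere_sum_add: "sphere_sum j (\<lambda>x. g x + h x) x = sphere_sum j g x + sphere_sum j h x"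
  by (simp add: sphere_sum_def sum.distrib)

lemma sphere_sum_diff: "sphere_sum j (\<lambda>x. g x - h x) x = sphere_sum j g x - sphere_sum j h x"
  by (simp add: sphere_sum_def sum_subtractf)

lemma sphere_sum_cmult: "sphere_sum j (\<lambda>x. c * g x) x = c * sphere_sum j g x"
  by (simp add: sphere_sum_def sum_distrib_left)

lemma sphere_sum_sum: "sphere_sum j (\<lambda>x. \<Sum>i\<in>I. g i x) x = (\<Sum>i\<in>I. sphere_sum j (g i) x)"
  unfolding sphere_sum_def by (rule sum.swap)

lemmas sphere_sum_linear = sphere_sum_add sphere_sum_diff sphere_sum_cmult sphere_sum_sum

text \<open>
  The number of neighbours of a vertex \<open>x\<close> that lead away from a vertex at distance \<open>j\<close> from \<open>x\<close>.
\<close>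

definition backdeg :: "nat \<Rightarrow> nat" where "backdeg j = (if j = 0 then q + 1 else q)"

text \<open>
  A path of one step followed by \<open>j + 1\<close> steps without backtracking ends at distance \<open>j + 2\<close> in exactly one
  way, and at distance \<open>j\<close> in as many ways as there are first steps away from the end point.
\<close>

lemma sphere_sum_1_mult: "sphere_sum (Suc 0) (sphere_sum (Suc j) g) x = sphere_sum (Suc (Suc j)) g x + of_nat (backdeg j) * sphere_sum j g x"
proof -
  let ?B = "gball E x (Suc (Suc j))" and ?c = "\<lambda>y. card {v. E x v \<and> d v y = Suc j}"
  have sub: "S v (Suc j) = {y \<in> ?B. d v y = Suc j}" if "E x v" for v
  proof -
    have "d x y \<le> Suc (Suc j)" if "d v y = Suc j" for y
      using \<open>E x v\<close> that dist_triangle[of x y v] dist_eq_1[of x v] by linarith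
    then show ?thesis by (auto simp: mem_sphere gball_def)
  qed
  have "sphere_sum (Suc 0) (sphere_sum (Suc j) g) x = (\<Sum>v | E x v. \<Sum>y\<in>?B. if d v y = Suc j then g y else 0)"
    unfolding sphere_sum_def sphere_1
    by (rule sum.cong[OF refl]) (simp only: mem_Collect_eq sub sum.inter_filter[OF finite_ball])
  also have "\<dots> = (\<Sum>y\<in>?B. of_nat (?c y) * g y)"
    by (subst sum.swap) (simp add: finite_nbrs Int_def flip: sum.inter_filter)
  also have "\<dots> = (\<Sum>y\<in>?B. (if d x y = Suc (Suc j) then g y else 0)
      + (if d x y = j then of_nat (backdeg j) * g y else 0))"
    by (intro sum.cong refl) (simp add: card_nbrs_by_dist backdeg_def)
  also have "\<dots> = (\<Sum>y\<in>{y \<in> ?B. d x y = Suc (Suc j)}. g y)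
      + (\<Sum>y\<in>{y \<in> ?B. d x y = j}. of_nat (backdeg j) * g y)"
    by (simp add: sum.distrib sum.inter_filter finite_ball)
  also have "{y \<in> ?B. d x y = Suc (Suc j)} = S x (Suc (Suc j))"
    by (auto simp: gball_def mem_sphere)
  also have "{y \<in> ?B. d x y = j} = S x j" by (auto simp: gball_def mem_sphere)
  finally show ?thesis by (simp add: sphere_sum_def sum_distrib_left)
qed

lemma sphere_sum_Suc_Suc: "sphere_sum (Suc (Suc j)) g x = sphere_sum (Suc 0) (sphere_sum (Suc j) g) x - of_nat (backdeg j) * sphere_sum j g x"
  by (simp add: sphere_sum_1_mult)

lemma sphere_sum_Suc_Suc': "sphere_sum (Suc (Suc j)) g = (\<lambda>x. sphere_sum (Suc 0) (sphere_sum (Suc j) g) x - of_nat (backdeg j) * sphere_sum j g x)"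
  by (rule ext) (rule sphere_sum_Suc_Suc)

lemma sphere_sum_1_commute: "sphere_sum (Suc 0) (sphere_sum j g) x = sphere_sum j (sphere_sum (Suc 0) g) x"
proof (induction j arbitrary: x rule: induct_nat_012)
  case (ge2 n)
  have "sphere_sum (Suc 0) (sphere_sum (Suc (Suc n)) g) x
      = sphere_sum (Suc 0) (sphere_sum (Suc 0) (sphere_sum (Suc n) g)) x - of_nat (backdeg n) * sphere_sum (Suc 0) (sphere_sum n g) x"
    unfolding sphere_sum_Suc_Suc'[of n g] by (simp add: sphere_sum_linear)
  also have "sphere_sum (Suc 0) (sphere_sum (Suc n) g) = sphere_sum (Suc n) (sphere_sum (Suc 0) g)"
    using ge2 by blast
  finally show ?case by (simp add: sphere_sum_Suc_Suc[of n "sphere_sum (Suc 0) g"] ge2)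
qed simp_all

lemma sphere_sum_commute: "sphere_sum i (sphere_sum j g) = sphere_sum j (sphere_sum i g)"
proof -
  have "sphere_sum i (sphere_sum j g) x = sphere_sum j (sphere_sum i g) x" for x
  proof (induction i arbitrary: x rule: induct_nat_012)
    case (ge2 n)
    have "sphere_sum (Suc n) (sphere_sum j g) = sphere_sum j (sphere_sum (Suc n) g)" using ge2 by blast
    then have "sphere_sum (Suc (Suc n)) (sphere_sum j g) x
        = sphere_sum j (sphere_sum (Suc 0) (sphere_sum (Suc n) g)) x - of_nat (backdeg n) * sphere_sum j (sphere_sum n g) x"
      by (simp add: sphere_sum_Suc_Suc ge2 sphere_sum_1_commute)
    then show ?case by (simp add: sphere_sum_Suc_Suc'[of n g] sphere_sum_linear)
  qed (auto simp: sphere_sum_1_commute)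
  then show ?thesis by blast
qed

lemma sphere_sum_2_mult:
  "sphere_sum (Suc (Suc 0)) (sphere_sum (Suc (Suc j)) g) x =
    of_nat q * sphere_sum (Suc 0) (sphere_sum (Suc j) g) x + sphere_sum (j + 4) g x - sphere_sum (j + 2) g x"
proof -
  have "sphere_sum (Suc (Suc 0)) (sphere_sum (Suc (Suc j)) g) x
      = sphere_sum (Suc 0) (sphere_sum (Suc 0) (sphere_sum (Suc (Suc j)) g)) x - of_nat (q + 1) * sphere_sum (Suc (Suc j)) g x"
    by (simp add: sphere_sum_Suc_Suc[of 0] backdeg_def)
  also have "sphere_sum (Suc 0) (sphere_sum (Suc (Suc j)) g) = (\<lambda>x. sphere_sum (Suc (Suc (Suc j))) g x + of_nat q * sphere_sum (Suc j) g x)"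
    by (rule ext) (simp add: sphere_sum_1_mult backdeg_def)
  finally show ?thesis by (simp add: sphere_sum_linear sphere_sum_1_mult backdeg_def numeral_eq_Suc algebra_simps)
qed

text \<open>
  The product of two sphere sums is reduced to the product with both radii lowered by one. This form of
  the recursion keeps the coefficients visibly nonnegative: the negative term is absorbed because
  the leading coefficient of the lower product is at least one.
\<close>

lemma sphere_sum_mult_step:
  "sphere_sum (Suc (Suc i)) (sphere_sum (Suc (Suc j)) g) x =
    of_nat q * sphere_sum (Suc i) (sphere_sum (Suc j) g) x + sphere_sum (i + j + 4) g x - sphere_sum (i + j + 2) g x"
proof (induction i arbitrary: x rule: induct_nat_012)
  case 0
  then show ?case by (simp add: sphere_sum_2_mult)
next
  case 1
  have IH: "sphere_sum (Suc (Suc 0)) (sphere_sum (Suc (Suc j)) g) =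
      (\<lambda>x. of_nat q * sphere_sum (Suc 0) (sphere_sum (Suc j) g) x + sphere_sum (j + 4) g x - sphere_sum (j + 2) g x)"
    by (rule ext) (rule sphere_sum_2_mult)
  show ?case
    unfolding sphere_sum_Suc_Suc[of "Suc 0" "sphere_sum (Suc (Suc j)) g"] IH sphere_sum_linear sphere_sum_1_mult[of 0 "sphere_sum (Suc j) g"]
    by (simp add: sphere_sum_1_mult backdeg_def numeral_eq_Suc algebra_simps)
next
  case (ge2 i)
  have IH: "sphere_sum (Suc (Suc (Suc i))) (sphere_sum (Suc (Suc j)) g) =
      (\<lambda>x. of_nat q * sphere_sum (Suc (Suc i)) (sphere_sum (Suc j) g) x + sphere_sum (Suc i + j + 4) g x - sphere_sum (Suc i + j + 2) g x)"
    by (rule ext) (rule ge2)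
  show ?case
    unfolding sphere_sum_Suc_Suc[of "Suc (Suc i)" "sphere_sum (Suc (Suc j)) g"] IH sphere_sum_linear ge2(1)
      sphere_sum_1_mult[of "Suc i" "sphere_sum (Suc j) g"]
    by (simp add: sphere_sum_1_mult backdeg_def numeral_eq_Suc algebra_simps)
qed

lemma sphere_sum_one: "sphere_sum j (\<lambda>_. 1 :: 'b::comm_ring_1) x = of_nat (card (S x j))"
  by (simp add: sphere_sum_def)

lemma card_sphere_1: "card (S x (Suc 0)) = q + 1"
  by (simp add: sphere_1 card_nbrs)

lemma card_sphere: "card (S x (Suc j)) = (q + 1) * q ^ j"
proof -
  have A1: "sphere_sum (Suc 0) (\<lambda>_. c) x = (int q + 1) * c" for c :: int and x
    by (simp add: sphere_sum_def card_sphere_1)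
  have "sphere_sum (Suc j) (\<lambda>_. 1 :: int) = (\<lambda>_. (int q + 1) * int q ^ j)"
  proof (induction j rule: induct_nat_012)
    case 0
    then show ?case by (simp add: A1)
  next
    case 1
    have "sphere_sum (Suc 0) (\<lambda>_. 1 :: int) = (\<lambda>_. int q + 1)" by (rule ext) (simp add: A1)
    then show ?case by (simp add: sphere_sum_Suc_Suc'[of 0] A1 backdeg_def algebra_simps)
  next
    case (ge2 j)
    then show ?case by (simp add: sphere_sum_Suc_Suc'[of "Suc j"] A1 backdeg_def algebra_simps)
  qed
  then have "int (card (S x (Suc j))) = int ((q + 1) * q ^ j)"
    by (metis sphere_sum_one of_nat_1 of_nat_add of_nat_mult of_nat_power add.commute id_apply of_nat_eq_id)
  then show ?thesis by (simp only: of_nat_eq_iff)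
qed

text \<open>
  The number \<open>lin_coeff i j k\<close> counts, for two vertices at distance \<open>k\<close>, the vertices at distance \<open>i\<close> from the first and
  \<open>j\<close> from the second. The truncated subtraction in the last equation never truncates, by \<open>lin_coeff_top\<close>.
\<close>

fun lin_coeff :: "nat \<Rightarrow> nat \<Rightarrow> nat \<Rightarrow> nat" where
  "lin_coeff 0 j k = (if k = j then 1 else 0)"
| "lin_coeff (Suc i) 0 k = (if k = Suc i then 1 else 0)"
| "lin_coeff (Suc 0) (Suc j) k = (if k = j + 2 then 1 else 0) + (if k = j then backdeg j else 0)"
| "lin_coeff (Suc (Suc i)) (Suc 0) k = (if k = i + 3 then 1 else 0) + (if k = i + 1 then q else 0)"
| "lin_coeff (Suc (Suc i)) (Suc (Suc j)) k =
    q * lin_coeff (Suc i) (Suc j) k + (if k = i + j + 4 then 1 else 0) - (if k = i + j + 2 then 1 else 0)"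

lemma lin_coeff_eq_0: "k > i + j \<Longrightarrow> lin_coeff i j k = 0"
  by (induction i j k rule: lin_coeff.induct) auto

lemma lin_coeff_top: "lin_coeff i j (i + j) \<ge> 1"
  by (induction i j "i + j" rule: lin_coeff.induct) (auto simp: lin_coeff_eq_0)

lemma of_nat_lin_coeff_step: "(of_nat (lin_coeff (Suc (Suc i)) (Suc (Suc j)) k) :: 'b::comm_ring_1) =
    of_nat q * of_nat (lin_coeff (Suc i) (Suc j) k) + (if k = i + j + 4 then 1 else 0)
      - (if k = i + j + 2 then 1 else 0)"
proof -
  have "(if k = i + j + 2 then 1 else 0) \<le> q * lin_coeff (Suc i) (Suc j) k"
    using lin_coeff_top[of "Suc i" "Suc j"] q2 by auto
  then show ?thesis by (simp add: of_nat_diff)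
qed

lemma of_nat_if_mult:
  "of_nat (if b then m else 0) * z = (if b then of_nat m * z else (0 :: 'b::comm_ring_1))"
  by simp

lemma sphere_sum_mult: "sphere_sum i (sphere_sum j g) x = (\<Sum>k\<le>i + j. of_nat (lin_coeff i j k) * sphere_sum k g x)"
proof (induction i j "0::nat" arbitrary: x rule: lin_coeff.induct)
  case (1 j)
  then show ?case by (simp add: of_nat_if_mult)
next
  case (2 i)
  then show ?case by (simp add: of_nat_if_mult del: sum.atMost_Suc)
next
  case (3 j)
  then show ?case
    by (simp add: of_nat_if_mult sphere_sum_1_mult distrib_right sum.distrib del: sum.atMost_Suc)
next
  case (4 i)
  have "sphere_sum (Suc (Suc i)) (sphere_sum (Suc 0) g) x = sphere_sum (Suc 0) (sphere_sum (Suc (Suc i)) g) x"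
    by (simp add: sphere_sum_1_commute)
  then show ?case
    by (simp add: of_nat_if_mult sphere_sum_1_mult distrib_right sum.distrib backdeg_def 
       numeral_eq_Suc del: sum.atMost_Suc)
next
  case (5 i j)
  have "{..Suc (Suc i) + Suc (Suc j)} = insert (i+j+3) (insert (i+j+4) {..Suc i + Suc j})"
    by auto
  then have "(\<Sum>k\<le>Suc (Suc i) + Suc (Suc j). of_nat (lin_coeff (Suc i) (Suc j) k) * sphere_sum k g x)
     = (\<Sum>k\<le>Suc i + Suc j. of_nat (lin_coeff (Suc i) (Suc j) k) * sphere_sum k g x)"
    by (simp add: lin_coeff_eq_0 del: sum.atMost_Suc)
  then show ?case
    unfolding sphere_sum_mult_step 5 of_nat_lin_coeff_step
    by (simp add: mult_delta_left distrib_right left_diff_distrib sum.distrib sum_subtractf mult.assoc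
       del: sum.atMost_Suc flip: sum_distrib_left)
qed

text \<open>
  Two vertices at distance two have a common point at distance \<open>n\<close> for every positive \<open>n\<close>, as there
  is a third branch at their midpoint. This makes the square of a sphere average charge the identity and the
  sphere average of radius two.
\<close>

lemma lin_coeff_diag_pos:
  "lin_coeff (Suc n) (Suc n) 0 > 0 \<and> lin_coeff (Suc n) (Suc n) 2 > 0"
proof (induction n)
  case 0
  then show ?case by (simp add: backdeg_def)
next
  case (Suc n)
  have "q * k - (if n = 0 then 1 else 0) > 0" if "k > 0" for k
    using q2 mult_le_mono[OF q2, of 1 k] that by (auto simp: Suc_le_eq)
  with Suc q2 show ?case by auto
qed

end

section \<open>A Liouville theorem for mixtures of sphere averages\<close>

context tree begin

text \<open>
  The eigenvalue of the sphere sum of radius \<open>j\<close> on any function on which the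
  sum over neighbours has the eigenvalue \<open>lam\<close>.
\<close>

fun alpha :: "real \<Rightarrow> nat \<Rightarrow> real" where
  "alpha lam 0 = 1"
| "alpha lam (Suc 0) = lam"
| "alpha lam (Suc (Suc j)) = lam * alpha lam (Suc j) - real (backdeg j) * alpha lam j"

lemma sphere_sum_eigen:
  fixes g :: "'v \<Rightarrow> 'b::{real_algebra_1, comm_ring_1}"
  assumes "\<And>x. sphere_sum (Suc 0) g x = of_real lam * g x"
  shows "sphere_sum j g x = of_real (alpha lam j) * g x"
proof (induction j arbitrary: x rule: induct_nat_012)
  case (ge2 n)
  have "sphere_sum (Suc n) g = (\<lambda>x. of_real (alpha lam (Suc n)) * g x)" using ge2 by blast
  then show ?case
    by (simp add: sphere_sum_Suc_Suc ge2 sphere_sum_cmult assms) (simp add: algebra_simps)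
qed (simp_all add: assms)

definition spherical :: "'v \<Rightarrow> real \<Rightarrow> 'v \<Rightarrow> real" where
  "spherical o' lam x = alpha lam (d o' x) / real (card (S o' (d o' x)))"

lemma sphere_sum_1_spherical: "sphere_sum (Suc 0) (spherical o' lam) x = lam * spherical o' lam x"
proof (cases "d o' x")
  case 0
  then have "o' = x" by simp
  then have "sphere_sum (Suc 0) (spherical o' lam) x = (\<Sum>y\<in>S x (Suc 0). lam / real (card (S x (Suc 0))))"
    unfolding sphere_sum_def by (intro sum.cong refl) (simp add: spherical_def mem_sphere del: dist_eq_1)
  then show ?thesis using 0 by (simp add: spherical_def card_sphere sphere_0)
next
  case (Suc n)
  obtain p where p: "E x p" "d o' p = n" "\<And>v. E x v \<Longrightarrow> v \<noteq> p \<Longrightarrow> d o' v = Suc (Suc n)"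
    using nbrs_split[OF Suc] by blast
  let ?s = "\<lambda>n. real (card (S o' n))"
  have "sphere_sum (Suc 0) (spherical o' lam) x = spherical o' lam p + (\<Sum>v\<in>{v. E x v} - {p}. spherical o' lam v)"
    unfolding sphere_sum_def sphere_1 using p finite_nbrs by (subst sum.remove[of _ p]) auto
  also have "(\<Sum>v\<in>{v. E x v} - {p}. spherical o' lam v)
      = (\<Sum>v\<in>{v. E x v} - {p}. alpha lam (Suc (Suc n)) / ?s (Suc (Suc n)))"
    using p by (intro sum.cong refl) (auto simp: spherical_def)
  also have "\<dots> = real q * (alpha lam (Suc (Suc n)) / ?s (Suc (Suc n)))"
    using p card_nbrs[of x] finite_nbrs[of x] by (simp add: card_Diff_singleton)
  also have "spherical o' lam p = alpha lam n / ?s n" using p by (simp add: spherical_def)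
  also have "alpha lam n / ?s n + real q * (alpha lam (Suc (Suc n)) / ?s (Suc (Suc n)))
      = lam * (alpha lam (Suc n) / ?s (Suc n))"
  proof (cases n)
    case 0
    have "real q + real q * real q > 0" "q \<noteq> 0" using q2 by (auto intro!: add_pos_pos)
    with 0 show ?thesis by (simp add: card_sphere sphere_0 backdeg_def divide_simps) (simp add: algebra_simps)
  next
    case (Suc m)
    have s: "?s (Suc n) = real q * ?s n" "?s (Suc (Suc n)) = real q * (real q * ?s n)" "?s n \<noteq> 0"
      using Suc q2 by (auto simp: card_sphere algebra_simps simp flip: of_nat_mult of_nat_add of_nat_power)
    have al: "alpha lam (Suc (Suc n)) = lam * alpha lam (Suc n) - real q * alpha lam n"
      using Suc by (simp add: backdeg_def)
    show ?thesis unfolding s(1,2) al using s(3) q2 by (simp add: field_simps)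
  qed
  also have "\<dots> = lam * spherical o' lam x" using Suc by (simp add: spherical_def)
  finally show ?thesis .
qed

text \<open>
  Evaluate the linearised product at the centre of a spherical function, where that function equals one.
\<close>

lemma alpha_mult: "(\<Sum>k\<le>i + j. real (lin_coeff i j k) * alpha lam k) = alpha lam i * alpha lam j"
proof -
  let ?h = "spherical undefined lam" and ?x = "undefined :: 'v"
  have e: "sphere_sum k ?h = (\<lambda>x. alpha lam k * ?h x)" for k
    using sphere_sum_eigen[of ?h lam k] sphere_sum_1_spherical by auto
  have h1: "?h ?x = 1" by (simp add: spherical_def sphere_0)
  have "alpha lam i * alpha lam j = sphere_sum i (sphere_sum j ?h) ?x" by (simp add: e sphere_sum_cmult h1)
  also have "\<dots> = (\<Sum>k\<le>i + j. real (lin_coeff i j k) * sphere_sum k ?h ?x)"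
    by (rule sphere_sum_mult)
  also have "\<dots> = (\<Sum>k\<le>i + j. real (lin_coeff i j k) * alpha lam k)"
    by (simp add: e h1)
  finally show ?thesis ..
qed

end

text \<open>
  Positivity of all eigenvalues makes them usable as weights.
\<close>

locale positive_tree = tree q E for q and E :: "'v \<Rightarrow> 'v \<Rightarrow> bool" +
  fixes lam :: real
  assumes alpha_pos: "\<And>j. alpha lam j > 0"
begin

text \<open>
  The bound \<open>C\<close> on the norm for which every sphere sum of radius \<open>i\<close> has operator norm at most
  \<open>alpha lam i\<close>.
\<close>

definition mean_bounded :: "real \<Rightarrow> ('v \<Rightarrow> complex) \<Rightarrow> bool" where
  "mean_bounded C g \<longleftrightarrow> (\<forall>x j. sphere_sum j (\<lambda>y. cmod (g y)) x \<le> C * alpha lam j)"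

lemma sphere_sum_mono: "(\<And>x. g x \<le> h x) \<Longrightarrow> sphere_sum j g x \<le> sphere_sum j h x" for g h :: "'v \<Rightarrow> real"
  unfolding sphere_sum_def by (rule sum_mono) 

lemma norm_sphere_sum_le: "cmod (sphere_sum j g x) \<le> sphere_sum j (\<lambda>y. cmod (g y)) x"
  unfolding sphere_sum_def by (rule norm_sum)

lemma mean_bounded_add: "mean_bounded C g \<Longrightarrow> mean_bounded D h \<Longrightarrow> mean_bounded (C + D) (\<lambda>x. g x + h x)"
  unfolding mean_bounded_def
proof (intro allI)
  fix x j
  assume *: "\<forall>x j. sphere_sum j (\<lambda>y. cmod (g y)) x \<le> C * alpha lam j" "\<forall>x j. sphere_sum j (\<lambda>y. cmod (h y)) x \<le> D * alpha lam j"
  have "sphere_sum j (\<lambda>y. cmod (g y + h y)) x \<le> sphere_sum j (\<lambda>y. cmod (g y) + cmod (h y)) x"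
    by (intro sphere_sum_mono norm_triangle_ineq)
  also have "\<dots> \<le> C * alpha lam j + D * alpha lam j"
    using * by (simp add: sphere_sum_linear add_mono)
  finally show "sphere_sum j (\<lambda>y. cmod (g y + h y)) x \<le> (C + D) * alpha lam j" by (simp add: distrib_right)
qed

lemma mean_bounded_cmult: "mean_bounded C g \<Longrightarrow> mean_bounded (cmod c * C) (\<lambda>x. c * g x)"
  unfolding mean_bounded_def by (simp add: norm_mult sphere_sum_linear mult.assoc mult_left_mono)

lemma mean_bounded_0: "mean_bounded 0 (\<lambda>_. 0)"
  by (simp add: mean_bounded_def sphere_sum_def)

lemma mean_bounded_sum: "(\<And>k. k \<in> K \<Longrightarrow> mean_bounded (C k) (g k)) \<Longrightarrow> mean_bounded (sum C K) (\<lambda>x. \<Sum>k\<in>K. g k x)"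
  by (induction K rule: infinite_finite_induct) (auto simp: mean_bounded_0 mean_bounded_add)

text \<open>
  Nonnegative linearisation coefficients and multiplicativity of \<open>alpha\<close> give the operator norm.
\<close>

lemma mean_bounded_sphere_sum: assumes "mean_bounded C g" shows "mean_bounded (alpha lam i * C) (sphere_sum i g)"
  unfolding mean_bounded_def
proof (intro allI)
  fix x j
  have "sphere_sum j (\<lambda>y. cmod (sphere_sum i g y)) x \<le> sphere_sum j (sphere_sum i (\<lambda>y. cmod (g y))) x"
    by (intro sphere_sum_mono norm_sphere_sum_le)
  also have "\<dots> = (\<Sum>k\<le>j + i. real (lin_coeff j i k) * sphere_sum k (\<lambda>y. cmod (g y)) x)"
    by (simp add: sphere_sum_mult)
  also have "\<dots> \<le> (\<Sum>k\<le>j + i. real (lin_coeff j i k) * (C * alpha lam k))"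
    using assms unfolding mean_bounded_def by (intro sum_mono mult_left_mono) auto
  also have "\<dots> = C * (\<Sum>k\<le>j + i. real (lin_coeff j i k) * alpha lam k)"
    by (simp add: sum_distrib_left mult_ac)
  also have "\<dots> = alpha lam i * C * alpha lam j" by (simp only: alpha_mult) (simp add: mult_ac)
  finally show "sphere_sum j (\<lambda>y. cmod (sphere_sum i g y)) x \<le> alpha lam i * C * alpha lam j" .
qed

definition mix :: "nat \<Rightarrow> (nat \<Rightarrow> real) \<Rightarrow> ('v \<Rightarrow> complex) \<Rightarrow> 'v \<Rightarrow> complex" where
  "mix L c g x = (\<Sum>k\<le>L. of_real (c k) * sphere_sum k g x)"

lemma mean_bounded_mix:
  assumes "mean_bounded C g" "\<And>k. c k \<ge> 0"
  shows "mean_bounded ((\<Sum>k\<le>L. c k * alpha lam k) * C) (mix L c g)"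
proof -
  have "mean_bounded (c k * (alpha lam k * C)) (\<lambda>x. of_real (c k) * sphere_sum k g x)" for k
    using mean_bounded_cmult[OF mean_bounded_sphere_sum[OF assms(1)], of "of_real (c k)" k] assms(2)[of k] by simp
  then have "mean_bounded (\<Sum>k\<le>L. c k * (alpha lam k * C)) (mix L c g)"
    unfolding mix_def by (intro mean_bounded_sum)
  then show ?thesis by (simp add: sum_distrib_right mult.assoc)
qed

lemma mix_linear:
  "mix L c (\<lambda>x. g x + h x) x = mix L c g x + mix L c h x"
  "mix L c (\<lambda>x. g x - h x) x = mix L c g x - mix L c h x"
  "mix L c (\<lambda>x. a * g x) x = a * mix L c g x"
  "mix L c (\<lambda>x. \<Sum>i\<in>I. G i x) x = (\<Sum>i\<in>I. mix L c (G i) x)"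
     apply (simp_all add: mix_def sphere_sum_linear sum.distrib sum_subtractf algebra_simps sum_distrib_left)
  apply (subst sum.swap) ..

text \<open>
  If a mixture has mass one and charges both the identity and \<open>R\<close> with weight at least \<open>\<epsilon>\<close>,
  then each of its powers contains the partial geometric series in \<open>R\<close> with
  weight \<open>\<epsilon> ^ m\<close>. The rest has exactly the remaining mass as a norm bound, since every operator
  involved is a contraction.
\<close>

lemma mix_power_decomp:
  fixes i :: nat
  defines "R \<equiv> \<lambda>(g :: 'v \<Rightarrow> complex) x. sphere_sum i g x / of_real (alpha lam i)"
  assumes c: "\<And>k. c k \<ge> 0" "(\<Sum>k\<le>L. c k * alpha lam k) = 1"
    and i: "1 \<le> i" "i \<le> L" and eps: "0 < \<epsilon>" "\<epsilon> \<le> c 0" "\<epsilon> \<le> c i * alpha lam i"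
    and u: "mean_bounded N u"
  shows "\<exists>w. mean_bounded ((1 - (real m + 1) * \<epsilon> ^ m) * N) w \<and>
     (mix L c ^^ m) u = (\<lambda>x. of_real (\<epsilon> ^ m) * (\<Sum>j\<le>m. (R ^^ j) u x) + w x)"
proof (induction m)
  case 0
  then show ?case using mean_bounded_0 by (intro exI[of _ "\<lambda>_. 0"]) simp
next
  case (Suc m)
  then obtain w where w: "mean_bounded ((1 - (real m + 1) * \<epsilon> ^ m) * N) w"
    "(mix L c ^^ m) u = (\<lambda>x. of_real (\<epsilon> ^ m) * (\<Sum>j\<le>m. (R ^^ j) u x) + w x)" by blast
  (* the coefficients of the mixture after removing the identity and R with weight epsilon each *)
  define e where "e k = c k - (if k = 0 then \<epsilon> else 0) - (if k = i then \<epsilon> / alpha lam i else 0)" for k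
  have e_nonneg: "e k \<ge> 0" for k
    using c(1)[of k] i eps alpha_pos[of i] by (auto simp: e_def field_simps)
  have "(\<Sum>k\<le>L. e k * alpha lam k) = (\<Sum>k\<le>L. c k * alpha lam k - (if k = 0 then \<epsilon> else 0) - (if k = i then \<epsilon> else 0))"
    using alpha_pos[of i] i by (intro sum.cong) (auto simp: e_def field_simps)
  also have "\<dots> = 1 - 2 * \<epsilon>" using i c(2) by (simp add: sum_subtractf)
  finally have e_mass: "(\<Sum>k\<le>L. e k * alpha lam k) = 1 - 2 * \<epsilon>" .
  have split: "mix L c g x = of_real \<epsilon> * (g x + R g x) + mix L e g x" for g x
  proof -
    have "mix L c g x = (\<Sum>k\<le>L. of_real (e k) * sphere_sum k g x + (if k = 0 then of_real \<epsilon> * g x else 0)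
        + (if k = i then of_real \<epsilon> * R g x else 0))"
      unfolding mix_def using i alpha_pos[of i]
      by (intro sum.cong refl) (auto simp: e_def R_def algebra_simps)
    also have "\<dots> = mix L e g x + of_real \<epsilon> * g x + of_real \<epsilon> * R g x"
      using i by (simp add: sum.distrib mix_def)
    finally show ?thesis by (simp add: algebra_simps)
  qed
  have R_bnd: "mean_bounded C (R g)" if "mean_bounded C g" for C g
    using mean_bounded_cmult[OF mean_bounded_sphere_sum[OF that, of i], of "1 / of_real (alpha lam i)"] alpha_pos[of i]
    by (simp add: R_def norm_divide)
  have Rj_bnd: "mean_bounded N ((R ^^ j) u)" for j
    by (induction j) (auto intro: u R_bnd)
  define V where "V = (\<lambda>x. \<Sum>j\<le>m. (R ^^ j) u x)"
  have V_bnd: "mean_bounded ((real m + 1) * N) V"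
    unfolding V_def using mean_bounded_sum[of "{..m}" "\<lambda>_. N" "\<lambda>j. (R ^^ j) u"] Rj_bnd by (simp add: add.commute)
  (* the terms of V and of R V that overlap are counted twice in V + R V; V' collects the second copies *)
  define V' where "V' = (\<lambda>x. \<Sum>j<m. (R ^^ Suc j) u x)"
  have V'_bnd: "mean_bounded (real m * N) V'"
    unfolding V'_def using mean_bounded_sum[of "{..<m}" "\<lambda>_. N" "\<lambda>j. (R ^^ Suc j) u"] Rj_bnd[of "Suc _"] by simp
  have RV: "V x + R V x = (\<Sum>j\<le>Suc m. (R ^^ j) u x) + V' x" for x
  proof -
    have "R V x = (\<Sum>j\<le>m. (R ^^ Suc j) u x)"
      by (simp add: V_def R_def sphere_sum_linear sum_divide_distrib)
    also have "\<dots> = V' x + (R ^^ Suc m) u x"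
      unfolding V'_def by (simp only: sum.lessThan_Suc flip: lessThan_Suc_atMost)
    finally show ?thesis by (simp add: V_def)
  qed
  define w' where "w' = (\<lambda>x. of_real (\<epsilon> ^ Suc m) * V' x + of_real (\<epsilon> ^ m) * mix L e V x + mix L c w x)"
  have "mean_bounded (cmod (of_real (\<epsilon> ^ Suc m)) * (real m * N) + cmod (of_real (\<epsilon> ^ m)) * ((1 - 2 * \<epsilon>) * ((real m + 1) * N))
      + 1 * ((1 - (real m + 1) * \<epsilon> ^ m) * N)) w'"
    unfolding w'_def
    using mean_bounded_mix[OF V_bnd, of e L, OF e_nonneg] mean_bounded_mix[OF w(1), of c L, OF c(1)]
    by (intro mean_bounded_add mean_bounded_cmult V'_bnd) (simp_all only: e_mass c(2))
  moreover have "cmod (of_real (\<epsilon> ^ Suc m)) * (real m * N) + cmod (of_real (\<epsilon> ^ m)) * ((1 - 2 * \<epsilon>) * ((real m + 1) * N))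
      + 1 * ((1 - (real m + 1) * \<epsilon> ^ m) * N) = (1 - (real (Suc m) + 1) * \<epsilon> ^ Suc m) * N"
    using eps(1) by (simp add: norm_power norm_mult algebra_simps)
  ultimately have w'_bnd: "mean_bounded ((1 - (real (Suc m) + 1) * \<epsilon> ^ Suc m) * N) w'" by simp
  have "(mix L c ^^ Suc m) u = mix L c (\<lambda>x. of_real (\<epsilon> ^ m) * V x + w x)"
    using w(2) by (simp add: V_def)
  also have "\<dots> = (\<lambda>x. of_real (\<epsilon> ^ Suc m) * (V x + R V x) + of_real (\<epsilon> ^ m) * mix L e V x + mix L c w x)"
    by (rule ext) (simp add: mix_linear split[of V], simp add: algebra_simps)
  also have "\<dots> = (\<lambda>x. of_real (\<epsilon> ^ Suc m) * (\<Sum>j\<le>Suc m. (R ^^ j) u x) + w' x)"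
    by (rule ext) (simp only: RV w'_def distrib_left add.assoc)
  finally show ?case using w'_bnd by blast
qed

text \<open>
  A bounded backward orbit of a mixture that charges the identity and \<open>sphere_sum i\<close> consists of eigenfunctions
  of \<open>sphere_sum i\<close>. The deviation of the orbit from this is again an orbit; a common norm bound \<open>N\<close>
  for it improves itself through the power decomposition, because the geometric
  series telescopes on the deviation, and the best bound must be zero.
\<close>

theorem liouville:
  assumes c: "\<And>k. c k \<ge> 0" "(\<Sum>k\<le>L. c k * alpha lam k) = 1" "c 0 > 0" "c i > 0"
    and i: "1 \<le> i" "i \<le> L" 
    and F: "\<And>m. mean_bounded C (F m)" and om: "cmod \<omega> = 1"
    and step: "\<And>m x. mix L c (F (Suc m)) x = \<omega> * F m x"
  shows "sphere_sum i (F 0) x = of_real (alpha lam i) * F 0 x"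
proof -
  define R where "R = (\<lambda>g x. sphere_sum i g x / of_real (alpha lam i) :: complex)"
  (* the largest weight that can be split off both charged terms *)
  define \<epsilon> where "\<epsilon> = min (c 0) (c i * alpha lam i)"
  have eps: "\<epsilon> > 0" "\<epsilon> \<le> c 0" "\<epsilon> \<le> c i * alpha lam i" using c alpha_pos[of i] by (auto simp: \<epsilon>_def)
  define u where "u m = (\<lambda>x. F m x - R (F m) x)" for m
  have R_bnd: "mean_bounded C (R g)" if "mean_bounded C g" for C g
    using mean_bounded_cmult[OF mean_bounded_sphere_sum[OF that, of i], of "1 / of_real (alpha lam i)"] alpha_pos[of i]
    by (simp add: R_def norm_divide)
  have R_sub: "R (\<lambda>x. g x - h x) = (\<lambda>x. R g x - R h x)" for g h
    by (simp add: R_def sphere_sum_linear diff_divide_distrib)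
  have mean_bounded_diff: "mean_bounded (C + D) (\<lambda>x. g x - h x)" if "mean_bounded C g" "mean_bounded D h" for C D g h
    using mean_bounded_add[OF that(1) mean_bounded_cmult[OF that(2), of "-1"]] by simp
  have Rj_bnd: "mean_bounded C ((R ^^ j) (F m))" for j m
    by (induction j) (auto intro: F R_bnd)
  have tele: "(\<Sum>j\<le>m. (R ^^ j) (u k) x) = F k x - (R ^^ Suc m) (F k) x" for m k x
  proof -
    have "(R ^^ j) (u k) = (\<lambda>x. (R ^^ j) (F k) x - (R ^^ Suc j) (F k) x)" for j
      by (induction j) (simp_all add: u_def R_sub)
    note pw = this
    show ?thesis
    proof (induction m)
      case 0
      then show ?case by (simp add: u_def)
    qed (simp add: pw)
  qed
  have mixu: "mix L c (u (Suc m)) = (\<lambda>x. \<omega> * u m x)" for m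
  proof
    fix x
    have "mix L c (R (F (Suc m))) x = R (mix L c (F (Suc m))) x"
      unfolding mix_def R_def by (simp add: sphere_sum_linear divide_inverse mult.commute[of _ "inverse _"] 
         sphere_sum_commute[of i] sum_distrib_left mult.left_commute)
    also have "mix L c (F (Suc m)) = (\<lambda>x. \<omega> * F m x)" using step by blast
    finally show "mix L c (u (Suc m)) x = \<omega> * u m x"
      by (simp add: u_def mix_linear step R_def sphere_sum_linear algebra_simps)
  qed
  have mixpow: "(mix L c ^^ m) (u (k + m)) = (\<lambda>x. \<omega> ^ m * u k x)" for k m
  proof (induction m arbitrary: k)
    case (Suc m)
    have "(mix L c ^^ Suc m) (u (k + Suc m)) = mix L c ((mix L c ^^ m) (u (Suc k + m)))" by simp
    also have "\<dots> = (\<lambda>x. \<omega> ^ m * mix L c (u (Suc k)) x)" unfolding Suc by (rule ext) (rule mix_linear)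
    finally show ?case by (simp add: mixu mult_ac)
  qed simp
  have improve: "mean_bounded (2 * C * \<epsilon> ^ m + (1 - (real m + 1) * \<epsilon> ^ m) * N) (u k)"
    if N: "\<And>k. mean_bounded N (u k)" for N m k
  proof -
    obtain w where w: "mean_bounded ((1 - (real m + 1) * \<epsilon> ^ m) * N) w"
      "(mix L c ^^ m) (u (k + m)) = (\<lambda>x. of_real (\<epsilon> ^ m) * (\<Sum>j\<le>m. (R ^^ j) (u (k + m)) x) + w x)"
      using mix_power_decomp[OF c(1,2) i eps N[of "k + m"], of m] unfolding R_def by blast
    have "mean_bounded (cmod (of_real (\<epsilon> ^ m)) * (C + C) + (1 - (real m + 1) * \<epsilon> ^ m) * N)
       (\<lambda>x. \<omega> ^ m * u k x)"
      using w(2) unfolding mixpow tele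
      by (simp only:) (intro mean_bounded_add mean_bounded_cmult mean_bounded_diff F Rj_bnd w(1))
    moreover have "\<omega> \<noteq> 0" using om by auto
    ultimately show ?thesis
      using mean_bounded_cmult[of _ "\<lambda>x. \<omega> ^ m * u k x" "1 / \<omega> ^ m"] om eps(1) by (auto simp: norm_divide norm_power mult_ac)
  qed
  have u_bnd: "mean_bounded (2 * C) (u k)" for k
    using mean_bounded_diff[OF F[of k] R_bnd[OF F[of k]]] by (simp add: u_def)
  (* the supremum of X is the best common norm bound of all u k *)
  define X where "X = {sphere_sum j (\<lambda>y. cmod (u k y)) x / alpha lam j | j k x. True}"
  have mean_bounded_iff: "(\<forall>k. mean_bounded N (u k)) \<longleftrightarrow> (\<forall>z\<in>X. z \<le> N)" for N
  proof -
    have "(\<forall>k. mean_bounded N (u k)) \<longleftrightarrow> (\<forall>k x j. sphere_sum j (\<lambda>y. cmod (u k y)) x / alpha lam j \<le> N)"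
      by (simp add: mean_bounded_def alpha_pos pos_divide_le_eq)
    then show ?thesis unfolding X_def by blast
  qed
  have "bdd_above X" using u_bnd mean_bounded_iff unfolding bdd_above_def by blast
  have X_ne: "X \<noteq> {}" by (auto simp: X_def)
  define N where "N = Sup X"
  have N_bnd: "\<forall>k. mean_bounded N (u k)" unfolding mean_bounded_iff N_def using \<open>bdd_above X\<close> by (auto intro: cSup_upper)
  have "(real m + 1) * N \<le> 2 * C" for m
  proof -
    have "N \<le> 2 * C * \<epsilon> ^ m + (1 - (real m + 1) * \<epsilon> ^ m) * N"
      unfolding N_def using improve N_bnd mean_bounded_iff
      by (intro cSup_least[OF X_ne]) (unfold N_def[symmetric], blast)
    then have "\<epsilon> ^ m * ((real m + 1) * N) \<le> \<epsilon> ^ m * (2 * C)" by (simp add: algebra_simps)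
    then show ?thesis using eps(1) by (simp only: mult_le_cancel_left_pos zero_less_power)
  qed
  then have "N \<le> 0"
  proof (rule_tac ccontr)
    assume *: "\<And>m. (real m + 1) * N \<le> 2 * C" "\<not> N \<le> 0"
    obtain m where "real m > 2 * C / N" using reals_Archimedean2 by blast
    then have "real m * N > 2 * C" using *(2) by (simp add: field_simps)
    then show False using *(1)[of m] *(2) by (simp add: algebra_simps)
  qed
  moreover have "sphere_sum 0 (\<lambda>y. cmod (u 0 y)) x / alpha lam 0 \<in> X" unfolding X_def by blast
  ultimately have "sphere_sum 0 (\<lambda>y. cmod (u 0 y)) x / alpha lam 0 \<le> 0"
    using N_bnd unfolding mean_bounded_iff by (meson order_trans)
  then have "F 0 x = R (F 0) x" by (simp add: u_def)
  then show ?thesis using alpha_pos[of i] by (simp add: R_def field_simps)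
qed

end

section \<open>Weak Lebesgue spaces\<close>

lemma conj_exponent_cases:
  assumes "1 \<le> p"
  obtains "p = 1" "conj_exponent p = \<infinity>"
  | r where "p > 1" "conj_exponent p = ennreal r" "r > 1" "1 / r = 1 - 1 / p"
proof (cases "p = 1")
  case False
  then have "p > 1" "p / (p - 1) > 1" "1 / (p / (p - 1)) = 1 - 1 / p" using assms by (auto simp: field_simps)
  then show ?thesis using that(2)[of "p / (p - 1)"] False by (auto simp: conj_exponent_def)
qed (use that in \<open>auto simp: conj_exponent_def\<close>)

lemma weak_norm_infinity_iff:
  assumes "M \<ge> 0" shows "weak_norm \<infinity> f \<le> ennreal M \<longleftrightarrow> (\<forall>x. cmod (f x) \<le> M)"
  using assms by (simp add: weak_norm_def SUP_le_iff ennreal_le_iff)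

text \<open>
  The weak norm bound for a finite exponent in terms of real numbers.
\<close>

definition weak_dist :: "real \<Rightarrow> real \<Rightarrow> ('v \<Rightarrow> complex) \<Rightarrow> bool" where
  "weak_dist r M f \<longleftrightarrow>
    (\<forall>t>0. finite {x. t < cmod (f x)} \<and> t * real (card {x. t < cmod (f x)}) powr (1 / r) \<le> M)"

lemma weak_norm_le_iff:
  assumes "M \<ge> 0" "r > 0" shows "weak_norm (ennreal r) f \<le> ennreal M \<longleftrightarrow> weak_dist r M f"
proof -
  have "weak_norm (ennreal r) f \<le> ennreal M \<longleftrightarrow> (\<forall>t\<in>{0<..}.
      (if finite {x. t < cmod (f x)}
       then ennreal (t * real (card {x. t < cmod (f x)}) powr (1 / r)) else \<infinity>) \<le> ennreal M)"
  proof -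
    have "ennreal r \<noteq> \<infinity>" "enn2real (ennreal r) = r" using assms(2) by auto
    then show ?thesis by (simp only: weak_norm_def if_False SUP_le_iff)
  qed
  then show ?thesis using assms(1)
    by (auto simp: weak_dist_def ennreal_le_iff top_unique split: if_splits)
qed

lemma less_top_ennreal_iff_bounded: "(x :: ennreal) < \<infinity> \<longleftrightarrow> (\<exists>M\<ge>0. x \<le> ennreal M)"
proof
  show "\<exists>M\<ge>0. x \<le> ennreal M" if "x < \<infinity>"
    using that by (cases x) auto
qed (auto intro: le_less_trans)

lemma weak_L_iff_dist:
  assumes "r > 0" shows "f \<in> weak_L (ennreal r) \<longleftrightarrow> (\<exists>M\<ge>0. weak_dist r M f)"
proof -
  have "f \<in> weak_L (ennreal r) \<longleftrightarrow> (\<exists>M\<ge>0. weak_norm (ennreal r) f \<le> ennreal M)"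
    unfolding weak_L_def mem_Collect_eq by (rule less_top_ennreal_iff_bounded)
  then show ?thesis using weak_norm_le_iff[OF _ assms, where f = f] by auto
qed

lemma weak_L_infinity_iff: "f \<in> weak_L \<infinity> \<longleftrightarrow> (\<exists>M\<ge>0. \<forall>x. cmod (f x) \<le> M)"
proof -
  have "f \<in> weak_L \<infinity> \<longleftrightarrow> (\<exists>M\<ge>0. weak_norm \<infinity> f \<le> ennreal M)"
    unfolding weak_L_def mem_Collect_eq by (rule less_top_ennreal_iff_bounded)
  then show ?thesis using weak_norm_infinity_iff[where f = f] by auto
qed

text \<open>
  All points of \<open>B\<close> lie in the superlevel set at any level below the minimum of \<open>cmod (f y)\<close>, so that
  minimum is controlled by the size of \<open>B\<close>. Peeling off minimal points one at a time then gives the estimates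
  for sums over finite sets.
\<close>

lemma weak_dist_min:
  assumes "weak_dist r M f" "r > 0" "finite B" "B \<noteq> {}"
  obtains y where "y \<in> B" "cmod (f y) \<le> M * real (card B) powr (- (1 / r))"
proof -
  define y where "y = arg_min_on (\<lambda>y. cmod (f y)) B"
  have y: "y \<in> B" "\<And>z. z \<in> B \<Longrightarrow> cmod (f y) \<le> cmod (f z)"
    using arg_min_if_finite[OF assms(3,4), of "\<lambda>y. cmod (f y)"] by (auto simp: y_def not_less)
  have N: "real (card B) > 0" using assms by (simp add: card_gt_0_iff)
  have "cmod (f y) * real (card B) powr (1 / r) \<le> M"
  (* the level s * cmod (f y) with s < 1 lies strictly below the minimum, as the superlevel sets are defined by strict inequality *)
  proof (rule field_le_mult_one_interval)
    fix s :: real assume s: "0 < s" "s < 1"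
    show "s * (cmod (f y) * real (card B) powr (1 / r)) \<le> M"
    proof (cases "f y = 0")
      case True
      have "0 \<le> M" using assms(1) unfolding weak_dist_def
        by (meson mult_nonneg_nonneg order_trans powr_ge_zero zero_le_one zero_less_one)
      with True show ?thesis by simp
    next
      case False
      let ?t = "s * cmod (f y)"
      have t: "?t > 0" "?t < cmod (f y)" using s False by auto
      then have fin: "finite {x. ?t < cmod (f x)}" and le: "?t * real (card {x. ?t < cmod (f x)}) powr (1 / r) \<le> M"
        using assms(1) by (auto simp: weak_dist_def)
      have "B \<subseteq> {x. ?t < cmod (f x)}" using y t by force
      then have "card B \<le> card {x. ?t < cmod (f x)}" by (rule card_mono[OF fin])
      then have "real (card B) powr (1 / r) \<le> real (card {x. ?t < cmod (f x)}) powr (1 / r)"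
        using assms(2) by (intro powr_mono2) auto
      then have "?t * real (card B) powr (1 / r) \<le> ?t * real (card {x. ?t < cmod (f x)}) powr (1 / r)"
        using t(1) by (intro mult_left_mono) auto
      then show ?thesis using le by (simp add: mult.assoc)
    qed
  qed
  then have "cmod (f y) \<le> M * real (card B) powr (- (1 / r))"
    using N by (simp add: powr_minus field_simps)
  then show ?thesis using that y(1) by blast
qed

lemma powr_increment_ge:
  fixes N :: nat
  assumes "0 < s" "s \<le> 1"
  shows "real N powr s + s * real (Suc N) powr (s - 1) \<le> real (Suc N) powr s"
proof (cases "N = 0")
  case True
  then show ?thesis using assms by simp
next
  case False
  have "\<exists>z. real N < z \<and> z < real (Suc N) \<and> real (Suc N) powr s - real N powr s = (real (Suc N) - real N) * (s * z powr (s - 1))"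
    using False by (intro MVT2) (auto intro!: derivative_eq_intros)
  then obtain z where z: "real N < z" "z < real (Suc N)" "real (Suc N) powr s - real N powr s = s * z powr (s - 1)"
    by auto
  have "real (Suc N) powr (s - 1) \<le> z powr (s - 1)"
    using z assms False by (intro powr_mono2') auto
  then have "s * real (Suc N) powr (s - 1) \<le> s * z powr (s - 1)" using assms by (intro mult_left_mono) auto
  with z(3) show ?thesis by linarith
qed

lemma weak_dist_sum_le:
  assumes "weak_dist r M f" "r > 1" "finite B" "M \<ge> 0"
  shows "(\<Sum>y\<in>B. cmod (f y)) \<le> M / (1 - 1 / r) * real (card B) powr (1 - 1 / r)"
  using assms(3)
proof (induction "card B" arbitrary: B)
  case 0
  then show ?case by simp
next
  case (Suc n)
  let ?s = "1 - 1 / r"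
  have s: "0 < ?s" "?s \<le> 1" using assms(2) by auto
  obtain y where y: "y \<in> B" "cmod (f y) \<le> M * real (Suc n) powr (?s - 1)"
  proof -
    have "B \<noteq> {}" "r > 0" using Suc.hyps(2) assms(2) by auto
    from weak_dist_min[OF assms(1) this(2) Suc.prems this(1)] that show ?thesis
      unfolding Suc.hyps(2)[symmetric] by auto
  qed
  have "(\<Sum>y\<in>B. cmod (f y)) = cmod (f y) + (\<Sum>z\<in>B - {y}. cmod (f z))"
    using y Suc.prems by (simp add: sum.remove)
  also have "\<dots> \<le> M * real (Suc n) powr (?s - 1) + M / ?s * real n powr ?s"
  proof (intro add_mono y(2))
    have n: "n = card (B - {y})" using Suc.hyps(2) Suc.prems y(1) by simp
    show "(\<Sum>z\<in>B - {y}. cmod (f z)) \<le> M / ?s * real n powr ?s"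
      using Suc.hyps(1)[OF n] Suc.prems by (simp flip: n)
  qed
  also have "\<dots> = M / ?s * (real n powr ?s + ?s * real (Suc n) powr (?s - 1))"
  proof -
    have "M / s * (a + s * b) = M * b + M / s * a" if "s \<noteq> 0" for s a b :: real
      using that by (simp add: field_simps)
    from this[of ?s "real n powr ?s" "real (Suc n) powr (?s - 1)"] show ?thesis using s(1) by linarith
  qed
  also have "\<dots> \<le> M / ?s * real (Suc n) powr ?s"
    using powr_increment_ge[OF s, of n] s assms(4) by (intro mult_left_mono) auto
  finally show ?case using Suc.hyps(2) by simp
qed

text \<open>
  At the critical exponent the sum over \<open>N\<close> points may still grow, but only
  like \<open>\<Sum>i=1..N. 1 / i\<close>.
\<close>

lemma weak_dist_sum_powr_le:
  assumes "weak_dist r M f" "r > 1" "finite B" "M \<ge> 0"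
  shows "(\<Sum>y\<in>B. cmod (f y) powr r) \<le> M powr r * harm (card B)"
  using assms(3)
proof (induction "card B" arbitrary: B)
  case 0
  then show ?case by (simp add: harm_def)
next
  case (Suc n)
  obtain y where y: "y \<in> B" "cmod (f y) \<le> M * real (Suc n) powr (- (1 / r))"
  proof -
    have "B \<noteq> {}" "r > 0" using Suc.hyps(2) assms(2) by auto
    from weak_dist_min[OF assms(1) this(2) Suc.prems this(1)] that show ?thesis
      unfolding Suc.hyps(2)[symmetric] by auto
  qed
  have "cmod (f y) powr r \<le> (M * real (Suc n) powr (- (1 / r))) powr r"
    using y(2) assms(2) by (intro powr_mono2) auto
  also have "\<dots> = M powr r * inverse (real (Suc n))"
  proof -
    have "(real (Suc n) powr (- (1 / r))) powr r = real (Suc n) powr (- 1)"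
      using assms(2) by (simp only: powr_powr) simp
    then show ?thesis using assms(4) by (simp add: powr_mult powr_minus)
  qed
  finally have 1: "cmod (f y) powr r \<le> M powr r * inverse (real (Suc n))" .
  have "(\<Sum>y\<in>B. cmod (f y) powr r) = cmod (f y) powr r + (\<Sum>z\<in>B - {y}. cmod (f z) powr r)"
    using y Suc.prems by (simp add: sum.remove)
  also have "\<dots> \<le> M powr r * inverse (real (Suc n)) + M powr r * harm n"
  proof (intro add_mono 1)
    have n: "n = card (B - {y})" using Suc.hyps(2) Suc.prems y(1) by simp
    show "(\<Sum>z\<in>B - {y}. cmod (f z) powr r) \<le> M powr r * harm n"
      using Suc.hyps(1)[OF n] Suc.prems by (simp flip: n)
  qed
  also have "\<dots> = M powr r * harm (Suc n)" by (simp add: harm_Suc distrib_left)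
  finally show ?case using Suc.hyps(2) by simp
qed

lemma weak_sum_le:
  assumes "1 \<le> p" "M \<ge> 0" "weak_norm (conj_exponent p) f \<le> ennreal M" "finite B"
  shows "(\<Sum>y\<in>B. cmod (f y)) \<le> p * M * real (card B) powr (1 / p)"
  using conj_exponent_cases[OF assms(1)]
proof cases
  case 1
  then have "(\<Sum>y\<in>B. cmod (f y)) \<le> (\<Sum>y\<in>B. M)"
    using assms(2,3) weak_norm_infinity_iff[of M f] by (intro sum_mono) auto
  then show ?thesis using 1 by (simp add: mult.commute)
next
  case (2 r)
  then have "weak_dist r M f" using assms weak_norm_le_iff[of M r f] by simp
  from weak_dist_sum_le[OF this 2(3) assms(4,2)] show ?thesis using 2 by (simp add: mult.commute)
qed

context tree begin

lemma card_ball_1: "card (gball E x (Suc 0)) = q + 2"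
proof -
  have "gball E x (Suc 0) = insert x {y. E x y}"
    unfolding ball_eq_UN_spheres by (auto simp: sphere_0 sphere_1 atMost_Suc)
  then show ?thesis using E_irrefl finite_nbrs card_nbrs by simp
qed

text \<open>
  A function that is dominated by a local sum of a weak-type function is of weak type as well: a large value
  forces a comparably large value at a vertex nearby, and each vertex is nearby only \<open>q + 2\<close> times.
\<close>

lemma weak_L_local:
  assumes p: "1 \<le> p" and f: "f \<in> weak_L (conj_exponent p)" and K: "K > 0"
    and le: "\<And>x. cmod (h x) \<le> K * (\<Sum>y\<in>gball E x (Suc 0). cmod (f y))"
  shows "h \<in> weak_L (conj_exponent p)"
  using conj_exponent_cases[OF p]
proof cases
  case 1
  then obtain M where M: "M \<ge> 0" "\<And>x. cmod (f x) \<le> M" using f weak_L_infinity_iff[of f] by auto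
  have "cmod (h x) \<le> K * (real (q + 2) * M)" for x
  proof -
    have "(\<Sum>y\<in>gball E x (Suc 0). cmod (f y)) \<le> real (card (gball E x (Suc 0))) * M"
      using M by (intro sum_bounded_above) auto
    then have "K * (\<Sum>y\<in>gball E x (Suc 0). cmod (f y)) \<le> K * (real (q + 2) * M)"
      using K by (intro mult_left_mono) (auto simp: card_ball_1)
    then show ?thesis using le[of x] by linarith
  qed
  moreover have "K * (real (q + 2) * M) \<ge> 0" using K M by simp
  ultimately show ?thesis using 1 weak_L_infinity_iff[of h] by auto
next
  case (2 r)
  then obtain M where M: "M \<ge> 0" "weak_dist r M f" using f weak_L_iff_dist[of r f] by auto
  define c where "c = K * real (q + 2)"
  have c: "c > 0" using K by (simp add: c_def)
  have sub: "{x. t < cmod (h x)} \<subseteq> (\<Union>y\<in>{y. t / c < cmod (f y)}. gball E y (Suc 0))" for t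
  proof
    fix x assume "x \<in> {x. t < cmod (h x)}"
    then have t: "t < K * (\<Sum>y\<in>gball E x (Suc 0). cmod (f y))" using le[of x] by simp
    have "\<exists>y\<in>gball E x (Suc 0). t / c < cmod (f y)"
    proof (rule ccontr)
      assume "\<not> ?thesis"
      then have "(\<Sum>y\<in>gball E x (Suc 0). cmod (f y)) \<le> real (card (gball E x (Suc 0))) * (t / c)"
        by (intro sum_bounded_above) (auto simp: not_less)
      then have "K * (\<Sum>y\<in>gball E x (Suc 0). cmod (f y)) \<le> K * (real (q + 2) * (t / c))"
        using K by (intro mult_left_mono) (auto simp: card_ball_1)
      also have "\<dots> = t" using K by (simp add: c_def)
      finally show False using t by simp
    qed
    then show "x \<in> (\<Union>y\<in>{y. t / c < cmod (f y)}. gball E y (Suc 0))"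
      by (auto simp: gball_def dist_sym)
  qed
  have "weak_dist r (c * real (q + 2) powr (1 / r) * M) h"
    unfolding weak_dist_def
  proof (intro allI impI conjI)
    fix t :: real assume t: "t > 0"
    let ?F = "{y. t / c < cmod (f y)}"
    have F: "finite ?F" "t / c * real (card ?F) powr (1 / r) \<le> M"
      using M(2) divide_pos_pos[OF t c] unfolding weak_dist_def by blast+
    show "finite {x. t < cmod (h x)}"
      using finite_subset[OF sub[of t]] F(1) finite_ball by blast
    have "card {x. t < cmod (h x)} \<le> card (\<Union>y\<in>?F. gball E y (Suc 0))"
      using F(1) finite_ball by (intro card_mono sub) auto
    also have "\<dots> \<le> (\<Sum>y\<in>?F. card (gball E y (Suc 0)))" by (rule card_UN_le[OF F(1)])
    also have "\<dots> = (q + 2) * card ?F" by (simp add: card_ball_1)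
    finally have "real (card {x. t < cmod (h x)}) \<le> real (q + 2) * real (card ?F)"
      by (metis of_nat_le_iff of_nat_mult)
    then have "real (card {x. t < cmod (h x)}) powr (1 / r) \<le> (real (q + 2) * real (card ?F)) powr (1 / r)"
      using 2 by (intro powr_mono2) auto
    then have "t * real (card {x. t < cmod (h x)}) powr (1 / r)
        \<le> t * (real (q + 2) powr (1 / r) * real (card ?F) powr (1 / r))"
      using t by (simp add: powr_mult)
    also have "\<dots> = c * real (q + 2) powr (1 / r) * (t / c * real (card ?F) powr (1 / r))"
      using c by simp
    also have "\<dots> \<le> c * real (q + 2) powr (1 / r) * M"
      using F(2) c by (intro mult_left_mono) auto
    finally show "t * real (card {x. t < cmod (h x)}) powr (1 / r) \<le> c * real (q + 2) powr (1 / r) * M" .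
  qed
  moreover have "c * real (q + 2) powr (1 / r) * M \<ge> 0" using c M by simp
  ultimately show ?thesis using 2 weak_L_iff_dist[of r h] by auto
qed

end

section \<open>Rays, sectors and the Poisson kernel\<close>

context tree begin

lemma dist_induct [case_names root step]:
  assumes "P o'" "\<And>x p n. d o' x = Suc n \<Longrightarrow> E x p \<Longrightarrow> d o' p = n \<Longrightarrow> P p \<Longrightarrow> P x"
  shows "P x"
proof (induction "d o' x" arbitrary: x)
  case 0
  then show ?case using assms(1) dist_eq_0[of o' x] by simp
next
  case (Suc n)
  then obtain p where "E x p" "d o' p = n" using dist_pred[of o' x n] by metis
  then show ?case using assms(2)[of x n p] Suc by simp
qed

end

locale rooted_tree = tree q E for q and E :: "'v \<Rightarrow> 'v \<Rightarrow> bool" +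
  fixes x0 :: 'v
begin

abbreviation level :: "'v \<Rightarrow> nat" where "level \<equiv> d x0"

definition parent :: "'v \<Rightarrow> 'v" where "parent x = (SOME p. E x p \<and> level x = Suc (level p))"

definition children :: "'v \<Rightarrow> 'v set" where "children x = {y. E x y \<and> level y = Suc (level x)}"

lemma level_root [simp]: "level x0 = 0" by simp

lemma parent:
  assumes "level x = Suc n"
  shows "E x (parent x)" "level (parent x) = n" "\<And>v. E x v \<Longrightarrow> v \<noteq> parent x \<Longrightarrow> level v = Suc (Suc n)"
proof -
  obtain p where p: "E x p" "level p = n" "\<And>v. E x v \<Longrightarrow> v \<noteq> p \<Longrightarrow> level v = Suc (Suc n)"
    using nbrs_split[OF assms] by blast
  have ex: "E x (parent x) \<and> level x = Suc (level (parent x))"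
    unfolding parent_def by (rule someI[of _ p]) (use p assms in auto)
  then have "parent x = p" using p(3)[of "parent x"] assms by fastforce
  then show "E x (parent x)" "level (parent x) = n" "\<And>v. E x v \<Longrightarrow> v \<noteq> parent x \<Longrightarrow> level v = Suc (Suc n)"
    using p by auto
qed

lemma parent_eqI: "E x p \<Longrightarrow> level x = Suc (level p) \<Longrightarrow> parent x = p"
  using parent(3)[of x "level p" p] by auto

lemma level_induct [case_names root step]:
  assumes "P x0" "\<And>x n. level x = Suc n \<Longrightarrow> P (parent x) \<Longrightarrow> P x"
  shows "P x"
  using assms(1)
proof (induction x rule: dist_induct[where o' = x0])
  case (step x p n)
  then show ?case using assms(2)[of x n] parent_eqI[of x p] by auto
qed

lemma mem_children: "y \<in> children x \<longleftrightarrow> level y = Suc (level x) \<and> parent y = x"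
  using parent(1)[of y "level x"] parent_eqI[of y x] E_sym by (auto simp: children_def)

lemma finite_children: "finite (children x)"
  by (rule finite_subset[OF _ finite_nbrs[of x]]) (auto simp: children_def)

lemma nbrs_eq_children:
  "{v. E x v} = (if level x = 0 then children x else insert (parent x) (children x))"
proof (cases "level x")
  case 0
  then have "x = x0" by (metis dist_eq_0)
  then show ?thesis using dist_eq_1[of x0] by (auto simp: children_def)
next
  case (Suc n)
  then show ?thesis using parent[OF Suc] by (auto simp: children_def)
qed

lemma parent_notin_children: "parent x \<notin> children x" if "level x = Suc n"
  using parent(2)[OF that] that by (simp add: children_def)

lemma sum_nbrs:
  fixes g :: "'v \<Rightarrow> 'b::comm_ring_1"
  shows "sphere_sum (Suc 0) g x = (\<Sum>y\<in>children x. g y) + (if level x = 0 then 0 else g (parent x))"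
proof (cases "level x")
  case (Suc n)
  then show ?thesis using parent_notin_children[OF Suc]
    by (simp add: sphere_sum_def sphere_1 nbrs_eq_children finite_children)
qed (simp add: sphere_sum_def sphere_1 nbrs_eq_children)

lemma card_children: "card (children x) = backdeg (level x)"
proof (cases "level x")
  case 0
  then show ?thesis using card_nbrs[of x] by (simp add: nbrs_eq_children backdeg_def)
next
  case (Suc n)
  then show ?thesis using card_nbrs[of x] parent_notin_children[OF Suc] finite_children
    by (simp add: nbrs_eq_children backdeg_def)
qed

lemma sphere_Suc: "S x0 (Suc n) = (\<Union>x\<in>S x0 n. children x)"
  using parent(2) by (auto simp: mem_sphere mem_children)

lemma sum_sphere_Suc: "(\<Sum>y\<in>S x0 (Suc n). f y) = (\<Sum>x\<in>S x0 n. \<Sum>y\<in>children x. f y)"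
  unfolding sphere_Suc
  by (rule sum.UNION_disjoint) (auto simp: finite_sphere finite_children mem_children)

lemma card_sphere_Suc: "card (S x0 (Suc n)) = backdeg n * card (S x0 n)"
  by (cases n) (simp_all add: card_sphere sphere_0 backdeg_def algebra_simps)

lemma card_sphere_pos: "card (S x0 n) > 0"
  using q2 by (cases n) (simp_all add: card_sphere sphere_0)

abbreviation rays' :: "(nat \<Rightarrow> 'v) set" where "rays' \<equiv> rays E x0"
abbreviation sec :: "'v \<Rightarrow> (nat \<Rightarrow> 'v) set" where "sec \<equiv> sector E x0"

lemma ray_0: "\<omega> \<in> rays' \<Longrightarrow> \<omega> 0 = x0"
  by (simp add: rays_def)

lemma ray_level: "\<omega> \<in> rays' \<Longrightarrow> level (\<omega> n) = n"
  unfolding rays_def by force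

lemma ray_edge: "\<omega> \<in> rays' \<Longrightarrow> E (\<omega> n) (\<omega> (Suc n))"
  unfolding rays_def using dist_eq_1[of "\<omega> n" "\<omega> (Suc n)"] by force

lemma ray_parent: "\<omega> \<in> rays' \<Longrightarrow> parent (\<omega> (Suc n)) = \<omega> n"
  using ray_edge[of \<omega> n] ray_level[of \<omega>] by (intro parent_eqI) (auto intro: E_sym)

lemma confluent:
  assumes "\<omega> \<in> rays'"
  shows "confluent E x0 x \<omega> \<in> geodesic E x0 x \<inter> range \<omega>"
    and "v \<in> geodesic E x0 x \<inter> range \<omega> \<Longrightarrow> level v \<le> level (confluent E x0 x \<omega>)"
proof -
  have "x0 \<in> geodesic E x0 x \<inter> range \<omega>"
    using ray_0[OF assms] by (auto simp: geodesic_def image_iff intro!: exI[of _ 0])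
  moreover have "\<forall>y. y \<in> geodesic E x0 x \<inter> range \<omega> \<longrightarrow> level y < Suc (level x)"
    by (auto simp: geodesic_def)
  ultimately show "confluent E x0 x \<omega> \<in> geodesic E x0 x \<inter> range \<omega>"
    unfolding confluent_def by (rule arg_max_natI)
  show "level v \<le> level (confluent E x0 x \<omega>)" if "v \<in> geodesic E x0 x \<inter> range \<omega>"
    unfolding confluent_def by (rule arg_max_nat_le[where b = "Suc (level x)"]) (use that in \<open>auto simp: geodesic_def\<close>)
qed

text \<open>
  The confluence point of a vertex and a ray has the level of the vertex only if it is the vertex itself.
\<close>

lemma mem_sector: "\<omega> \<in> sec x \<longleftrightarrow> \<omega> \<in> rays' \<and> \<omega> (level x) = x"
proof (intro iffI conjI)
  assume "\<omega> \<in> sec x"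
  then show r: "\<omega> \<in> rays'" by (simp add: sector_def)
  let ?c = "confluent E x0 x \<omega>"
  have "level ?c = level x" using \<open>\<omega> \<in> sec x\<close> by (simp add: sector_def)
  moreover have "?c \<in> geodesic E x0 x" "?c \<in> range \<omega>" using confluent(1)[OF r] by auto
  ultimately have "?c = x" by (simp add: geodesic_def)
  then obtain m where "x = \<omega> m" using \<open>?c \<in> range \<omega>\<close> by auto
  then show "\<omega> (level x) = x" using ray_level[OF r] by simp
next
  assume *: "\<omega> \<in> rays' \<and> \<omega> (level x) = x"
  then have "x \<in> geodesic E x0 x \<inter> range \<omega>" by (auto simp: geodesic_def image_iff intro: exI[of _ "level x"])
  then have "level x \<le> level (confluent E x0 x \<omega>)" using confluent(2) * by blast
  moreover have "level (confluent E x0 x \<omega>) \<le> level x"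
    using confluent(1)[of \<omega> x] * by (auto simp: geodesic_def)
  ultimately show "\<omega> \<in> sec x" using * by (simp add: sector_def)
qed

lemma sector_root: "sec x0 = rays'"
  by (auto simp: mem_sector ray_0)

lemma sector_child_subset: "y \<in> children x \<Longrightarrow> sec y \<subseteq> sec x"
  by (auto simp: mem_sector mem_children ray_level) (metis ray_parent)

lemma indicator_sector_children:
  assumes "\<omega> \<in> rays'"
  shows "(indicator (sec x) \<omega> :: real) = (\<Sum>y\<in>children x. indicator (sec y) \<omega>)"
proof (cases "\<omega> \<in> sec x")
  case True
  define y where "y = \<omega> (Suc (level x))"
  have y: "y \<in> children x" using True by (auto simp: y_def mem_sector mem_children ray_level ray_parent)
  have "indicator (sec z) \<omega> = (if z = y then 1 else 0 :: real)" if "z \<in> children x" for z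
    using True that by (auto simp: indicator_def mem_sector mem_children y_def ray_level)
  then have "(\<Sum>z\<in>children x. indicator (sec z) \<omega>) = (\<Sum>z\<in>children x. if z = y then 1 else 0 :: real)"
    by (rule sum.cong[OF refl])
  then show ?thesis using y True finite_children by simp
next
  case False
  then have "indicator (sec y) \<omega> = (0 :: real)" if "y \<in> children x" for y
    using sector_child_subset[OF that] by (auto simp: indicator_def)
  then show ?thesis using False by simp
qed

text \<open>
  Removing the end point from the geodesic of \<open>x\<close> leaves that of its parent; so for a ray that
  misses \<open>x\<close>, the confluence points of \<open>x\<close> and of its parent agree.
\<close>

lemma geodesic_parent:
  assumes "level x = Suc n"
  shows "geodesic E x0 x = insert x (geodesic E x0 (parent x))"
proof (intro equalityI subsetI)
  fix v assume v: "v \<in> geodesic E x0 x"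
  show "v \<in> insert x (geodesic E x0 (parent x))"
  proof (cases "d v x")
    case (Suc m)
    obtain w where w: "E x w" "d v w = m" using dist_pred[OF Suc] by blast
    have "level w \<le> n" using dist_triangle[of x0 w v] w v Suc assms by (simp add: geodesic_def)
    then have "w = parent x" using parent(3)[OF assms w(1)] by auto
    then show ?thesis using w v Suc assms parent(2)[OF assms] by (simp add: geodesic_def)
  qed simp
next
  fix v assume v: "v \<in> insert x (geodesic E x0 (parent x))"
  show "v \<in> geodesic E x0 x"
  proof (cases "v = x")
    case False
    then have "level v + d v (parent x) = n" using v parent(2)[OF assms] by (simp add: geodesic_def)
    moreover have "d v x \<le> Suc (d v (parent x))" using dist_nbr[OF parent(1)[OF assms], of v] by simp
    ultimately show ?thesis using dist_triangle[of x0 x v] assms by (simp add: geodesic_def)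
  qed (simp add: geodesic_def)
qed

lemma confluent_parent:
  assumes "\<omega> \<in> rays'" "\<omega> \<notin> sec x" "level x = Suc n"
  shows "confluent E x0 x \<omega> = confluent E x0 (parent x) \<omega>"
proof -
  have "x \<notin> range \<omega>" using assms ray_level[OF assms(1)] by (auto simp: mem_sector)
  then have "geodesic E x0 x \<inter> range \<omega> = geodesic E x0 (parent x) \<inter> range \<omega>"
    using geodesic_parent[OF assms(3)] by auto
  then show ?thesis by (simp add: confluent_def)
qed

text \<open>
  With \<open>a\<close> a real power of \<open>q\<close>, this is the same real power of the Poisson kernel; the integer exponent
  avoids powers with real exponents in computations.
\<close>

definition kern :: "real \<Rightarrow> 'v \<Rightarrow> (nat \<Rightarrow> 'v) \<Rightarrow> real" where
  "kern a x \<omega> = a powi (2 * int (level (confluent E x0 x \<omega>)) - int (level x))"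

text \<open>
  The amount by which the kernel at a vertex of level \<open>n\<close> exceeds its value propagated from the
  parent, on rays through the vertex.
\<close>

definition jump :: "real \<Rightarrow> nat \<Rightarrow> real" where "jump a n = a ^ n * (1 - 1 / a\<^sup>2)"

lemma kern_root: "\<omega> \<in> rays' \<Longrightarrow> kern a x0 \<omega> = 1"
  using confluent(1)[of \<omega> x0] by (auto simp: kern_def geodesic_def)

text \<open>
  On rays through \<open>x\<close> the kernel gains a factor \<open>a\<close> on the way from the parent, on other rays
  it loses one, because only the level of \<open>x\<close> changes in the exponent.
\<close>

lemma kern_step:
  assumes "\<omega> \<in> rays'" "level x = Suc n" "a > 0"
  shows "kern a x \<omega> = kern a (parent x) \<omega> / a + jump a (level x) * indicator (sec x) \<omega>"
proof (cases "\<omega> \<in> sec x")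
  case True
  then have 1: "level (confluent E x0 x \<omega>) = Suc n" using assms by (simp add: sector_def)
  have "\<omega> \<in> sec (parent x)" using True assms parent(2)[OF assms(2)] ray_parent[OF assms(1), of n] by (auto simp: mem_sector)
  then have 2: "level (confluent E x0 (parent x) \<omega>) = n" using parent(2)[OF assms(2)] by (simp add: sector_def)
  have "kern a x \<omega> = a ^ Suc n" "kern a (parent x) \<omega> = a ^ n"
    using 1 2 assms parent(2)[OF assms(2)] by (simp_all add: kern_def power_int_def nat_add_distrib)
  then show ?thesis using True assms by (simp add: jump_def field_simps power2_eq_square)
next
  case False
  have "kern a x \<omega> = a powi ((2 * int (level (confluent E x0 (parent x) \<omega>)) - int n) - 1)"
    using confluent_parent[OF assms(1) False assms(2)] assms by (simp add: kern_def algebra_simps)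
  also have "\<dots> = kern a (parent x) \<omega> / a"
    using parent(2)[OF assms(2)] assms by (simp add: kern_def power_int_diff)
  finally show ?thesis using False by simp
qed

end

locale boundary = rooted_tree q E x0 for q and E :: "'v \<Rightarrow> 'v \<Rightarrow> bool" and x0 +
  fixes \<nu> :: "(nat \<Rightarrow> 'v) measure"
  assumes boundary_measure: "boundary_measure q E x0 \<nu>"

sublocale boundary \<subseteq> prob_space \<nu>
  using boundary_measure by (simp add: boundary_measure_def)

context boundary begin

lemma space_nu: "space \<nu> = rays'"
  using boundary_measure by (simp add: boundary_measure_def)

lemma sector_sets [measurable]: "sec x \<in> sets \<nu>"
proof -
  have "openin (ray_topology E x0) (sec x)"
    unfolding ray_topology_def by (rule topology_generated_by_Basis) simp
  then show ?thesis using boundary_measure by (auto simp: boundary_measure_def)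
qed

lemma measure_sector: "measure \<nu> (sec x) = 1 / real (card (S x0 (level x)))"
proof (cases "level x")
  case 0
  then have "x = x0" by (metis dist_eq_0)
  then show ?thesis using prob_space by (simp add: sector_root sphere_0 space_nu)
next
  case (Suc n)
  then have "measure \<nu> (sec x) = inverse (real q + 1) * real q powi (1 - int (level x))"
    using boundary_measure by (simp add: boundary_measure_def)
  moreover have "real (card (S x0 (level x))) = (real q + 1) * real q ^ n"
    using Suc by (simp add: card_sphere algebra_simps)
  ultimately show ?thesis using Suc by (simp add: power_int_minus divide_inverse)
qed

definition mass :: "((nat \<Rightarrow> 'v) \<Rightarrow> complex) \<Rightarrow> 'v \<Rightarrow> complex" where
  "mass F x = (LINT \<omega>:sec x|\<nu>. F \<omega>)"

lemma integrable_sector: "integrable \<nu> F \<Longrightarrow> integrable \<nu> (\<lambda>\<omega>. indicator (sec x) \<omega> *\<^sub>R (F \<omega> :: complex))"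
  by (rule integrable_mult_indicator) simp_all

lemma mass_root: "mass F x0 = (LINT \<omega>|\<nu>. F \<omega>)"
  unfolding mass_def set_lebesgue_integral_def sector_root
  by (rule Bochner_Integration.integral_cong) (auto simp: space_nu)

lemma mass_children:
  assumes "integrable \<nu> F"
  shows "mass F x = (\<Sum>y\<in>children x. mass F y)"
proof -
  have "mass F x = (LINT \<omega>|\<nu>. (\<Sum>y\<in>children x. indicator (sec y) \<omega> *\<^sub>R F \<omega>))"
    unfolding mass_def set_lebesgue_integral_def
    by (rule Bochner_Integration.integral_cong)
       (auto simp: space_nu indicator_sector_children scaleR_sum_left)
  then show ?thesis
    using integrable_sector[OF assms] by (simp add: mass_def set_lebesgue_integral_def)
qed

definition pois :: "real \<Rightarrow> ((nat \<Rightarrow> 'v) \<Rightarrow> complex) \<Rightarrow> 'v \<Rightarrow> complex" where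
  "pois a F x = (LINT \<omega>|\<nu>. of_real (kern a x \<omega>) * F \<omega>)"

lemma pois_root: "pois a F x0 = mass F x0"
  unfolding pois_def mass_root
  by (rule Bochner_Integration.integral_cong) (auto simp: space_nu kern_root)

lemma kern_expand:
  fixes F :: "(nat \<Rightarrow> 'v) \<Rightarrow> complex"
  assumes "\<omega> \<in> rays'" "level x = Suc n" "a > 0"
  shows "of_real (kern a x \<omega>) * F \<omega> = of_real (kern a (parent x) \<omega>) * F \<omega> / of_real a
      + of_real (jump a (level x)) * (indicator (sec x) \<omega> *\<^sub>R (F \<omega> :: complex))"
  unfolding kern_step[OF assms] by (simp add: scaleR_conv_of_real distrib_right)

lemma integrable_kern:
  fixes F :: "(nat \<Rightarrow> 'v) \<Rightarrow> complex"
  assumes "integrable \<nu> F" "a > 0"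
  shows "integrable \<nu> (\<lambda>\<omega>. of_real (kern a x \<omega>) * F \<omega>)"
proof (induction x rule: level_induct)
  case root
  have "integrable \<nu> (\<lambda>\<omega>. of_real (kern a x0 \<omega>) * F \<omega>) \<longleftrightarrow> integrable \<nu> F"
    by (rule Bochner_Integration.integrable_cong) (auto simp: space_nu kern_root)
  then show ?case using assms(1) by blast
next
  case (step x n)
  have "integrable \<nu> (\<lambda>\<omega>. of_real (kern a x \<omega>) * F \<omega>) \<longleftrightarrow>
     integrable \<nu> (\<lambda>\<omega>. of_real (kern a (parent x) \<omega>) * F \<omega> / of_real a
      + of_real (jump a (level x)) * (indicator (sec x) \<omega> *\<^sub>R (F \<omega> :: complex)))"
    by (rule Bochner_Integration.integrable_cong[OF refl kern_expand[OF _ step(1) assms(2)]])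
       (simp add: space_nu)
  moreover have "integrable \<nu> (\<lambda>\<omega>. of_real (kern a (parent x) \<omega>) * F \<omega> / of_real a
      + of_real (jump a (level x)) * (indicator (sec x) \<omega> *\<^sub>R (F \<omega> :: complex)))"
    by (intro Bochner_Integration.integrable_add integrable_divide_zero integrable_mult_right
          integrable_sector assms step)
  ultimately show ?case by blast
qed

text \<open>
  The Poisson transform and the integrals over sectors determine each other by this recursion along the tree.
\<close>

lemma pois_step:
  assumes "integrable \<nu> F" "a > 0" "level x = Suc n"
  shows "pois a F x = pois a F (parent x) / of_real a + of_real (jump a (level x)) * mass F x"
proof -
  have "pois a F x = (LINT \<omega>|\<nu>. of_real (kern a (parent x) \<omega>) * F \<omega> / of_real a
      + of_real (jump a (level x)) * (indicator (sec x) \<omega> *\<^sub>R F \<omega>))"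
    unfolding pois_def
    by (rule Bochner_Integration.integral_cong[OF refl kern_expand[OF _ assms(3,2)]]) (simp add: space_nu)
  then show ?thesis
    using integrable_sector[OF assms(1)] integrable_kern[OF assms(1,2)]
    by (simp add: pois_def mass_def set_lebesgue_integral_def del: mult_scaleR_right)
qed

end

section \<open>Martingales on the boundary\<close>

text \<open>
  Fatou's lemma for Bochner integrals of nonnegative functions.
\<close>

lemma fatou_integrable:
  fixes h :: "'a \<Rightarrow> real"
  assumes "\<And>k. integrable M (hs k)" and meas [measurable]: "h \<in> borel_measurable M"
    and nonneg: "\<And>k x. hs k x \<ge> 0" and lim: "AE x in M. (\<lambda>k. hs k x) \<longlonglongrightarrow> h x"
    and bound: "\<And>k. (\<integral>x. hs k x \<partial>M) \<le> B"
  shows "integrable M h" "(\<integral>x. h x \<partial>M) \<le> B"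
proof -
  have [measurable]: "hs k \<in> borel_measurable M" for k using assms(1) by auto
  have B: "B \<ge> 0" using bound[of 0] Bochner_Integration.integral_nonneg[of M "hs 0"] nonneg by (meson order_trans)
  have h_nonneg: "AE x in M. h x \<ge> 0"
    using lim by eventually_elim (auto intro: LIMSEQ_le_const nonneg)
  have "(\<integral>\<^sup>+x. ennreal (h x) \<partial>M) = (\<integral>\<^sup>+x. liminf (\<lambda>k. ennreal (hs k x)) \<partial>M)"
  proof (rule nn_integral_cong_AE, use lim in eventually_elim)
    case (elim x)
    then have "(\<lambda>k. ennreal (hs k x)) \<longlonglongrightarrow> ennreal (h x)" by (rule tendsto_ennrealI)
    then show ?case by (simp add: lim_imp_Liminf)
  qed
  also have "\<dots> \<le> liminf (\<lambda>k. \<integral>\<^sup>+x. ennreal (hs k x) \<partial>M)"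
    by (rule nn_integral_liminf) simp
  also have "\<dots> \<le> liminf (\<lambda>k::nat. ennreal B)"
  proof (intro Liminf_mono always_eventually allI)
    fix k
    show "(\<integral>\<^sup>+x. ennreal (hs k x) \<partial>M) \<le> ennreal B"
      using bound[of k] assms(1) nonneg by (subst nn_integral_eq_integral) (auto intro: ennreal_leI)
  qed
  also have "\<dots> = ennreal B" by (simp add: Liminf_const)
  finally have le: "(\<integral>\<^sup>+x. ennreal (h x) \<partial>M) \<le> ennreal B" .
  show int: "integrable M h"
    by (rule integrableI_nonneg[OF meas h_nonneg]) (use le in \<open>auto intro: le_less_trans\<close>)
  show "(\<integral>x. h x \<partial>M) \<le> B"
    using le B nn_integral_eq_integral[OF int h_nonneg] by (simp add: ennreal_le_iff)
qed

context boundary begin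

text \<open>
  Functions of a single vertex of the ray are simple functions on the boundary.
\<close>

lemma ray_fun_eq:
  assumes "\<omega> \<in> rays'"
  shows "\<Phi> (\<omega> n) = (\<Sum>x\<in>S x0 n. indicator (sec x) \<omega> *\<^sub>R (\<Phi> x :: 'b::real_normed_vector))"
proof -
  have "indicator (sec x) \<omega> *\<^sub>R \<Phi> x = (if x = \<omega> n then \<Phi> x else 0)" if "x \<in> S x0 n" for x
    using assms that by (auto simp: indicator_def mem_sector mem_sphere)
  then have "(\<Sum>x\<in>S x0 n. indicator (sec x) \<omega> *\<^sub>R \<Phi> x) = (\<Sum>x\<in>S x0 n. if x = \<omega> n then \<Phi> x else 0)"
    by (rule sum.cong[OF refl])
  then show ?thesis using assms finite_sphere by (simp add: mem_sphere ray_level)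
qed

lemma has_integral_level:
  fixes \<Phi> :: "'v \<Rightarrow> 'b::{banach, second_countable_topology}"
  shows "has_bochner_integral \<nu> (\<lambda>\<omega>. \<Phi> (\<omega> n)) ((\<Sum>x\<in>S x0 n. \<Phi> x) /\<^sub>R real (card (S x0 n)))"
proof -
  have "has_bochner_integral \<nu> (\<lambda>\<omega>. \<Sum>x\<in>S x0 n. indicator (sec x) \<omega> *\<^sub>R \<Phi> x)
      (\<Sum>x\<in>S x0 n. measure \<nu> (sec x) *\<^sub>R \<Phi> x)"
    by (intro has_bochner_integral_sum has_bochner_integral_scaleR_left has_bochner_integral_real_indicator)
       (simp_all add: emeasure_eq_measure)
  moreover have "(\<Sum>x\<in>S x0 n. measure \<nu> (sec x) *\<^sub>R \<Phi> x) = (\<Sum>x\<in>S x0 n. \<Phi> x) /\<^sub>R real (card (S x0 n))"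
    unfolding scaleR_sum_right by (intro sum.cong refl) (simp add: measure_sector mem_sphere divide_inverse)
  ultimately show ?thesis
    by (subst has_bochner_integral_cong[OF refl ray_fun_eq refl]) (simp_all add: space_nu)
qed

lemma mass_diff:
  assumes "integrable \<nu> F" "integrable \<nu> H"
  shows "mass (\<lambda>\<omega>. F \<omega> - H \<omega>) x = mass F x - mass H x"
  unfolding mass_def using assms
  by (intro set_integral_diff(2)) (auto simp: set_integrable_def intro: integrable_sector)

lemma norm_mass_le:
  assumes "integrable \<nu> F"
  shows "cmod (mass F x) \<le> (LINT \<omega>|\<nu>. cmod (F \<omega>))"
proof -
  have "cmod (mass F x) \<le> (LINT \<omega>|\<nu>. cmod (indicator (sec x) \<omega> *\<^sub>R F \<omega>))"
    unfolding mass_def set_lebesgue_integral_def by (rule integral_norm_bound)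
  also have "\<dots> \<le> (LINT \<omega>|\<nu>. cmod (F \<omega>))"
    by (intro integral_mono integrable_norm integrable_sector assms) (simp add: indicator_def)
  finally show ?thesis .
qed

context
  fixes m :: "'v \<Rightarrow> complex"
  assumes additive: "\<And>x. (\<Sum>y\<in>children x. m y) = m x"
begin

text \<open>
  The martingale attached to an additive function \<open>m\<close> of vertices: the conditional density at level \<open>n\<close> of the
  finitely additive measure that gives the mass \<open>m x\<close> to the sector of \<open>x\<close>.
\<close>

definition density_at :: "nat \<Rightarrow> (nat \<Rightarrow> 'v) \<Rightarrow> complex" where
  "density_at n \<omega> = of_nat (card (S x0 n)) * m (\<omega> n)"

lemma integrable_density_at: "integrable \<nu> (density_at n)"
  unfolding density_at_def[abs_def]
  using has_integral_level[of "\<lambda>x. of_nat (card (S x0 n)) * m x" n] by (simp add: has_bochner_integral_iff)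

lemma mass_density_at:
  assumes "level x \<le> n"
  shows "mass (density_at n) x = m x"
  using assms
proof (induction "n - level x" arbitrary: x)
  case 0
  then have n: "n = level x" by simp
  have "mass (density_at n) x = (LINT \<omega>|\<nu>. indicator (sec x) \<omega> *\<^sub>R (of_nat (card (S x0 n)) * m x))"
    unfolding mass_def set_lebesgue_integral_def density_at_def
    by (intro Bochner_Integration.integral_cong refl) (auto simp: indicator_def mem_sector n)
  also have "\<dots> = measure \<nu> (sec x) *\<^sub>R (of_nat (card (S x0 n)) * m x)"
    by (subst integral_scaleR_left) (simp_all add: emeasure_eq_measure)
  also have "\<dots> = m x" using card_sphere_pos[of n] by (simp add: measure_sector n scaleR_conv_of_real)
  finally show ?case .
next
  case (Suc k)
  have "mass (density_at n) x = (\<Sum>y\<in>children x. mass (density_at n) y)"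
    by (rule mass_children[OF integrable_density_at])
  also have "\<dots> = (\<Sum>y\<in>children x. m y)"
    using Suc by (intro sum.cong refl Suc.hyps(1)) (auto simp: mem_children)
  finally show ?case by (simp add: additive)
qed

definition energy :: "nat \<Rightarrow> real" where
  "energy n = real (card (S x0 n)) * (\<Sum>x\<in>S x0 n. (cmod (m x))\<^sup>2)"

lemma energy_eq: "has_bochner_integral \<nu> (\<lambda>\<omega>. (cmod (density_at n \<omega>))\<^sup>2) (energy n)"
proof -
  have "has_bochner_integral \<nu> (\<lambda>\<omega>. (cmod (of_nat (card (S x0 n)) * m (\<omega> n)))\<^sup>2)
      ((\<Sum>x\<in>S x0 n. (cmod (of_nat (card (S x0 n)) * m x))\<^sup>2) /\<^sub>R real (card (S x0 n)))"
    by (rule has_integral_level)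
  moreover have "(\<Sum>x\<in>S x0 n. (cmod (of_nat (card (S x0 n)) * m x))\<^sup>2) /\<^sub>R real (card (S x0 n)) = energy n"
    using card_sphere_pos[of n]
    by (simp add: energy_def norm_mult power_mult_distrib flip: sum_distrib_left)
       (simp add: power2_eq_square)
  ultimately show ?thesis by (simp add: density_at_def)
qed

text \<open>
  The density at level \<open>n\<close> is constant on the sectors of level \<open>n\<close>, where later densities have
  the same integral.
\<close>

lemma density_at_orthogonal:
  assumes "n \<le> N"
  shows "has_bochner_integral \<nu> (\<lambda>\<omega>. cnj (density_at n \<omega>) * density_at N \<omega>) (of_real (energy n))"
proof -
  let ?c = "of_nat (card (S x0 n)) :: complex"
  have "has_bochner_integral \<nu> (\<lambda>\<omega>. \<Sum>x\<in>S x0 n. cnj (?c * m x) * (indicator (sec x) \<omega> *\<^sub>R density_at N \<omega>))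
     (\<Sum>x\<in>S x0 n. cnj (?c * m x) * m x)"
  proof (intro has_bochner_integral_sum has_bochner_integral_mult_right)
    fix x assume "x \<in> S x0 n"
    then have "mass (density_at N) x = m x" using assms by (intro mass_density_at) (simp add: mem_sphere)
    then show "has_bochner_integral \<nu> (\<lambda>\<omega>. indicator (sec x) \<omega> *\<^sub>R density_at N \<omega>) (m x)"
      using integrable_sector[OF integrable_density_at]
      by (simp add: has_bochner_integral_iff mass_def set_lebesgue_integral_def)
  qed
  moreover have "(\<Sum>x\<in>S x0 n. cnj (?c * m x) * m x) = of_real (energy n)"
    by (simp add: energy_def sum_distrib_left mult.assoc complex_norm_square mult.commute[of "cnj _"] del: of_real_power)
  moreover have "cnj (density_at n \<omega>) * density_at N \<omega> =
      (\<Sum>x\<in>S x0 n. cnj (?c * m x) * (indicator (sec x) \<omega> *\<^sub>R density_at N \<omega>))" if "\<omega> \<in> space \<nu>" for \<omega>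
  proof -
    have "cnj (density_at n \<omega>) = (\<Sum>x\<in>S x0 n. indicator (sec x) \<omega> *\<^sub>R cnj (?c * m x))"
      unfolding density_at_def using that
      by (intro ray_fun_eq[where \<Phi> = "\<lambda>x. cnj (?c * m x)"]) (simp add: space_nu)
    then show ?thesis by (simp add: sum_distrib_right)
  qed
  ultimately show ?thesis by (subst has_bochner_integral_cong[OF refl _ refl]) auto
qed

text \<open>
  Martingale increments are orthogonal, by Pythagoras.
\<close>

lemma energy_diff:
  assumes "n \<le> N"
  shows "has_bochner_integral \<nu> (\<lambda>\<omega>. (cmod (density_at N \<omega> - density_at n \<omega>))\<^sup>2) (energy N - energy n)"
proof -
  have eq: "(cmod (density_at N \<omega> - density_at n \<omega>))\<^sup>2 =
      (cmod (density_at N \<omega>))\<^sup>2 + (cmod (density_at n \<omega>))\<^sup>2 - 2 * Re (cnj (density_at n \<omega>) * density_at N \<omega>)" for \<omega>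
    by (simp only: cmod_power2) (simp add: power2_eq_square algebra_simps)
  have "has_bochner_integral \<nu> (\<lambda>\<omega>. Re (cnj (density_at n \<omega>) * density_at N \<omega>)) (Re (of_real (energy n)))"
    by (rule has_bochner_integral_bounded_linear[OF bounded_linear_Re density_at_orthogonal[OF assms]])
  then have "has_bochner_integral \<nu> (\<lambda>\<omega>. (cmod (density_at N \<omega>))\<^sup>2 + (cmod (density_at n \<omega>))\<^sup>2
      - 2 * Re (cnj (density_at n \<omega>) * density_at N \<omega>)) (energy N + energy n - 2 * energy n)"
    by (intro has_bochner_integral_diff has_bochner_integral_add energy_eq has_bochner_integral_mult_right) simp
  then show ?thesis unfolding eq by simp
qed

lemma energy_mono: "n \<le> N \<Longrightarrow> energy n \<le> energy N"
proof -
  assume "n \<le> N"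
  have "0 \<le> (LINT \<omega>|\<nu>. (cmod (density_at N \<omega> - density_at n \<omega>))\<^sup>2)"
    by (rule Bochner_Integration.integral_nonneg) simp
  then show ?thesis using energy_diff[OF \<open>n \<le> N\<close>] unfolding has_bochner_integral_iff by linarith
qed

lemma L1_dist_le:
  assumes "n \<le> N" "e > 0"
  shows "(LINT \<omega>|\<nu>. cmod (density_at N \<omega> - density_at n \<omega>)) \<le> e / 2 + (energy N - energy n) / (2 * e)"
proof -
  have D: "has_bochner_integral \<nu> (\<lambda>\<omega>. e / 2 + (cmod (density_at N \<omega> - density_at n \<omega>))\<^sup>2 / (2 * e))
      (e / 2 + (energy N - energy n) / (2 * e))"
    using has_bochner_integral_add[OF _ has_bochner_integral_divide_zero[OF energy_diff[OF assms(1)], of "2 * e"], of "\<lambda>_. e / 2" "e / 2"]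
    by (simp add: has_bochner_integral_iff prob_space)
  (* trades the mean for the mean square *)
  have amgm: "t \<le> e / 2 + t\<^sup>2 / (2 * e)" for t :: real
  proof -
    have "0 \<le> (t - e)\<^sup>2" by simp
    then show ?thesis using assms(2) by (simp add: field_simps power2_eq_square)
  qed
  have "(LINT \<omega>|\<nu>. cmod (density_at N \<omega> - density_at n \<omega>))
      \<le> (LINT \<omega>|\<nu>. e / 2 + (cmod (density_at N \<omega> - density_at n \<omega>))\<^sup>2 / (2 * e))"
    using D by (intro integral_mono amgm) (auto simp: has_bochner_integral_iff integrable_density_at)
  then show ?thesis using D by (simp add: has_bochner_integral_iff)
qed

text \<open>
  A bounded energy makes the martingale a Cauchy sequence in mean, so a subsequence converges almost everywhere; Fatou's lemma
  upgrades this to convergence in mean, which carries the integrals over sectors to the limit.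
\<close>

theorem martingale_limit:
  assumes bound: "\<And>n. energy n \<le> B"
  obtains G r where "integrable \<nu> G" "strict_mono (r :: nat \<Rightarrow> nat)"
    "AE \<omega> in \<nu>. (\<lambda>k. density_at (r k) \<omega>) \<longlonglongrightarrow> G \<omega>" "\<And>x. mass G x = m x"
proof -
  have "incseq energy" by (simp add: incseq_def energy_mono)
  then obtain L where "energy \<longlonglongrightarrow> L" using incseq_convergent bound by blast
  then have "Cauchy energy" by (rule LIMSEQ_imp_Cauchy)
  have L1: "\<exists>N0. \<forall>i\<ge>N0. \<forall>j\<ge>N0. (LINT \<omega>|\<nu>. cmod (density_at i \<omega> - density_at j \<omega>)) < e" if "e > 0" for e
  proof -
    have "e\<^sup>2 > 0" using that by simp
    then obtain N0 where N0: "\<And>i j. i \<ge> N0 \<Longrightarrow> j \<ge> N0 \<Longrightarrow> \<bar>energy i - energy j\<bar> < e\<^sup>2"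
        using \<open>Cauchy energy\<close> unfolding Cauchy_def dist_real_def by blast
    have *: "(LINT \<omega>|\<nu>. cmod (density_at i \<omega> - density_at j \<omega>)) < e" if "N0 \<le> j" "j \<le> i" for i j
    proof -
      have "(LINT \<omega>|\<nu>. cmod (density_at i \<omega> - density_at j \<omega>)) \<le> e / 2 + (energy i - energy j) / (2 * e)"
        using L1_dist_le[OF that(2) \<open>e > 0\<close>] .
      also have "\<dots> < e / 2 + e\<^sup>2 / (2 * e)"
        using N0[of i j] that \<open>e > 0\<close> by (intro add_strict_left_mono divide_strict_right_mono) auto
      also have "\<dots> = e" using \<open>e > 0\<close> by (simp add: power2_eq_square)
      finally show ?thesis .
    qed
    show ?thesis
    proof (intro exI[of _ N0] allI impI)
      fix i j assume "N0 \<le> i" "N0 \<le> j"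
      then show "(LINT \<omega>|\<nu>. cmod (density_at i \<omega> - density_at j \<omega>)) < e"
        using *[of i j] *[of j i] by (cases "i \<le> j") (auto simp: norm_minus_commute)
    qed
  qed
  obtain r where r: "strict_mono r" "AE \<omega> in \<nu>. Cauchy (\<lambda>k. density_at (r k) \<omega>)"
    using cauchy_L1_AE_cauchy_subseq[of \<nu> density_at] integrable_density_at L1 by blast
  define G where "G \<omega> = lim (\<lambda>k. density_at (r k) \<omega>)" for \<omega>
  have [measurable]: "density_at n \<in> borel_measurable \<nu>" for n using integrable_density_at by auto
  have [measurable]: "G \<in> borel_measurable \<nu>" unfolding G_def[abs_def] by measurable
  have lim: "AE \<omega> in \<nu>. (\<lambda>k. density_at (r k) \<omega>) \<longlonglongrightarrow> G \<omega>"
    using r(2) by eventually_elim (simp add: G_def Cauchy_convergent_iff convergent_LIMSEQ_iff)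
  have tail: "\<exists>N0. \<forall>n\<ge>N0. integrable \<nu> (\<lambda>\<omega>. cmod (G \<omega> - density_at n \<omega>)) \<and>
      (LINT \<omega>|\<nu>. cmod (G \<omega> - density_at n \<omega>)) \<le> e" if "e > 0" for e
  proof -
    obtain N0 where N0: "\<And>i j. i \<ge> N0 \<Longrightarrow> j \<ge> N0 \<Longrightarrow> (LINT \<omega>|\<nu>. cmod (density_at i \<omega> - density_at j \<omega>)) < e"
      using L1[OF \<open>e > 0\<close>] by blast
    show ?thesis
    proof (intro exI[of _ N0] allI impI)
      fix n assume n: "n \<ge> N0"
      have 1: "integrable \<nu> (\<lambda>\<omega>. cmod (density_at (r (k + N0)) \<omega> - density_at n \<omega>))" for k
        using integrable_density_at by (intro integrable_norm Bochner_Integration.integrable_diff)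
      have 2: "AE \<omega> in \<nu>. (\<lambda>k. cmod (density_at (r (k + N0)) \<omega> - density_at n \<omega>)) \<longlonglongrightarrow> cmod (G \<omega> - density_at n \<omega>)"
        using lim
      proof eventually_elim
        case (elim \<omega>)
        then have "(\<lambda>k. density_at (r (k + N0)) \<omega>) \<longlonglongrightarrow> G \<omega>" by (rule LIMSEQ_ignore_initial_segment)
        then show ?case by (intro tendsto_intros)
      qed
      have 3: "(LINT \<omega>|\<nu>. cmod (density_at (r (k + N0)) \<omega> - density_at n \<omega>)) \<le> e" for k
        using N0[of "r (k + N0)" n] n seq_suble[OF r(1), of "k + N0"] by simp
      show "integrable \<nu> (\<lambda>\<omega>. cmod (G \<omega> - density_at n \<omega>)) \<and>
          (LINT \<omega>|\<nu>. cmod (G \<omega> - density_at n \<omega>)) \<le> e"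
        using fatou_integrable[OF 1 _ _ 2 3] by simp
    qed
  qed
  have diff_int: "integrable \<nu> (\<lambda>\<omega>. G \<omega> - density_at n \<omega>)" if "integrable \<nu> (\<lambda>\<omega>. cmod (G \<omega> - density_at n \<omega>))" for n
    using that by (subst (asm) integrable_norm_iff) auto
  have G_int: "integrable \<nu> G"
  proof -
    obtain n where "integrable \<nu> (\<lambda>\<omega>. cmod (G \<omega> - density_at n \<omega>))" using tail[of 1] by auto
    from Bochner_Integration.integrable_add[OF diff_int[OF this] integrable_density_at[of n]]
    show ?thesis by simp
  qed
  have "mass G x = m x" for x
  proof -
    have small: "cmod (mass G x - m x) \<le> e" if e: "e > 0" for e
    proof -
      obtain N0 where N0: "\<And>n. n \<ge> N0 \<Longrightarrow> (LINT \<omega>|\<nu>. cmod (G \<omega> - density_at n \<omega>)) \<le> e"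
        using tail[OF e] by blast
      let ?n = "max N0 (level x)"
      have "cmod (mass G x - m x) = cmod (mass (\<lambda>\<omega>. G \<omega> - density_at ?n \<omega>) x)"
        using mass_diff[OF G_int integrable_density_at] mass_density_at[of x ?n] by simp
      also have "\<dots> \<le> (LINT \<omega>|\<nu>. cmod (G \<omega> - density_at ?n \<omega>))"
        by (rule norm_mass_le) (intro Bochner_Integration.integrable_diff G_int integrable_density_at)
      also have "\<dots> \<le> e" by (rule N0) simp
      finally show ?thesis .
    qed
    show ?thesis
    proof (rule ccontr)
      assume "mass G x \<noteq> m x"
      then have "cmod (mass G x - m x) > 0" by simp
      then show False using small[of "cmod (mass G x - m x) / 2"] by linarith
    qed
  qed
  with G_int r(1) lim show ?thesis by (rule that)
qed

end

lemma rays_agree_below: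
  assumes "\<omega> \<in> rays'" "\<eta> \<in> rays'" "\<omega> n = \<eta> n" "i \<le> n"
  shows "\<omega> i = \<eta> i"
  using assms(4)
proof (induction rule: inc_induct)
  case (step i)
  then show ?case using ray_parent[OF assms(1), of i] ray_parent[OF assms(2), of i] by simp
qed (rule assms(3))

lemma sector_antimono:
  assumes "\<omega> \<in> rays'" "i \<le> n"
  shows "sec (\<omega> n) \<subseteq> sec (\<omega> i)"
proof
  fix \<eta> assume "\<eta> \<in> sec (\<omega> n)"
  then have \<eta>: "\<eta> \<in> rays'" "\<eta> n = \<omega> n" using assms(1) by (simp_all add: mem_sector ray_level)
  then show "\<eta> \<in> sec (\<omega> i)"
    using rays_agree_below[OF \<eta>(1) assms(1) \<eta>(2) assms(2)] assms(1) by (simp add: mem_sector ray_level)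
qed

text \<open>
  The sectors along a ray form a neighbourhood basis of it, because they are nested.
\<close>

lemma open_contains_sector:
  assumes "generate_topology_on (range sec) U" "\<omega> \<in> U" "\<omega> \<in> rays'"
  shows "\<exists>n. sec (\<omega> n) \<subseteq> U"
  using assms(1,2)
proof (induction rule: generate_topology_on.induct)
  case (Int U V)
  then obtain n k where nk: "sec (\<omega> n) \<subseteq> U" "sec (\<omega> k) \<subseteq> V" by blast
  show ?case using nk sector_antimono[OF assms(3), of _ "max n k"] by (intro exI[of _ "max n k"] Int_greatest) (meson max.cobounded1 max.cobounded2 order_trans)+
next
  case (UN K)
  then show ?case by blast
next
  case (Basis U)
  then obtain x where "U = sec x" by blast
  then show ?case using Basis by (intro exI[of _ "level x"]) (simp add: mem_sector)
qed simp

text \<open>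
  Open sets are countable unions of sectors, since there are only countably many vertices.
\<close>

lemma sets_nu: "sets \<nu> = sigma_sets rays' (range sec)"
proof -
  have "U \<in> sigma_sets rays' (range sec)" if "openin (ray_topology E x0) U" for U
  proof -
    have gen: "generate_topology_on (range sec) U"
      using that unfolding ray_topology_def openin_topology_generated_by_iff .
    have "U \<subseteq> topspace (ray_topology E x0)" using that by (rule openin_subset)
    then have "U \<subseteq> rays'" unfolding ray_topology_def topology_generated_by_topspace by (auto simp: mem_sector)
    have "U = (\<Union>x\<in>{x. sec x \<subseteq> U}. sec x)"
    proof (intro equalityI subsetI)
      fix \<omega> assume "\<omega> \<in> U"
      then have \<omega>: "\<omega> \<in> rays'" using \<open>U \<subseteq> rays'\<close> by blast
      obtain n where "sec (\<omega> n) \<subseteq> U" using open_contains_sector[OF gen \<open>\<omega> \<in> U\<close> \<omega>] by blast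
      moreover have "\<omega> \<in> sec (\<omega> n)" using \<omega> by (simp add: mem_sector ray_level)
      ultimately show "\<omega> \<in> (\<Union>x\<in>{x. sec x \<subseteq> U}. sec x)" by blast
    qed blast
    moreover have "(\<Union>x\<in>{x. sec x \<subseteq> U}. sec x) \<in> sigma_sets rays' (range sec)"
    proof (rule sigma_sets_UNION)
      show "countable (sec ` {x. sec x \<subseteq> U})"
        by (rule countable_image) (rule countable_subset[OF subset_UNIV countable_vertices])
    qed (auto intro: sigma_sets.Basic)
    ultimately show ?thesis by simp
  qed
  then have "sigma_sets rays' {U. openin (ray_topology E x0) U} \<subseteq> sigma_sets rays' (range sec)"
    by (intro sigma_sets_mono) auto
  moreover have "sigma_sets rays' (range sec) \<subseteq> sigma_sets rays' {U. openin (ray_topology E x0) U}"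
    unfolding ray_topology_def by (intro sigma_sets_mono') (auto intro: topology_generated_by_Basis)
  ultimately show ?thesis using boundary_measure by (auto simp: boundary_measure_def)
qed

text \<open>
  Two sectors that share a ray are nested, so the sectors and the empty set are closed under intersection.
\<close>

lemma sector_Int: "sec x \<inter> sec y \<in> {sec x, sec y, {}}"
proof -
  have sub: "sec y \<subseteq> sec x" if le: "level x \<le> level y" and \<omega>: "\<omega> \<in> sec x" "\<omega> \<in> sec y" for x y \<omega>
  proof -
    have "sec (\<omega> (level y)) \<subseteq> sec (\<omega> (level x))"
      using \<omega> le by (intro sector_antimono) (auto simp: mem_sector)
    then show ?thesis using \<omega> by (simp add: mem_sector)
  qed
  show ?thesis
  proof (cases "sec x \<inter> sec y = {}")
    case False
    then show ?thesis using sub[of x y] sub[of y x] by (cases "level x \<le> level y") auto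
  qed simp
qed

text \<open>
  The sets on which both functions have the same integral form a Dynkin system that contains the
  intersection-stable generator given by the sectors.
\<close>

lemma mass_unique:
  assumes "integrable \<nu> F" "integrable \<nu> H" "\<And>x. mass F x = mass H x"
  shows "AE \<omega> in \<nu>. F \<omega> = H \<omega>"
proof (rule density_unique_banach[OF assms(1,2)])
  fix A assume "A \<in> sets \<nu>"
  let ?G = "insert {} (range sec)"
  have si: "set_integrable \<nu> A f" if "integrable \<nu> f" "A \<in> sets \<nu>" for A and f :: "_ \<Rightarrow> complex"
    using that by (simp add: set_integrable_def integrable_mult_indicator)
  have "sets \<nu> = sigma_sets rays' ?G"
    unfolding sets_nu
    by (intro antisym sigma_sets_mono' sigma_sets_mono) (auto intro: sigma_sets.Empty)
  have "Int_stable ?G" unfolding Int_stable_def using sector_Int by blast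
  moreover have "?G \<subseteq> Pow rays'" by (auto simp: mem_sector)
  moreover have "A \<in> sigma_sets rays' ?G" using \<open>A \<in> sets \<nu>\<close> \<open>sets \<nu> = sigma_sets rays' ?G\<close> by simp
  ultimately show "(LINT \<omega>:A|\<nu>. F \<omega>) = (LINT \<omega>:A|\<nu>. H \<omega>)"
  proof (induction rule: sigma_sets_induct_disjoint)
    case (basic A)
    then show ?case using assms(3) by (auto simp: mass_def set_lebesgue_integral_def)
  next
    case (compl A)
    then have A: "A \<in> sets \<nu>" using \<open>sets \<nu> = sigma_sets rays' ?G\<close> by simp
    have "(LINT \<omega>:rays' - A|\<nu>. f \<omega>) = mass f x0 - (LINT \<omega>:A|\<nu>. f \<omega>)" if "integrable \<nu> f" for f
    proof -
      have "mass f x0 = (LINT \<omega>:(rays' - A) \<union> A|\<nu>. f \<omega>)"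
        using sets.sets_into_space[OF A] by (simp add: mass_def sector_root space_nu Un_absorb2)
      also have "\<dots> = (LINT \<omega>:rays' - A|\<nu>. f \<omega>) + (LINT \<omega>:A|\<nu>. f \<omega>)"
        using that A sets.compl_sets[OF A] by (intro set_integral_Un si) (auto simp: space_nu)
      finally show ?thesis by simp
    qed
    then show ?case using assms compl by simp
  next
    case (union A)
    then have A: "range A \<subseteq> sets \<nu>" using \<open>sets \<nu> = sigma_sets rays' ?G\<close> by auto
    have "(LINT \<omega>:(\<Union>i. A i)|\<nu>. f \<omega>) = (\<Sum>i. (LINT \<omega>:A i|\<nu>. f \<omega>))" if "integrable \<nu> f" for f :: "_ \<Rightarrow> complex"
      using A that union by (intro lebesgue_integral_countable_add si) (auto simp: disjoint_family_on_def)
    then show ?case using assms union by simp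
  qed (simp add: set_lebesgue_integral_def)
qed

end

section \<open>Eigenfunctions of weak type are Poisson transforms\<close>

text \<open>
  Convexity of \<open>t powr r\<close> on the positive numbers, applied to the nonzero summands.
\<close>

lemma power_mean_sum:
  fixes t :: "'a \<Rightarrow> real"
  assumes "finite T" "r \<ge> 1" "\<And>y. y \<in> T \<Longrightarrow> t y \<ge> 0"
  shows "(\<Sum>y\<in>T. t y) powr r \<le> real (card T) powr (r - 1) * (\<Sum>y\<in>T. t y powr r)"
proof -
  define T' where "T' = {y \<in> T. t y > 0}"
  have fin: "finite T'" "T' \<subseteq> T" using assms by (auto simp: T'_def)
  have eq: "(\<Sum>y\<in>T. t y) = (\<Sum>y\<in>T'. t y)" "(\<Sum>y\<in>T. t y powr r) = (\<Sum>y\<in>T'. t y powr r)"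
  proof -
    have z: "t y = 0" if "y \<in> T - T'" for y
      using that assms(3)[of y] by (auto simp: T'_def)
    show "(\<Sum>y\<in>T. t y) = (\<Sum>y\<in>T'. t y)" "(\<Sum>y\<in>T. t y powr r) = (\<Sum>y\<in>T'. t y powr r)"
      by (rule sum.mono_neutral_right; use assms(1) fin z in simp)+
  qed
  show ?thesis
  proof (cases "T' = {}")
    case False
    let ?c = "real (card T')"
    have c: "?c > 0" using False fin by (simp add: card_gt_0_iff)
    have "(\<Sum>y\<in>T'. (1 / ?c) *\<^sub>R t y) powr r \<le> (\<Sum>y\<in>T'. 1 / ?c * t y powr r)"
      using fin False c by (intro convex_on_sum[OF _ _ powr_convex[OF assms(2)]]) (auto simp: T'_def)
    then have "((\<Sum>y\<in>T'. t y) / ?c) powr r \<le> (\<Sum>y\<in>T'. t y powr r) / ?c"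
      by (simp add: sum_divide_distrib)
    then have "(\<Sum>y\<in>T'. t y) powr r \<le> ?c powr r * ((\<Sum>y\<in>T'. t y powr r) / ?c)"
      using c by (simp add: powr_divide sum_nonneg T'_def field_simps)
    also have "\<dots> = ?c powr (r - 1) * (\<Sum>y\<in>T'. t y powr r)"
      using c by (simp add: powr_diff)
    also have "\<dots> \<le> real (card T) powr (r - 1) * (\<Sum>y\<in>T'. t y powr r)"
      using fin assms by (intro mult_right_mono powr_mono2 sum_nonneg) (auto intro: card_mono)
    finally show ?thesis unfolding eq .
  qed (simp add: eq sum_nonneg)
qed

lemma harm_le_1_plus_ln: "n > 0 \<Longrightarrow> harm n \<le> 1 + ln (real n)"
  using euler_mascheroni_sequence_decreasing[of 1 n] by (simp add: harm_def)

locale boundary_exponent = boundary q E x0 \<nu> for q and E :: "'v \<Rightarrow> 'v \<Rightarrow> bool" and x0 \<nu> +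
  fixes p :: real
  assumes p1: "1 \<le> p" and p2: "p < 2"
begin

definition a :: real where "a = real q powr (1 / p)"
definition b :: real where "b = real q powr (1 - 1 / p)"
definition lam :: real where "lam = a + b"

lemma a_gt_1: "a > 1"
  using q2 p1 by (simp add: a_def)

lemma b_ge_1: "b \<ge> 1"
  using q2 p1 by (simp add: b_def ge_one_powr_ge_zero)

lemma a_mult_b: "a * b = real q"
  using q2 by (simp add: a_def b_def flip: powr_add)

lemma b_eq: "b = real q / a"
  using a_mult_b a_gt_1 by (simp add: field_simps)

lemma lam_pos: "lam > 0"
  using a_gt_1 b_ge_1 by (simp add: lam_def)

lemma jump_pos: "jump a n > 0"
  using a_gt_1 by (simp add: jump_def)

text \<open>
  The numbers \<open>a\<close> and \<open>b\<close> are the characteristic roots of the recursion for \<open>alpha\<close>; removing the root \<open>b\<close>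
  leaves a geometric sequence with ratio \<open>a\<close>.
\<close>

lemma alpha_rec: "alpha lam (Suc (Suc n)) = b * alpha lam (Suc n) + a ^ n * (a\<^sup>2 - 1)"
proof (induction n)
  case 0
  then show ?case using a_mult_b by (simp add: backdeg_def lam_def power2_eq_square algebra_simps)
next
  case (Suc n)
  have "alpha lam (Suc (Suc (Suc n))) = b * alpha lam (Suc (Suc n)) + a * (alpha lam (Suc (Suc n)) - b * alpha lam (Suc n))"
    using a_mult_b by (simp add: backdeg_def lam_def algebra_simps)
  also have "\<dots> = b * alpha lam (Suc (Suc n)) + a ^ Suc n * (a\<^sup>2 - 1)"
    by (subst Suc) (simp add: algebra_simps)
  finally show ?case .
qed

lemma alpha_lower: "jump a n \<le> alpha lam n"
proof -
  have 1: "jump a (Suc n) \<le> alpha lam (Suc n)" for n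
  proof (induction n)
    case 0
    have "a * (1 - 1 / a\<^sup>2) \<le> a" using a_gt_1 by (simp add: mult_le_cancel_left1)
    then show ?case using b_ge_1 by (simp add: jump_def lam_def)
  next
    case (Suc n)
    have "jump a (Suc (Suc n)) = a ^ n * (a\<^sup>2 - 1)"
      using a_gt_1 by (simp add: jump_def field_simps power2_eq_square)
    moreover have "0 \<le> b * alpha lam (Suc n)"
      using Suc jump_pos[of "Suc n"] b_ge_1 by simp
    ultimately show ?case unfolding alpha_rec by linarith
  qed
  show ?thesis
    by (cases n) (use 1 in \<open>auto simp: jump_def simp del: alpha.simps(3)\<close>)
qed

lemma alpha_lam_pos: "alpha lam n > 0"
  using alpha_lower[of n] jump_pos[of n] by linarith

sublocale positive_tree q E lam
  by unfold_locales (rule alpha_lam_pos)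

text \<open>
  Both sides satisfy the same recursion from a vertex to its children, as the mass of a sector is the inverse of the size of its sphere.
\<close>

lemma pois_one: "pois a (\<lambda>_. 1) x = of_real (spherical x0 lam x)"
proof (induction x rule: level_induct)
  case root
  then show ?case using prob_space by (simp add: pois_root mass_root spherical_def sphere_0)
next
  case (step x n)
  have mass1: "mass (\<lambda>_. 1) x = of_real (1 / real (card (S x0 (Suc n))))"
  proof -
    have "mass (\<lambda>_. 1) x = of_real (measure \<nu> (sec x))"
      by (simp add: mass_def set_lebesgue_integral_def emeasure_eq_measure scaleR_conv_of_real)
    then show ?thesis using step(1) by (simp add: measure_sector)
  qed
  have key: "alpha lam (Suc n) / real (card (S x0 (Suc n))) =
      alpha lam n / real (card (S x0 n)) / a + jump a (Suc n) / real (card (S x0 (Suc n)))"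
  proof (cases n)
    case 0
    have "(a + (X - 1) / a) / X = 1 / a + (a - 1 / a) / X" if "X \<noteq> 0" for X
      using that a_gt_1 by (simp add: field_simps)
    from this[of "real q + 1"] show ?thesis using 0 a_gt_1
      by (simp add: card_sphere sphere_0 jump_def lam_def b_eq right_diff_distrib power2_eq_square add.commute)
  next
    case (Suc k)
    have s: "real (card (S x0 (Suc n))) = a * b * real (card (S x0 n))"
      using Suc a_mult_b by (simp add: card_sphere_Suc backdeg_def)
    have "jump a (Suc n) = a ^ k * (a\<^sup>2 - 1)"
      using Suc a_gt_1 by (simp add: jump_def field_simps power2_eq_square)
    then have "alpha lam (Suc n) = b * alpha lam n + jump a (Suc n)" using alpha_rec[of k] Suc by simp
    then show ?thesis unfolding s using a_gt_1 b_ge_1 card_sphere_pos[of n]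
      by (simp add: field_simps)
  qed
  have "pois a (\<lambda>_. 1) x = of_real (spherical x0 lam (parent x)) / of_real a
      + of_real (jump a (Suc n)) * of_real (1 / real (card (S x0 (Suc n))))"
    using pois_step[of "\<lambda>_. 1" a x n] a_gt_1 step mass1 by simp
  then show ?case
    using key step(1) parent(2)[OF step(1)] by (simp add: spherical_def del: alpha.simps flip: of_real_divide of_real_mult of_real_add)
qed

text \<open>
  The recursion \<open>pois_step\<close> propagates the equality away from the root.
\<close>

lemma pois_determined_by_mass:
  assumes "integrable \<nu> G" "mass G x0 = g x0"
    and "\<And>x. level x \<noteq> 0 \<Longrightarrow> mass G x = (g x - g (parent x) / of_real a) / of_real (jump a (level x))"
  shows "pois a G x = g x"
proof (induction x rule: level_induct)
  case root
  then show ?case using assms(2) by (simp add: pois_root)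
next
  case (step x n)
  then show ?case
    using pois_step[OF assms(1) _ step(1)] assms(3)[of x] a_gt_1 jump_pos[of "level x"] by simp
qed

lemma pois_inj:
  assumes "integrable \<nu> G" "integrable \<nu> H" "pois a G = pois a H"
  shows "AE \<omega> in \<nu>. G \<omega> = H \<omega>"
proof (rule mass_unique[OF assms(1,2)])
  fix x
  show "mass G x = mass H x"
  proof (cases "level x")
    case 0
    then have "x = x0" by (metis dist_eq_0)
    then show ?thesis using fun_cong[OF assms(3), of x0] by (simp add: pois_root)
  next
    case (Suc n)
    have "of_real (jump a (level x)) * mass G x = of_real (jump a (level x)) * mass H x"
      using pois_step[OF assms(1) _ Suc, of a] pois_step[OF assms(2) _ Suc, of a] a_gt_1 assms(3) by auto
    then show ?thesis using jump_pos[of "level x"] by auto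
  qed
qed

lemma Lr_integrable:
  assumes "G \<in> Lr (conj_exponent p) \<nu>"
  shows "integrable \<nu> G"
  using conj_exponent_cases[OF p1]
proof cases
  case 1
  then obtain C where "G \<in> borel_measurable \<nu>" "AE \<omega> in \<nu>. cmod (G \<omega>) \<le> C"
    using assms by (auto simp: Lr_def)
  then show ?thesis by (intro integrable_const_bound)
next
  case (2 r)
  have G: "G \<in> borel_measurable \<nu>" "integrable \<nu> (\<lambda>\<omega>. cmod (G \<omega>) powr r)"
    using assms 2 by (auto simp: Lr_def)
  have "cmod z \<le> 1 + cmod z powr r" for z
    using 2 powr_mono[of 1 r "cmod z"] by (cases "cmod z \<le> 1") (auto intro: order_trans add_increasing2)
  then show ?thesis
    using G by (intro Bochner_Integration.integrable_bound[OF _ G(1), of "\<lambda>\<omega>. 1 + cmod (G \<omega>) powr r"]) auto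
qed

end

context boundary_exponent begin

context
  fixes g :: "'v \<Rightarrow> complex"
  assumes eigen: "\<And>x. sphere_sum (Suc 0) g x = of_real lam * g x"
    and weak: "g \<in> weak_L (conj_exponent p)"
begin

text \<open>
  Up to the factor \<open>jump a (level x)\<close>, the integral over the sector of \<open>x\<close> that a boundary function
  representing \<open>g\<close> must have. At the root, which has no parent, the value is a default.
\<close>

definition incr :: "'v \<Rightarrow> complex" where
  "incr x = (if x = x0 then 0 else g x - g (parent x) / of_real a)"

text \<open>
  The finitely additive boundary measure that represents \<open>g\<close>.
\<close>

definition bmass :: "'v \<Rightarrow> complex" where
  "bmass x = (if x = x0 then g x0 else incr x / of_real (jump a (level x)))"

lemma sum_children_incr:
  assumes "level x = Suc n"
  shows "(\<Sum>y\<in>children x. incr y) = of_real a * incr x"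
proof -
  have ux: "incr x = g x - g (parent x) / of_real a" using assms by (auto simp: incr_def)
  have "(\<Sum>y\<in>children x. incr y) = (\<Sum>y\<in>children x. g y) - of_nat q * (g x / of_real a)"
  proof -
    have "(\<Sum>y\<in>children x. incr y) = (\<Sum>y\<in>children x. g y - g x / of_real a)"
      by (intro sum.cong refl) (auto simp: incr_def mem_children)
    then show ?thesis using assms by (simp add: sum_subtractf card_children backdeg_def)
  qed
  also have "of_nat q * (g x / of_real a) = of_real b * g x"
    by (simp add: b_eq)
  also have "(\<Sum>y\<in>children x. g y) = of_real lam * g x - g (parent x)"
    using sum_nbrs[of g x] eigen[of x] assms by (simp add: algebra_simps)
  also have "of_real lam * g x - g (parent x) - of_real b * g x = of_real a * incr x"
    using a_gt_1 by (simp add: ux lam_def field_simps)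
  finally show ?thesis .
qed

text \<open>
  Additivity is a reformulation of the eigenvalue equation.
\<close>

lemma sum_children_bmass: "(\<Sum>y\<in>children x. bmass y) = bmass x"
proof (cases "level x")
  case 0
  then have x: "x = x0" by (metis dist_eq_0)
  have "(\<Sum>y\<in>children x. bmass y) = (\<Sum>y\<in>children x. (g y - g x0 / of_real a) / of_real (jump a (Suc 0)))"
    using x by (intro sum.cong refl) (auto simp: bmass_def incr_def mem_children simp del: dist_eq_1)
  also have "\<dots> = ((\<Sum>y\<in>children x. g y) - of_nat (q + 1) * (g x0 / of_real a)) / of_real (jump a (Suc 0))"
    using x by (simp add: sum_subtractf card_children backdeg_def flip: sum_divide_distrib)
  also have "(\<Sum>y\<in>children x. g y) = of_real lam * g x0"
    using sum_nbrs[of g x0] eigen[of x0] x by simp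
  also have "of_real lam * g x0 - of_nat (q + 1) * (g x0 / of_real a) = of_real (jump a (Suc 0)) * g x0"
  proof -
    have "lam - real (q + 1) / a = jump a (Suc 0)"
      using a_gt_1 by (simp add: lam_def b_eq jump_def field_simps power2_eq_square)
    from arg_cong[OF this, of "\<lambda>t. complex_of_real t * g x0"] show ?thesis
      by (simp add: algebra_simps)
  qed
  finally show ?thesis using x jump_pos[of "Suc 0"] by (simp add: bmass_def)
next
  case (Suc n)
  have "(\<Sum>y\<in>children x. bmass y) = (\<Sum>y\<in>children x. incr y / of_real (jump a (Suc (Suc n))))"
    using Suc by (intro sum.cong refl) (auto simp: bmass_def mem_children)
  also have "\<dots> = of_real a * incr x / of_real (jump a (Suc (Suc n)))"
    using sum_children_incr[OF Suc] by (simp flip: sum_divide_distrib)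
  also have "\<dots> = bmass x"
    using Suc a_gt_1 by (auto simp: bmass_def jump_def)
  finally show ?thesis .
qed

lemma incr_weak: "incr \<in> weak_L (conj_exponent p)"
proof (rule weak_L_local[OF p1 weak, of 1])
  fix x
  show "cmod (incr x) \<le> 1 * (\<Sum>y\<in>gball E x (Suc 0). cmod (g y))"
  proof (cases "level x")
    case 0
    then have "x = x0" by (metis dist_eq_0)
    then have "incr x = 0" unfolding incr_def by (rule if_P)
    then show ?thesis by (simp add: sum_nonneg)
  next
    case (Suc n)
    have ne: "x \<noteq> parent x" using parent(2)[OF Suc] Suc by auto
    have "cmod (incr x) \<le> cmod (g x) + cmod (g (parent x)) / a"
      using Suc a_gt_1 norm_triangle_ineq4[of "g x" "g (parent x) / of_real a"]
      by (auto simp: incr_def norm_divide)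
    also have "\<dots> \<le> cmod (g x) + cmod (g (parent x))"
      using a_gt_1 by (simp add: divide_le_eq mult_le_cancel_left1)
    also have "\<dots> = (\<Sum>y\<in>{x, parent x}. cmod (g y))" using ne by simp
    also have "\<dots> \<le> (\<Sum>y\<in>gball E x (Suc 0). cmod (g y))"
      using parent(1)[OF Suc] by (intro sum_mono2 finite_ball) (auto simp: gball_def simp flip: dist_eq_1)
    finally show ?thesis by simp
  qed
qed simp

text \<open>
  The martingale at level \<open>n\<close> has the modulus \<open>kappa * b ^ n\<close> times that of the increment, for positive \<open>n\<close>;
  the factor \<open>b ^ n\<close> undoes the decay of the eigenfunction.
\<close>

definition kappa :: real where "kappa = (real q + 1) / real q / (1 - 1 / a\<^sup>2)"

lemma kappa_pos: "kappa > 0"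
  using q2 a_gt_1 by (simp add: kappa_def)

lemma norm_density:
  assumes "level x = Suc n"
  shows "cmod (of_nat (card (S x0 (Suc n))) * bmass x) = kappa * b ^ Suc n * cmod (incr x)"
proof -
  have "real (card (S x0 (Suc n))) = (real q + 1) / real q * real q ^ Suc n"
    using q2 by (simp add: card_sphere field_simps)
  also have "real q ^ Suc n = a ^ Suc n * b ^ Suc n"
    by (simp only: a_mult_b flip: power_mult_distrib)
  finally have "real (card (S x0 (Suc n))) / jump a (Suc n) = kappa * b ^ Suc n"
    using a_gt_1 by (simp add: jump_def kappa_def)
  moreover have "cmod (bmass x) = cmod (incr x) / jump a (Suc n)"
    using assms jump_pos[of "Suc n"] by (auto simp: bmass_def norm_divide)
  ultimately show ?thesis by (simp only: norm_mult norm_of_nat) (metis times_divide_eq_left times_divide_eq_right)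
qed

text \<open>
  By \<open>sum_children_incr\<close> the value at a vertex is the sum over its \<open>q\<close> children divided by \<open>a\<close>.
  Since \<open>a powr r = q powr (r - 1)\<close>, the power mean inequality loses nothing on passing to children; this is where
  \<open>r\<close> is the exponent conjugate to \<open>p\<close>.
\<close>

lemma incr_powr_sum_mono:
  assumes r: "r > 1" "1 / r = 1 - 1 / p"
  shows "(\<Sum>x\<in>S x0 (Suc n). cmod (incr x) powr r) \<le> (\<Sum>x\<in>S x0 (Suc (Suc n)). cmod (incr x) powr r)"
proof -
  have ar: "a powr r = real q powr (r - 1)"
  proof -
    have "1 / p * r = r - 1" using r by (simp add: field_simps)
    then show ?thesis by (simp add: a_def powr_powr)
  qed
  have "cmod (incr x) powr r \<le> (\<Sum>y\<in>children x. cmod (incr y) powr r)" if "x \<in> S x0 (Suc n)" for x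
  proof -
    have lx: "level x = Suc n" using that by (simp add: mem_sphere)
    have "a * cmod (incr x) = cmod (\<Sum>y\<in>children x. incr y)"
      using a_gt_1 by (simp add: sum_children_incr[OF lx] norm_mult)
    also have "\<dots> \<le> (\<Sum>y\<in>children x. cmod (incr y))" by (rule norm_sum)
    finally have "(a * cmod (incr x)) powr r \<le> (\<Sum>y\<in>children x. cmod (incr y)) powr r"
      using r a_gt_1 by (intro powr_mono2) auto
    also have "\<dots> \<le> real (card (children x)) powr (r - 1) * (\<Sum>y\<in>children x. cmod (incr y) powr r)"
      using r finite_children by (intro power_mean_sum) auto
    also have "real (card (children x)) = real q" using lx by (simp add: card_children backdeg_def)
    finally have "a powr r * cmod (incr x) powr r \<le> a powr r * (\<Sum>y\<in>children x. cmod (incr y) powr r)"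
      using a_gt_1 by (simp add: powr_mult ar)
    moreover have "a powr r > 0" using a_gt_1 by simp
    ultimately show ?thesis by (simp only: mult_le_cancel_left_pos)
  qed
  then have "(\<Sum>x\<in>S x0 (Suc n). cmod (incr x) powr r)
      \<le> (\<Sum>x\<in>S x0 (Suc n). \<Sum>y\<in>children x. cmod (incr y) powr r)" by (rule sum_mono)
  then show ?thesis by (simp only: sum_sphere_Suc[of _ "Suc n"])
qed

lemma card_ball_le: "card (gball E x n) \<le> (q + 2) ^ n"
proof (induction n)
  case 0
  then show ?case by (simp add: ball_eq_UN_spheres sphere_0)
next
  case (Suc n)
  have "gball E x (Suc n) = gball E x n \<union> S x (Suc n)" by (auto simp: gball_def mem_sphere)
  then have "card (gball E x (Suc n)) \<le> card (gball E x n) + card (S x (Suc n))"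
    by (simp add: card_Un_le)
  also have "\<dots> \<le> (q + 2) ^ n + (q + 1) * (q + 2) ^ n"
    unfolding card_sphere by (intro add_mono Suc mult_left_mono power_mono) auto
  finally show ?case by simp
qed

text \<open>
  A weak-type bound alone lets the sphere sums grow on average only like a logarithm of the number of vertices
  divided by the radius. That is bounded on average, and the sums increase with the radius, so they are bounded.
\<close>

lemma incr_powr_sum_bounded:
  assumes r: "r > 1" "1 / r = 1 - 1 / p" and M: "M \<ge> 0" "weak_dist r M incr"
  shows "(\<Sum>x\<in>S x0 (Suc n). cmod (incr x) powr r) \<le> M powr r * (1 + 2 * ln (real (q + 2)))"
proof -
  define U where "U n = (\<Sum>x\<in>S x0 n. cmod (incr x) powr r)" for n
  have mono: "U (Suc n) \<le> U (Suc n + k)" for k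
    by (induction k) (use incr_powr_sum_mono[OF r] in \<open>auto simp: U_def intro: order_trans\<close>)
  (* the spheres of radius n + 1, ..., 2 n + 1 together carry at least n + 1 times the sum for radius n + 1 *)
  let ?N = "2 * Suc n"
  have "real (Suc n) * U (Suc n) = (\<Sum>j\<in>{Suc n..<?N}. U (Suc n))" by simp
  also have "\<dots> \<le> (\<Sum>j\<in>{Suc n..<?N}. U j)"
  proof (rule sum_mono)
    fix j assume "j \<in> {Suc n..<?N}"
    then show "U (Suc n) \<le> U j" using mono[of "j - Suc n"] by simp
  qed
  also have "\<dots> \<le> (\<Sum>j\<le>?N. U j)"
    by (intro sum_mono2) (auto simp: U_def sum_nonneg)
  also have "\<dots> = (\<Sum>x\<in>gball E x0 ?N. cmod (incr x) powr r)"
    by (simp only: sum_ball U_def)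
  also have "\<dots> \<le> M powr r * harm (card (gball E x0 ?N))"
    by (rule weak_dist_sum_powr_le[OF M(2) r(1) finite_ball M(1)])
  also have "\<dots> \<le> M powr r * (real (Suc n) * (1 + 2 * ln (real (q + 2))))"
  proof (rule mult_left_mono)
    have "x0 \<in> gball E x0 ?N" by (simp add: gball_def)
    then have pos: "card (gball E x0 ?N) > 0" using finite_ball by (metis card_gt_0_iff empty_iff)
    have "harm (card (gball E x0 ?N)) \<le> 1 + ln (real (card (gball E x0 ?N)))"
      by (rule harm_le_1_plus_ln[OF pos])
    also have "\<dots> \<le> 1 + ln (real ((q + 2) ^ ?N))"
      using pos card_ball_le[of x0 ?N] by (intro add_left_mono ln_mono) (simp_all only: of_nat_le_iff of_nat_0_less_iff)
    also have "\<dots> = 1 + real ?N * ln (real (q + 2))"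
      by (simp only: of_nat_power) (simp add: ln_realpow del: power_Suc)
    also have "\<dots> \<le> real (Suc n) * (1 + 2 * ln (real (q + 2)))"
      by (simp add: algebra_simps)
    finally show "harm (card (gball E x0 ?N)) \<le> real (Suc n) * (1 + 2 * ln (real (q + 2)))" .
  qed simp
  finally have "real (Suc n) * U (Suc n) \<le> real (Suc n) * (M powr r * (1 + 2 * ln (real (q + 2))))"
    by (simp add: mult_ac)
  then show ?thesis unfolding U_def by (simp only: mult_le_cancel_left_pos of_nat_0_less_iff zero_less_Suc)
qed

lemma density_powr_bound:
  assumes r: "r > 1" "1 / r = 1 - 1 / p" and M: "M \<ge> 0" "weak_dist r M incr"
  shows "\<exists>B. \<forall>n. integrable \<nu> (\<lambda>\<omega>. cmod (density_at bmass n \<omega>) powr r) \<and>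
      (LINT \<omega>|\<nu>. cmod (density_at bmass n \<omega>) powr r) \<le> B"
proof -
  define B where "B = max (cmod (g x0) powr r) (kappa powr r * (M powr r * (1 + 2 * ln (real (q + 2)))))"
  have hi: "has_bochner_integral \<nu> (\<lambda>\<omega>. cmod (density_at bmass n \<omega>) powr r)
      ((\<Sum>x\<in>S x0 n. cmod (of_nat (card (S x0 n)) * bmass x) powr r) /\<^sub>R real (card (S x0 n)))" for n
    using has_integral_level[of "\<lambda>x. cmod (of_nat (card (S x0 n)) * bmass x) powr r" n]
    by (simp add: density_at_def[OF sum_children_bmass])
  have br: "(b ^ k) powr r = real q ^ k" for k
  proof -
    have "(1 - 1 / p) * r = 1" using r by (simp add: field_simps)
    then have "b powr r = real q" using q2 by (simp add: b_def powr_powr)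
    have "(b ^ k) powr r = (b powr real k) powr r" using b_ge_1 by (simp add: powr_realpow)
    also have "\<dots> = (b powr r) powr real k" by (simp add: powr_powr mult.commute)
    also have "\<dots> = real q ^ k" using q2 by (simp add: \<open>b powr r = real q\<close> powr_realpow)
    finally show ?thesis .
  qed
  have le: "(\<Sum>x\<in>S x0 n. cmod (of_nat (card (S x0 n)) * bmass x) powr r) /\<^sub>R real (card (S x0 n)) \<le> B" for n
  proof (cases n)
    case 0
    then show ?thesis by (simp add: sphere_0 bmass_def B_def)
  next
    case (Suc k)
    have "(\<Sum>x\<in>S x0 n. cmod (of_nat (card (S x0 n)) * bmass x) powr r) =
        (\<Sum>x\<in>S x0 n. kappa powr r * real q ^ n * cmod (incr x) powr r)"
      using Suc kappa_pos b_ge_1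
      by (intro sum.cong refl) (simp add: norm_density mem_sphere powr_mult br del: power_Suc)
    also have "\<dots> = real q ^ n * (kappa powr r * (\<Sum>x\<in>S x0 n. cmod (incr x) powr r))"
      by (simp add: sum_distrib_left mult_ac)
    also have "\<dots> \<le> real (card (S x0 n)) * (kappa powr r * (\<Sum>x\<in>S x0 n. cmod (incr x) powr r))"
    proof (intro mult_right_mono)
      have "q ^ n \<le> card (S x0 n)" using Suc by (simp add: card_sphere)
      then show "real q ^ n \<le> real (card (S x0 n))" by (metis of_nat_le_iff of_nat_power)
    qed (simp add: sum_nonneg)
    finally have "(\<Sum>x\<in>S x0 n. cmod (of_nat (card (S x0 n)) * bmass x) powr r) /\<^sub>R real (card (S x0 n))
        \<le> kappa powr r * (\<Sum>x\<in>S x0 n. cmod (incr x) powr r)"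
      using card_sphere_pos[of n] by (simp add: field_simps)
    also have "\<dots> \<le> B"
      using incr_powr_sum_bounded[OF r M, of k] Suc unfolding B_def
      by (intro max.coboundedI2 mult_left_mono) auto
    finally show ?thesis .
  qed
  show ?thesis using hi le unfolding has_bochner_integral_iff by metis
qed

text \<open>
  The martingale of the increments has bounded energy, because the conjugate exponent exceeds two. Its limit lies in
  the Lebesgue space, by Fatou's lemma or, for the exponent infinity, as a limit of uniformly bounded functions.
\<close>

theorem poisson_representation: "\<exists>G\<in>Lr (conj_exponent p) \<nu>. \<forall>x. pois a G x = g x"
proof -
  note dens = density_at_def[OF sum_children_bmass]
  have rep: "pois a G x = g x" if "integrable \<nu> G" "\<And>x. mass G x = bmass x" for G x
    by (rule pois_determined_by_mass[OF that(1)]) (simp_all add: that(2) bmass_def incr_def)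
  have e_int: "energy bmass n = (LINT \<omega>|\<nu>. (cmod (density_at bmass n \<omega>))\<^sup>2)"
    and e_integrable: "integrable \<nu> (\<lambda>\<omega>. (cmod (density_at bmass n \<omega>))\<^sup>2)" for n
    using energy_eq[OF sum_children_bmass, of n] by (simp_all add: has_bochner_integral_iff)
  show ?thesis using conj_exponent_cases[OF p1]
  proof cases
    case 1
    then obtain M where M: "M \<ge> 0" "\<And>x. cmod (incr x) \<le> M" using incr_weak weak_L_infinity_iff[of incr] by auto
    define B where "B = max (cmod (g x0)) (kappa * M)"
    have B: "cmod (density_at bmass n \<omega>) \<le> B" if "\<omega> \<in> space \<nu>" for n \<omega>
    proof (cases n)
      case 0
      then show ?thesis using that by (simp add: dens sphere_0 bmass_def ray_0 space_nu B_def)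
    next
      case (Suc k)
      have "b = 1" unfolding b_def using 1(1) q2 by simp
      then have "cmod (density_at bmass n \<omega>) = kappa * cmod (incr (\<omega> n))"
        using norm_density[of "\<omega> n" k] that Suc by (simp add: dens ray_level space_nu)
      also have "\<dots> \<le> B" using kappa_pos M(2)[of "\<omega> n"] by (simp add: B_def max.coboundedI2)
      finally show ?thesis .
    qed
    have en: "energy bmass n \<le> B\<^sup>2" for n
    proof -
      have "energy bmass n \<le> (LINT \<omega>|\<nu>. B\<^sup>2)"
        unfolding e_int by (intro integral_mono e_integrable power_mono) (use B in auto)
      then show ?thesis by (simp add: prob_space)
    qed
    obtain G r where G: "integrable \<nu> G" "strict_mono r" "AE \<omega> in \<nu>. (\<lambda>k. density_at bmass (r k) \<omega>) \<longlonglongrightarrow> G \<omega>"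
        "\<And>x. mass G x = bmass x"
      by (rule martingale_limit[OF sum_children_bmass en]) (rule that)
    have "AE \<omega> in \<nu>. cmod (G \<omega>) \<le> B"
      using G(3) AE_space
    proof eventually_elim
      case (elim \<omega>)
      then show ?case using B by (intro LIMSEQ_le_const2[OF tendsto_norm[OF elim(1)]]) auto
    qed
    then have "G \<in> Lr (conj_exponent p) \<nu>" using G(1) 1 by (auto simp: Lr_def)
    then show ?thesis using rep[OF G(1,4)] by blast
  next
    case (2 r)
    then obtain M where M: "M \<ge> 0" "weak_dist r M incr" using incr_weak weak_L_iff_dist[of r incr] by auto
    obtain B where B: "\<And>n. integrable \<nu> (\<lambda>\<omega>. cmod (density_at bmass n \<omega>) powr r)"
        "\<And>n. (LINT \<omega>|\<nu>. cmod (density_at bmass n \<omega>) powr r) \<le> B"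
      using density_powr_bound[OF 2(3,4) M] by blast
    have r2: "r \<ge> 2"
    proof -
      have "1 / p > 1 / 2" using p1 p2 by (simp add: field_simps)
      then have "1 / r < 1 / 2" using 2(4) by linarith
      then show ?thesis using 2(3) by (simp add: field_simps)
    qed
    have sq: "t\<^sup>2 \<le> 1 + t powr r" if "t \<ge> 0" for t :: real
    proof (cases "t \<le> 1")
      case True
      then have "t\<^sup>2 \<le> 1" using that by (simp add: power_le_one)
      then show ?thesis by (simp add: add_increasing2)
    next
      case False
      then have "t powr 2 \<le> t powr r" using r2 by (intro powr_mono) auto
      then show ?thesis using False by simp
    qed
    have en: "energy bmass n \<le> 1 + B" for n
    proof -
      have "energy bmass n \<le> (LINT \<omega>|\<nu>. 1 + cmod (density_at bmass n \<omega>) powr r)"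
        unfolding e_int using B(1) by (intro integral_mono e_integrable) (auto intro: sq)
      also have "\<dots> \<le> 1 + B" using B[of n] by (simp add: prob_space)
      finally show ?thesis .
    qed
    obtain G s where G: "integrable \<nu> G" "strict_mono s" "AE \<omega> in \<nu>. (\<lambda>k. density_at bmass (s k) \<omega>) \<longlonglongrightarrow> G \<omega>"
        "\<And>x. mass G x = bmass x"
      by (rule martingale_limit[OF sum_children_bmass en]) (rule that)
    have "integrable \<nu> (\<lambda>\<omega>. cmod (G \<omega>) powr r)"
    proof (rule fatou_integrable(1)[where hs = "\<lambda>k \<omega>. cmod (density_at bmass (s k) \<omega>) powr r" and B = B])
      show "(\<lambda>\<omega>. cmod (G \<omega>) powr r) \<in> borel_measurable \<nu>" using G(1) by measurable
      show "AE \<omega> in \<nu>. (\<lambda>k. cmod (density_at bmass (s k) \<omega>) powr r) \<longlonglongrightarrow> cmod (G \<omega>) powr r"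
        using G(3)
      proof eventually_elim
        case (elim \<omega>)
        then show ?case using 2 by (intro tendsto_powr' tendsto_norm tendsto_const) auto
      qed
    qed (use B in auto)
    then have "G \<in> Lr (conj_exponent p) \<nu>" using G(1) 2 by (auto simp: Lr_def)
    then show ?thesis using rep[OF G(1,4)] by blast
  qed
qed

end
end

section \<open>Orbits of the averaging operators\<close>

context boundary_exponent begin

lemma delta_conj: "delta (conj_exponent p) = 1 / 2 - 1 / p"
  using conj_exponent_cases[OF p1]
proof cases
  case 1
  then show ?thesis by (simp add: delta_def)
next
  case (2 r)
  have "delta (conj_exponent p) = 1 / r - 1 / 2" using 2 by (simp add: delta_def)
  then show ?thesis using 2(4) by simp
qed

definition z1 :: complex where "z1 = \<i> * of_real (delta (conj_exponent p))"
definition z2 :: complex where "z2 = of_real (tau q / 2) + \<i> * of_real (delta (conj_exponent p))"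

lemma exponents:
  "1 / 2 + \<i> * z1 = of_real (1 / p)"
  "1 / 2 - \<i> * z1 = of_real (1 - 1 / p)"
  "1 / 2 + \<i> * z2 = of_real (1 / p) + \<i> * of_real (tau q / 2)"
  "1 / 2 - \<i> * z2 = of_real (1 - 1 / p) - \<i> * of_real (tau q / 2)"
  by (simp_all add: z1_def z2_def delta_conj algebra_simps)

text \<open>
  The imaginary exponent \<open>\<i> * tau q / 2\<close> turns \<open>q\<close> into \<open>exp (\<i> * pi)\<close>.
\<close>

lemma powr_tau:
  "complex_of_real (real q powi e) powr (\<i> * of_real (tau q / 2)) = (- 1) powi e"
proof -
  have lnq: "ln (real q) > 0" using q2 by simp
  have pos: "real q powi e > 0" using q2 by simp
  have lnpow: "ln (real q powi e) = real_of_int e * ln (real q)"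
    using q2 exp_power_int[of "ln (real q)" e] by (metis exp_ln ln_exp of_nat_0_less_iff less_le_trans pos2)
  have "Ln (complex_of_real (real q powi e)) = of_real (real_of_int e * ln (real q))"
    using Ln_of_real[OF pos] unfolding lnpow .
  moreover have "real q powi e \<noteq> 0" using pos by linarith
  ultimately have "complex_of_real (real q powi e) powr (\<i> * of_real (tau q / 2))
      = exp (\<i> * of_real (tau q / 2) * of_real (real_of_int e * ln (real q)))"
    by (simp only: powr_def of_real_eq_0_iff if_False)
  also have "\<i> * of_real (tau q / 2) * of_real (real_of_int e * ln (real q)) = of_int e * (\<i> * complex_of_real pi)"
  proof -
    have "tau q / 2 * (real_of_int e * ln (real q)) = real_of_int e * pi"
      using lnq by (simp add: tau_def)
    then have "complex_of_real (tau q / 2) * of_real (real_of_int e * ln (real q)) = of_int e * of_real pi"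
      by (metis of_real_mult of_real_of_int_eq)
    then show ?thesis by (simp add: mult.assoc mult.left_commute)
  qed
  also have "exp (of_int e * (\<i> * complex_of_real pi)) = exp (\<i> * complex_of_real pi) powi e"
    by (rule exp_power_int[symmetric])
  finally show ?thesis by simp
qed

lemma kernel_powr_z1:
  "complex_of_real (poisson_kernel q E x0 x \<omega>) powr (1 / 2 + \<i> * z1) = of_real (kern a x \<omega>)"
proof -
  let ?e = "2 * int (level (confluent E x0 x \<omega>)) - int (level x)"
  have "(real q powi ?e) powr (1 / p) = (real q powr real_of_int ?e) powr (1 / p)"
  proof -
    have "real q powr real_of_int ?e = real q powi ?e" using q2 by (intro powr_real_of_int') auto
    then show ?thesis by (simp only:)
  qed
  also have "\<dots> = a powr real_of_int ?e" by (simp add: a_def powr_powr mult.commute)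
  also have "\<dots> = kern a x \<omega>" using a_gt_1 unfolding kern_def by (intro powr_real_of_int') auto
  finally have eq: "(real q powi ?e) powr (1 / p) = kern a x \<omega>" .
  have nonneg: "real q powi ?e \<ge> 0" by simp
  show ?thesis unfolding exponents poisson_kernel_def powr_of_real[OF nonneg] eq ..
qed

lemma kernel_powr_z2:
  "complex_of_real (poisson_kernel q E x0 x \<omega>) powr (1 / 2 + \<i> * z2)
    = (- 1) ^ level x * of_real (kern a x \<omega>)"
proof -
  let ?k = "level (confluent E x0 x \<omega>)"
  have "(- 1 :: complex) powi (2 * int ?k - int (level x)) = (- 1) ^ level x"
  proof -
    have "(- 1 :: complex) powi (2 * int ?k - int (level x)) = (- 1) powi (int (2 * ?k)) / (- 1) powi (int (level x))"
      by (simp add: power_int_diff)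
    also have "\<dots> = 1 / (- 1) ^ level x" by (simp only: power_int_of_nat) simp
    finally show ?thesis by (cases "even (level x)") auto
  qed
  then have "complex_of_real (poisson_kernel q E x0 x \<omega>) powr (\<i> * of_real (tau q / 2)) = (- 1) ^ level x"
    unfolding poisson_kernel_def powr_tau .
  then show ?thesis
    using kernel_powr_z1[of x \<omega>] unfolding exponents powr_add by simp
qed

lemma poisson_z1: "poisson q E x0 \<nu> z1 F x = pois a F x"
  unfolding poisson_def pois_def kernel_powr_z1 ..

lemma poisson_z2: "poisson q E x0 \<nu> z2 F x = (- 1) ^ level x * pois a F x"
  unfolding poisson_def pois_def kernel_powr_z2 by (simp add: mult.assoc)

lemma phi_z1: "phi q E x0 \<nu> z1 n = of_real (alpha lam n / real (card (S x0 n)))"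
proof -
  have "poisson q E x0 \<nu> z1 (\<lambda>_. 1) ` S x0 n = {of_real (alpha lam n / real (card (S x0 n)))}"
  proof -
    have "S x0 n \<noteq> {}" using card_sphere_pos[of n] by auto
    moreover have "poisson q E x0 \<nu> z1 (\<lambda>_. 1) x = of_real (alpha lam n / real (card (S x0 n)))" if "x \<in> S x0 n" for x
      using that by (simp add: poisson_z1 pois_one spherical_def mem_sphere)
    ultimately show ?thesis by auto
  qed
  then show ?thesis by (simp add: phi_def)
qed

lemma psi_z1: "psi q E x0 \<nu> z1 n = of_real ((\<Sum>j\<le>n. alpha lam j) / real (card (gball E x0 n)))"
  using card_sphere_pos by (simp add: psi_def phi_z1)

lemma laplacian_eq: "laplacian q E g x = g x - sphere_sum (Suc 0) g x / (of_nat q + 1)"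
  by (simp add: laplacian_def sphere_sum_def gsphere_def)

lemma q1_ne: "of_nat q + 1 \<noteq> (0 :: complex)"
  by (metis Suc_eq_plus1 of_nat_Suc of_nat_eq_0_iff nat.distinct(2) add.commute)

lemma gamma_z1: "gamma q z1 = 1 - of_real lam / (of_nat q + 1)"
proof -
  have r: "complex_of_real (real q) powr of_real t = of_real (real q powr t)" for t
    by (rule powr_of_real) simp
  have "complex_of_real (real q) powr (1 / 2 + \<i> * z1) = complex_of_real a"
      "complex_of_real (real q) powr (1 / 2 - \<i> * z1) = complex_of_real b"
    unfolding exponents a_def b_def r by (rule refl)+
  then show ?thesis by (simp only: gamma_def lam_def of_real_add of_real_of_nat_eq)
qed

lemma gamma_z2: "gamma q z2 = 1 + of_real lam / (of_nat q + 1)"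
proof -
  have r: "complex_of_real (real q) powr of_real t = of_real (real q powr t)" for t
    by (rule powr_of_real) simp
  have t: "complex_of_real (real q) powr (\<i> * of_real (tau q / 2)) = - 1"
    using powr_tau[of 1] by simp
  have "complex_of_real (real q) powr (1 / 2 + \<i> * z2) = - of_real a"
    unfolding exponents powr_add r t by (simp add: a_def)
  moreover have "complex_of_real (real q) powr (1 / 2 - \<i> * z2) = - of_real b"
    unfolding exponents powr_diff[of "complex_of_real (real q)" "of_real (1 - 1 / p)"] r t b_def by simp
  ultimately have "of_nat q powr (1 / 2 + \<i> * z2) + of_nat q powr (1 / 2 - \<i> * z2) = - complex_of_real lam"
    by (simp add: lam_def)
  then show ?thesis unfolding gamma_def by simp
qed

lemma eigenfunction_z1: "eigenfunction q E (gamma q z1) g \<longleftrightarrow> (\<forall>x. sphere_sum (Suc 0) g x = of_real lam * g x)"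
proof -
  have "g x - t / (of_nat q + 1) = (1 - of_real lam / (of_nat q + 1)) * g x \<longleftrightarrow> t = of_real lam * g x" for t x
    using q1_ne by (auto simp: field_simps)
  then show ?thesis unfolding eigenfunction_def laplacian_eq gamma_z1 by blast
qed

lemma eigenfunction_z2: "eigenfunction q E (gamma q z2) g \<longleftrightarrow> (\<forall>x. sphere_sum (Suc 0) g x = - of_real lam * g x)"
proof -
  have "g x - t / (of_nat q + 1) = (1 + of_real lam / (of_nat q + 1)) * g x \<longleftrightarrow> t = - of_real lam * g x" for t x
    using q1_ne by (auto simp: field_simps eq_neg_iff_add_eq_0)
  then show ?thesis unfolding eigenfunction_def laplacian_eq gamma_z2 by blast
qed

lemma unique_rep_z1:
  assumes "g \<in> weak_L (conj_exponent p)" "\<And>x. sphere_sum (Suc 0) g x = of_real lam * g x"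
  shows "unique_poisson_rep q E x0 \<nu> z1 (conj_exponent p) g"
proof -
  obtain G where G: "G \<in> Lr (conj_exponent p) \<nu>" "\<And>x. pois a G x = g x"
    using poisson_representation[OF assms(2,1)] by blast
  have "AE \<omega> in \<nu>. H \<omega> = G \<omega>" if H: "H \<in> Lr (conj_exponent p) \<nu>" "g = poisson q E x0 \<nu> z1 H" for H
  proof (rule pois_inj[OF Lr_integrable[OF H(1)] Lr_integrable[OF G(1)]])
    show "pois a H = pois a G" using H(2) G(2) by (simp add: fun_eq_iff poisson_z1)
  qed
  moreover have "g = poisson q E x0 \<nu> z1 G" using G(2) by (simp add: fun_eq_iff poisson_z1)
  ultimately show ?thesis using G(1) unfolding unique_poisson_rep_def by blast
qed

lemma alternate_weak:
  assumes "g \<in> weak_L (conj_exponent p)"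
  shows "(\<lambda>x. (- 1) ^ level x * g x) \<in> weak_L (conj_exponent p)"
proof (rule weak_L_local[OF p1 assms, of 1])
  fix x
  have "cmod (g x) \<le> (\<Sum>y\<in>gball E x (Suc 0). cmod (g y))"
    by (rule member_le_sum) (auto simp: gball_def finite_ball[unfolded gball_def])
  then show "cmod ((- 1) ^ level x * g x) \<le> 1 * (\<Sum>y\<in>gball E x (Suc 0). cmod (g y))"
    by (simp add: norm_mult norm_power)
qed simp

text \<open>
  Multiplication by the sign of the level exchanges the eigenvalues \<open>lam\<close> and \<open>- lam\<close>, because
  neighbours have levels of different parity, and it turns the kernel for \<open>z1\<close> into that for \<open>z2\<close>.
\<close>

lemma unique_rep_z2:
  assumes "g \<in> weak_L (conj_exponent p)" "\<And>x. sphere_sum (Suc 0) g x = - of_real lam * g x"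
  shows "unique_poisson_rep q E x0 \<nu> z2 (conj_exponent p) g"
proof -
  let ?h = "\<lambda>x. (- 1) ^ level x * g x"
  have inv: "(- 1) ^ level x * ((- 1) ^ level x * w) = (w :: complex)" for x w
    by (simp flip: mult.assoc power_mult_distrib)
  have "sphere_sum (Suc 0) ?h x = of_real lam * ?h x" for x
  proof -
    have "(- 1) ^ level y = - ((- 1 :: complex) ^ level x)" if "E x y" for y
    proof (cases "level x")
      case 0
      then have "x = x0" by (metis dist_eq_0)
      then have "level y = Suc 0" using that by (metis dist_eq_1)
      then show ?thesis using 0 by (simp del: dist_eq_1 dist_eq_0)
    next
      case (Suc n)
      then show ?thesis using parent(2,3)[OF Suc] that by (cases "y = parent x") auto
    qed
    then have "sphere_sum (Suc 0) ?h x = (\<Sum>y\<in>S x (Suc 0). - ((- 1) ^ level x) * g y)"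
      unfolding sphere_sum_def sphere_1 by (intro sum.cong refl) auto
    also have "\<dots> = - ((- 1) ^ level x) * sphere_sum (Suc 0) g x" by (simp add: sphere_sum_def sum_distrib_left)
    finally show ?thesis by (simp add: assms(2) mult.left_commute)
  qed
  from poisson_representation[OF this alternate_weak[OF assms(1)]]
  obtain G where G: "G \<in> Lr (conj_exponent p) \<nu>" "\<And>x. pois a G x = ?h x" by blast
  have "AE \<omega> in \<nu>. H \<omega> = G \<omega>" if H: "H \<in> Lr (conj_exponent p) \<nu>" "g = poisson q E x0 \<nu> z2 H" for H
  proof (rule pois_inj[OF Lr_integrable[OF H(1)] Lr_integrable[OF G(1)]])
    show "pois a H = pois a G"
      unfolding fun_eq_iff G(2) using H(2) by (simp add: poisson_z2 inv)
  qed
  moreover have "g = poisson q E x0 \<nu> z2 G" by (simp add: fun_eq_iff poisson_z2 G(2) inv)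
  ultimately show ?thesis using G(1) unfolding unique_poisson_rep_def by blast
qed

text \<open>
  A sphere of radius \<open>j\<close> contributes at most a multiple of \<open>(q ^ j) powr (1 / p) = a ^ j\<close>, which is the order of growth of \<open>alpha lam j\<close>.
\<close>

lemma mean_bounded_of_weak_norm:
  assumes "M \<ge> 0" "weak_norm (conj_exponent p) g \<le> ennreal M"
  shows "mean_bounded (2 * p * M / (1 - 1 / a\<^sup>2)) g"
  unfolding mean_bounded_def
proof (intro allI)
  fix x j
  have c: "1 - 1 / a\<^sup>2 > 0" using a_gt_1 by simp
  have card: "real (card (S x j)) \<le> 2 * real q ^ j"
  proof (cases j)
    case (Suc k)
    then have "real (card (S x j)) = (real q + 1) * real q ^ k" by (simp add: card_sphere algebra_simps)
    also have "\<dots> \<le> (2 * real q) * real q ^ k" using q2 by (intro mult_right_mono) auto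
    finally show ?thesis using Suc by simp
  qed (simp add: sphere_0)
  have "sphere_sum j (\<lambda>y. cmod (g y)) x \<le> p * M * real (card (S x j)) powr (1 / p)"
    unfolding sphere_sum_def by (rule weak_sum_le[OF p1 assms finite_sphere])
  also have "\<dots> \<le> p * M * (2 * a ^ j)"
  proof (rule mult_left_mono)
    have "real (card (S x j)) powr (1 / p) \<le> (2 * real q ^ j) powr (1 / p)"
      using card p1 by (intro powr_mono2) auto
    also have "\<dots> = 2 powr (1 / p) * a ^ j"
    proof -
      have "(real q ^ j) powr (1 / p) = (real q powr real j) powr (1 / p)" using q2 by (simp add: powr_realpow)
      also have "\<dots> = a powr real j" by (simp add: a_def powr_powr mult.commute)
      also have "\<dots> = a ^ j" using a_gt_1 by (simp add: powr_realpow)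
      finally show ?thesis by (simp add: powr_mult)
    qed
    also have "\<dots> \<le> 2 powr 1 * a ^ j"
      using p1 a_gt_1 by (intro mult_right_mono powr_mono) auto
    finally show "real (card (S x j)) powr (1 / p) \<le> 2 * a ^ j" by simp
  qed (use assms p1 in simp)
  also have "\<dots> = 2 * p * M / (1 - 1 / a\<^sup>2) * jump a j"
  proof -
    have "p * M * (2 * y) = 2 * p * M / t * (y * t)" if "t > 0" for y t :: real
      using that by simp
    from this[OF c, of "a ^ j"] show ?thesis by (simp only: jump_def)
  qed
  also have "\<dots> \<le> 2 * p * M / (1 - 1 / a\<^sup>2) * alpha lam j"
    using alpha_lower[of j] c assms p1 by (intro mult_left_mono) auto
  finally show "sphere_sum j (\<lambda>y. cmod (g y)) x \<le> 2 * p * M / (1 - 1 / a\<^sup>2) * alpha lam j" .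
qed

lemma weak_L_of_weak_norm: "weak_norm r g \<le> ennreal M \<Longrightarrow> g \<in> weak_L r"
  unfolding weak_L_def by (auto intro: le_less_trans)

context
  fixes f :: "int \<Rightarrow> 'v \<Rightarrow> complex" and c :: complex and M :: real and n :: nat
  assumes n1: "n \<ge> 1" and M0: "M \<ge> 0" and f_weak: "\<And>k. weak_norm (conj_exponent p) (f k) \<le> ennreal M"
begin

text \<open>
  A ball average charges the identity and the sum over neighbours directly.
\<close>

theorem ball_average_orbit:
  assumes orbit: "\<And>k x. ball_avg E x0 n (f k) x = c * f (k + 1) x"
    and c: "of_real (cmod c) = psi q E x0 \<nu> z1 n"
  shows "sphere_sum (Suc 0) (f 0) x = of_real lam * f 0 x"
proof -
  define W where "W = (\<Sum>j\<le>n. alpha lam j)"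
  let ?N = "real (card (gball E x0 n))"
  have W: "W > 0" unfolding W_def using alpha_pos by (intro sum_pos) auto
  have N: "?N > 0"
  proof -
    have "x0 \<in> gball E x0 n" by (simp add: gball_def)
    then have "card (gball E x0 n) \<noteq> 0" using finite_ball by (metis card_0_eq empty_iff)
    then show ?thesis by simp
  qed
  have cN: "cmod c = W / ?N" using c unfolding psi_z1 W_def of_real_eq_iff .
  have sum: "(\<Sum>j\<le>n. sphere_sum j (f k) x) = of_real ?N * (c * f (k + 1) x)" for k x
    using orbit[of k x] N by (simp add: ball_avg_def sum_ball sphere_sum_def field_simps)
  have "sphere_sum (Suc 0) (f (- int 0)) x = of_real (alpha lam (Suc 0)) * f (- int 0) x"
  proof (rule liouville[where c = "\<lambda>_. 1 / W" and L = n and \<omega> = "of_real ?N * c / of_real W" and F = "\<lambda>m. f (- int m)"])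
    show "(\<Sum>k\<le>n. 1 / W * alpha lam k) = 1" using W by (simp add: W_def flip: sum_divide_distrib)
    show "mean_bounded (2 * p * M / (1 - 1 / a\<^sup>2)) (f (- int m))" for m
      by (rule mean_bounded_of_weak_norm[OF M0 f_weak])
    show "cmod (of_real ?N * c / of_real W) = 1" using W N by (simp add: norm_mult norm_divide cN)
    show "mix n (\<lambda>_. 1 / W) (f (- int (Suc m))) x = of_real ?N * c / of_real W * f (- int m) x" for m x
      using sum[of "- int (Suc m)" x] by (simp add: mix_def flip: sum_divide_distrib)
  qed (use W n1 in auto)
  then show ?thesis by simp
qed

text \<open>
  One sphere average charges only one sphere, so the orbit is sampled at even times. Its square contains
  the identity and \<open>sphere_sum 2\<close>; squaring is necessary, since for odd \<open>n\<close> the operator has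
  two eigenvalues of maximal modulus.
\<close>

theorem sphere_average_orbit:
  assumes orbit: "\<And>k x. sphere_avg E x0 n (f k) x = c * f (k + 1) x"
    and c: "of_real (cmod c) = phi q E x0 \<nu> z1 n"
  shows "sphere_sum (Suc 0) (sphere_sum (Suc 0) (f 0)) x = of_real (lam\<^sup>2) * f 0 x"
proof -
  let ?N = "real (card (S x0 n))" and ?\<alpha> = "alpha lam n"
  have al: "?\<alpha> > 0" by (rule alpha_pos)
  have N: "?N > 0" using card_sphere_pos[of n] by simp
  have cN: "cmod c = ?\<alpha> / ?N" using c unfolding phi_z1 of_real_eq_iff .
  have step: "sphere_sum n (f k) = (\<lambda>x. of_real ?N * c * f (k + 1) x)" for k
    using orbit[of k] N by (auto simp: sphere_avg_def sphere_sum_def field_simps)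
  have pos: "lin_coeff n n 0 > 0" "lin_coeff n n (Suc (Suc 0)) > 0"
    using n1 lin_coeff_diag_pos[of "n - 1"] by (auto simp: numeral_2_eq_2)
  have "sphere_sum (Suc (Suc 0)) (f (- int (2 * 0))) x = of_real (alpha lam (Suc (Suc 0))) * f (- int (2 * 0)) x"
  proof (rule liouville[where c = "\<lambda>k. real (lin_coeff n n k) / ?\<alpha>\<^sup>2" and L = "n + n"
        and \<omega> = "(of_real ?N * c / of_real ?\<alpha>)\<^sup>2" and F = "\<lambda>m. f (- int (2 * m))"])
    show "(\<Sum>k\<le>n + n. real (lin_coeff n n k) / ?\<alpha>\<^sup>2 * alpha lam k) = 1"
      using alpha_mult[of n n lam] al by (simp add: power2_eq_square flip: sum_divide_distrib)
    show "mean_bounded (2 * p * M / (1 - 1 / a\<^sup>2)) (f (- int (2 * m)))" for m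
      by (rule mean_bounded_of_weak_norm[OF M0 f_weak])
    show "cmod ((of_real ?N * c / of_real ?\<alpha>)\<^sup>2) = 1"
      using al N by (simp add: norm_mult norm_divide norm_power cN)
    show "mix (n + n) (\<lambda>k. real (lin_coeff n n k) / ?\<alpha>\<^sup>2) (f (- int (2 * Suc m))) x
        = (of_real ?N * c / of_real ?\<alpha>)\<^sup>2 * f (- int (2 * m)) x" for m x
    proof -
      have idx: "- int (2 * Suc m) + 1 + 1 = - int (2 * m)" by simp
      have "mix (n + n) (\<lambda>k. real (lin_coeff n n k) / ?\<alpha>\<^sup>2) (f (- int (2 * Suc m))) x
          = sphere_sum n (sphere_sum n (f (- int (2 * Suc m)))) x / of_real (?\<alpha>\<^sup>2)"
        by (simp add: mix_def sphere_sum_mult sum_divide_distrib)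
      also have "sphere_sum n (sphere_sum n (f (- int (2 * Suc m)))) x = (of_real ?N * c)\<^sup>2 * f (- int (2 * m)) x"
        unfolding step sphere_sum_cmult idx by (simp only: power2_eq_square mult.assoc)
      finally show ?thesis by (simp add: power_divide power_mult_distrib)
    qed
  qed (use al n1 pos in auto)
  then have "sphere_sum (Suc (Suc 0)) (f 0) x = of_real (lam\<^sup>2 - real (q + 1)) * f 0 x"
    by (simp add: backdeg_def power2_eq_square)
  then show ?thesis by (simp add: sphere_sum_1_mult backdeg_def algebra_simps)
qed

end

text \<open>
  The two parts of \<open>g\<close> are its projections \<open>half 1\<close> and \<open>half (- 1)\<close> to the eigenspaces of
  \<open>lam\<close> and \<open>- lam\<close>. They are given by local formulas, so they inherit the weak type of \<open>g\<close>.
\<close>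

theorem square_eigen_decomposition:
  assumes weak: "g \<in> weak_L (conj_exponent p)"
    and sq: "\<And>x. sphere_sum (Suc 0) (sphere_sum (Suc 0) g) x = of_real (lam\<^sup>2) * g x"
  shows "\<exists>g1 g2. decomposition q E (conj_exponent p) z1 z2 g g1 g2 \<and>
     (\<forall>h1 h2. decomposition q E (conj_exponent p) z1 z2 g h1 h2 \<longrightarrow> h1 = g1 \<and> h2 = g2) \<and>
     unique_poisson_rep q E x0 \<nu> z1 (conj_exponent p) g1 \<and>
     unique_poisson_rep q E x0 \<nu> z2 (conj_exponent p) g2"
proof -
  have l0: "complex_of_real lam \<noteq> 0" using lam_pos by simp
  define half where "half s = (\<lambda>x. (1 / 2) * g x + (s / (2 * of_real lam)) * sphere_sum (Suc 0) g x)" for s :: complex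
  have A_half: "sphere_sum (Suc 0) (half s) x = s * of_real lam * half s x" if "s * s = 1" for s x
  proof -
    have "sphere_sum (Suc 0) (half s) x = sphere_sum (Suc 0) g x / 2 + s * of_real lam / 2 * g x"
      unfolding half_def sphere_sum_add sphere_sum_cmult sq using l0 by (simp add: power2_eq_square)
    also have "\<dots> = s * of_real lam * half s x"
    proof -
      have "s * L * ((1 / 2) * G + (s / (2 * L)) * H) = s * L / 2 * G + (s * s) * H / 2"
        if "L \<noteq> 0" for L G H :: complex
        using that by (simp add: field_simps)
      from this[OF l0, of "g x" "sphere_sum (Suc 0) g x"] show ?thesis
        unfolding half_def that by simp
    qed
    finally show ?thesis .
  qed
  have half_weak: "half s \<in> weak_L (conj_exponent p)" if "cmod s = 1" for s
  proof (rule weak_L_local[OF p1 weak, of "1 / 2 + 1 / (2 * lam)"])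
    fix x
    let ?B = "\<Sum>y\<in>gball E x (Suc 0). cmod (g y)"
    have 1: "cmod (g x) \<le> ?B"
      by (rule member_le_sum) (auto simp: gball_def finite_ball[unfolded gball_def])
    have "cmod (sphere_sum (Suc 0) g x) \<le> sphere_sum (Suc 0) (\<lambda>y. cmod (g y)) x" by (rule norm_sphere_sum_le)
    also have "\<dots> \<le> ?B"
      unfolding sphere_sum_def by (intro sum_mono2 finite_ball) (auto simp: gball_def gsphere_def simp del: dist_eq_1)
    finally have 2: "cmod (sphere_sum (Suc 0) g x) \<le> ?B" .
    have "cmod (half s x) \<le> 1 / 2 * cmod (g x) + 1 / (2 * lam) * cmod (sphere_sum (Suc 0) g x)"
      unfolding half_def using lam_pos that
      by (intro order_trans[OF norm_triangle_ineq]) (simp add: norm_mult norm_divide)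
    also have "\<dots> \<le> 1 / 2 * ?B + 1 / (2 * lam) * ?B"
      using 1 2 lam_pos by (intro add_mono mult_left_mono) auto
    finally show "cmod (half s x) \<le> (1 / 2 + 1 / (2 * lam)) * ?B" by (simp only: distrib_right)
  qed (use lam_pos in \<open>simp add: add_pos_pos\<close>)
  have eigen: "sphere_sum (Suc 0) (half 1) x = of_real lam * half 1 x" "sphere_sum (Suc 0) (half (- 1)) x = - of_real lam * half (- 1) x" for x
    using A_half[of 1 x] A_half[of "- 1" x] by simp_all
  have "decomposition q E (conj_exponent p) z1 z2 g (half 1) (half (- 1))"
    unfolding decomposition_def eigenfunction_z1 eigenfunction_z2
  proof (intro conjI allI eigen half_weak)
    show "g x = half 1 x + half (- 1) x" for x by (simp add: half_def)
  qed simp_all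
  moreover have "h1 = half 1 \<and> h2 = half (- 1)" if "decomposition q E (conj_exponent p) z1 z2 g h1 h2" for h1 h2
  proof -
    have g: "g = (\<lambda>x. h1 x + h2 x)" using that by (auto simp: decomposition_def)
    have Ag: "sphere_sum (Suc 0) g x = of_real lam * h1 x - of_real lam * h2 x" for x
      using that unfolding g sphere_sum_add decomposition_def eigenfunction_z1 eigenfunction_z2 by simp
    have "half 1 x = h1 x" "half (- 1) x = h2 x" for x
      unfolding half_def Ag using l0 by (simp_all add: fun_cong[OF g] field_simps)
    then show ?thesis by (simp add: fun_eq_iff)
  qed
  moreover have "unique_poisson_rep q E x0 \<nu> z1 (conj_exponent p) (half 1)"
    by (rule unique_rep_z1[OF half_weak eigen(1)]) simp
  moreover have "unique_poisson_rep q E x0 \<nu> z2 (conj_exponent p) (half (- 1))"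
    by (rule unique_rep_z2[OF half_weak eigen(2)]) simp
  ultimately show ?thesis by blast
qed

end

theorem corollary5p4:
  fixes E :: "'v \<Rightarrow> 'v \<Rightarrow> bool" and x0 :: 'v and \<nu> :: "(nat \<Rightarrow> 'v) measure"
    and q n :: nat and p M :: real and A z1 z2 :: complex
    and \<Lambda> :: "('v \<Rightarrow> complex) \<Rightarrow> 'v \<Rightarrow> complex"
    and f :: "int \<Rightarrow> 'v \<Rightarrow> complex"
  assumes "q \<ge> 2" and "homogeneous_tree q E" and "boundary_measure q E x0 \<nu>"
    and "n \<ge> 1" and "1 \<le> p" and "p < 2"
    and "\<Lambda> = sphere_avg E x0 n \<or> \<Lambda> = ball_avg E x0 n"
    and "A \<noteq> 0" and "\<And>k x. \<Lambda> (f k) x = A * f (k + 1) x"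
    and "M > 0" and "\<And>k. weak_norm (conj_exponent p) (f k) \<le> ennreal M"
    and "z1 = \<i> * of_real (delta (conj_exponent p))"
    and "z2 = of_real (tau q / 2) + \<i> * of_real (delta (conj_exponent p))"
  shows "(\<Lambda> = sphere_avg E x0 n \<and> of_real (cmod A) = phi q E x0 \<nu> z1 n \<longrightarrow>
            (\<exists>g1 g2. decomposition q E (conj_exponent p) z1 z2 (f 0) g1 g2 \<and>
               (\<forall>h1 h2. decomposition q E (conj_exponent p) z1 z2 (f 0) h1 h2 \<longrightarrow>
                  h1 = g1 \<and> h2 = g2) \<and>
               unique_poisson_rep q E x0 \<nu> z1 (conj_exponent p) g1 \<and>
               unique_poisson_rep q E x0 \<nu> z2 (conj_exponent p) g2)) \<and>
         (\<Lambda> = ball_avg E x0 n \<and> of_real (cmod A) = psi q E x0 \<nu> z1 n \<longrightarrow>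
            eigenfunction q E (gamma q z1) (f 0) \<and>
            unique_poisson_rep q E x0 \<nu> z1 (conj_exponent p) (f 0))"
proof -
  interpret T: boundary_exponent q E x0 \<nu> p
    by unfold_locales (fact assms)+
  have z: "z1 = T.z1" "z2 = T.z2" using assms(12,13) by (simp_all add: T.z1_def T.z2_def)
  have M: "M \<ge> 0" using assms(10) by simp
  note orbit = assms(9)
  have weak: "f 0 \<in> weak_L (conj_exponent p)" by (rule T.weak_L_of_weak_norm[OF assms(11)])
  show ?thesis
  proof (intro conjI impI; elim conjE)
    assume \<Lambda>: "\<Lambda> = sphere_avg E x0 n" and A: "of_real (cmod A) = phi q E x0 \<nu> z1 n"
    have "T.sphere_sum (Suc 0) (T.sphere_sum (Suc 0) (f 0)) x = of_real (T.lam\<^sup>2) * f 0 x" for x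
      using T.sphere_average_orbit[where n = n and M = M and f = f and c = A, OF assms(4) M assms(11) orbit[unfolded \<Lambda>] A[unfolded z]] .
    from T.square_eigen_decomposition[OF weak this] show
      "\<exists>g1 g2. decomposition q E (conj_exponent p) z1 z2 (f 0) g1 g2 \<and>
               (\<forall>h1 h2. decomposition q E (conj_exponent p) z1 z2 (f 0) h1 h2 \<longrightarrow>
                  h1 = g1 \<and> h2 = g2) \<and>
               unique_poisson_rep q E x0 \<nu> z1 (conj_exponent p) g1 \<and>
               unique_poisson_rep q E x0 \<nu> z2 (conj_exponent p) g2"
      unfolding z .
  next
    assume \<Lambda>: "\<Lambda> = ball_avg E x0 n" and A: "of_real (cmod A) = psi q E x0 \<nu> z1 n"
    have eig: "T.sphere_sum (Suc 0) (f 0) x = of_real T.lam * f 0 x" for x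
      using T.ball_average_orbit[where n = n and M = M and f = f and c = A, OF assms(4) M assms(11) orbit[unfolded \<Lambda>] A[unfolded z]] .
    then show "eigenfunction q E (gamma q z1) (f 0)" unfolding z T.eigenfunction_z1 by blast
    show "unique_poisson_rep q E x0 \<nu> z1 (conj_exponent p) (f 0)"
      unfolding z by (rule T.unique_rep_z1[OF weak eig])
  qed
qed

end
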